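(* There is an algorithm which, given a cyclically reduced word $w$ of length $n$ in $F(a,b)$, outputs the fully expanded trace polynomial $f_w(x,y,z)\in\mathbb Z[x,y,z]$ in deterministic Turing-machine time $O(n^5)$ and space $O(n^4)$. Here the output is given in the dense coefficient-table representation, in which the output itself has $O(n^4)$ bits.
   Context: $F(a,b)$ is the free group on $a,b$. A word over $\{a,a^{-1},b,b^{-1}\}$ is cyclically reduced if it is freely reduced and its last letter is not the inverse of its first letter. For $w\in F(a,b)$ and $A,B\in \mathrm{SL}(2,\mathbb C)$, $w(A,B)$ denotes the image of $w$ under $a\mapsto A$, $b\mapsto B$. The trace polynomial $f_w(x,y,z)\in\mathbb Z[x,y,z]$ is the unique polynomial such that $\mathrm{Tr}(w(A,B))=f_w(\mathrm{Tr}A,\mathrm{Tr}B,\mathrm{Tr}(AB))$ for all $A,B\in \mathrm{SL}(2,\mathbb C)$ (its existence and uniqueness are classical); it has total degree at most $n$ when $w$ has length $n$. Dense coefficient-table representation: a polynomial of total degree at most $n$ in $x,y,z$ is represented by an array with one integer entry, written in binary with sign, for every triple $(i,j,k)\in\mathbb Z_{\ge 0}^3$ with $i+j+k\le n$, the entry being the coefficient of $x^iy^jz^k$, even when it is $0$. *)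

theory Defs
  imports "HOL-Analysis.Analysis" "HOL-Library.Poly_Mapping" "HOL-Library.Product_Plus"
    "HOL-Library.Landau_Symbols"
begin

section \<open>Words in the free group on two generators\<close>

datatype letter = Let_a | Let_a_inv | Let_b | Let_b_inv

fun letter_inv :: "letter \<Rightarrow> letter" where
  "letter_inv Let_a = Let_a_inv"
| "letter_inv Let_a_inv = Let_a"
| "letter_inv Let_b = Let_b_inv"
| "letter_inv Let_b_inv = Let_b"

definition freely_reduced :: "letter list \<Rightarrow> bool" where
  "freely_reduced w \<longleftrightarrow> successively (\<lambda>u v. v \<noteq> letter_inv u) w"

definition cyclically_reduced :: "letter list \<Rightarrow> bool" where
  "cyclically_reduced w \<longleftrightarrow>
     freely_reduced w \<and> (w \<noteq> [] \<longrightarrow> last w \<noteq> letter_inv (hd w))"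


section \<open>Trace polynomials\<close>

definition SL2 :: "(complex ^ 2 ^ 2) set" where
  "SL2 = {A. det A = 1}"

fun letter_eval :: "complex ^ 2 ^ 2 \<Rightarrow> complex ^ 2 ^ 2 \<Rightarrow> letter \<Rightarrow> complex ^ 2 ^ 2" where
  "letter_eval A B Let_a = A"
| "letter_eval A B Let_a_inv = matrix_inv A"
| "letter_eval A B Let_b = B"
| "letter_eval A B Let_b_inv = matrix_inv B"

fun word_eval :: "complex ^ 2 ^ 2 \<Rightarrow> complex ^ 2 ^ 2 \<Rightarrow> letter list \<Rightarrow> complex ^ 2 ^ 2" where
  "word_eval A B [] = mat 1"
| "word_eval A B (l # w) = letter_eval A B l ** word_eval A B w"

text \<open>The polynomial ring over the integers in \<open>x\<close>, \<open>y\<close>, \<open>z\<close> is the monoid ring of triples of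
  natural numbers under componentwise addition: \<open>lookup f (i, j, k)\<close> is the coefficient of
  \<open>x ^ i * y ^ j * z ^ k\<close>.\<close>

type_synonym int_poly3 = "(nat \<times> nat \<times> nat) \<Rightarrow>\<^sub>0 int"

definition poly3 :: "int_poly3 \<Rightarrow> complex \<Rightarrow> complex \<Rightarrow> complex \<Rightarrow> complex" where
  "poly3 f x y z =
     (\<Sum>(i, j, k) \<in> Poly_Mapping.keys f.
        of_int (Poly_Mapping.lookup f (i, j, k)) * x ^ i * y ^ j * z ^ k)"

definition is_trace_poly :: "letter list \<Rightarrow> int_poly3 \<Rightarrow> bool" where
  "is_trace_poly w f \<longleftrightarrow>
     (\<forall>A \<in> SL2. \<forall>B \<in> SL2.
        trace (word_eval A B w) = poly3 f (trace A) (trace B) (trace (A ** B)))"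

text \<open>The description is proper, see \<open>ex1_is_trace_poly\<close> below.\<close>

definition trace_poly :: "letter list \<Rightarrow> int_poly3" where
  "trace_poly w = (THE f. is_trace_poly w f)"


section \<open>Deterministic multitape Turing machines\<close>

text \<open>The tape alphabet of a machine is a finite subset of this type; \<open>Aux\<close> provides arbitrarily
  many additional work symbols.\<close>

datatype symbol = Blank | Letter letter | Plus | Minus | Bit bool | Sep | Aux nat

datatype move = Move_left | Stay | Move_right

fun move_offset :: "move \<Rightarrow> int" where
  "move_offset Move_left = -1"
| "move_offset Stay = 0"
| "move_offset Move_right = 1"

record tm =
  n_tapes :: nat
  states :: "nat set"
  alphabet :: "symbol set"
  start_state :: nat
  halt_state :: nat
  delta :: "nat \<Rightarrow> symbol list \<Rightarrow> nat \<times> (symbol \<times> move) list"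

text \<open>Tape 0 is the input tape and tape 1 the output tape.\<close>

definition valid_tm :: "tm \<Rightarrow> bool" where
  "valid_tm M \<longleftrightarrow>
     n_tapes M \<ge> 2 \<and> finite (states M) \<and> finite (alphabet M) \<and>
     start_state M \<in> states M \<and> halt_state M \<in> states M \<and>
     Blank \<in> alphabet M \<and> range Letter \<subseteq> alphabet M \<and>
     (\<forall>q \<in> states M. \<forall>rd. length rd = n_tapes M \<and> set rd \<subseteq> alphabet M \<longrightarrow>
        fst (delta M q rd) \<in> states M \<and>
        length (snd (delta M q rd)) = n_tapes M \<and>
        fst ` set (snd (delta M q rd)) \<subseteq> alphabet M)"

text \<open>Tapes are infinite in both directions.\<close>

type_synonym tape = "int \<Rightarrow> symbol"

record config =
  state :: nat
  heads :: "int list"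
  tapes :: "tape list"

definition blank_tape :: tape where
  "blank_tape = (\<lambda>_. Blank)"

definition tape_of :: "symbol list \<Rightarrow> tape" where
  "tape_of xs = (\<lambda>p. if 0 \<le> p \<and> p < int (length xs) then xs ! nat p else Blank)"

definition init_config :: "tm \<Rightarrow> symbol list \<Rightarrow> config" where
  "init_config M inp =
     \<lparr> state = start_state M,
       heads = replicate (n_tapes M) 0,
       tapes = tape_of inp # replicate (n_tapes M - 1) blank_tape \<rparr>"

definition read_symbols :: "config \<Rightarrow> symbol list" where
  "read_symbols c = map2 (\<lambda>h t. t h) (heads c) (tapes c)"

definition step :: "tm \<Rightarrow> config \<Rightarrow> config" where
  "step M c =
     (if state c = halt_state M then c
      else let (q, acts) = delta M (state c) (read_symbols c) in
        \<lparr> state = q,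
          heads = map2 (\<lambda>h (s, m). h + move_offset m) (heads c) acts,
          tapes = map2 (\<lambda>(h, t) (s, m). t(h := s)) (zip (heads c) (tapes c)) acts \<rparr>)"

definition run :: "tm \<Rightarrow> symbol list \<Rightarrow> nat \<Rightarrow> config" where
  "run M inp t = (step M ^^ t) (init_config M inp)"

text \<open>Number of cells scanned on all tapes, the input and output tapes included, in the first
  \<open>t\<close> steps.\<close>

definition space_used :: "tm \<Rightarrow> symbol list \<Rightarrow> nat \<Rightarrow> nat" where
  "space_used M inp t =
     (\<Sum>i < n_tapes M. card ((\<lambda>t'. heads (run M inp t') ! i) ` {..t}))"

definition computes_within :: "tm \<Rightarrow> symbol list \<Rightarrow> symbol list \<Rightarrow> nat \<Rightarrow> nat \<Rightarrow> bool" where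
  "computes_within M inp out tb sb \<longleftrightarrow>
     (\<exists>t \<le> tb. state (run M inp t) = halt_state M \<and>
        tapes (run M inp t) ! 1 = tape_of out \<and>
        space_used M inp t \<le> sb)"


section \<open>Dense coefficient tables\<close>

text \<open>Most significant bit first, without leading zeros; zero is the single bit 0.\<close>

fun binary :: "nat \<Rightarrow> symbol list" where
  "binary m = (if m < 2 then [Bit (m = 1)] else binary (m div 2) @ [Bit (odd m)])"

declare binary.simps [simp del]

definition table_entry :: "int \<Rightarrow> symbol list" where
  "table_entry c = (if c < 0 then Minus else Plus) # binary (nat \<bar>c\<bar>) @ [Sep]"

text \<open>The index triples in lexicographic order; an entry is identified by its position.\<close>

definition triples :: "nat \<Rightarrow> (nat \<times> nat \<times> nat) list" where
  "triples n = [(i, j, k). i \<leftarrow> [0..<Suc n], j \<leftarrow> [0..<Suc (n - i)], k \<leftarrow> [0..<Suc (n - i - j)]]"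

definition dense_table :: "nat \<Rightarrow> int_poly3 \<Rightarrow> symbol list" where
  "dense_table n f = concat (map (\<lambda>t. table_entry (Poly_Mapping.lookup f t)) (triples n))"

lemma set_triples: "set (triples n) = {(i, j, k). i + j + k \<le> n}"
proof -
  have "set (triples n) =
      (\<Union>i \<in> {0..<Suc n}. \<Union>j \<in> {0..<Suc (n - i)}. (\<lambda>k. (i, j, k)) ` {0..<Suc (n - i - j)})"
    by (simp only: triples_def set_concat set_map set_upt image_image)
  also have "\<dots> = {(i, j, k). i + j + k \<le> n}"
  proof (intro equalityI subsetI)
    fix t assume "t \<in> {(i, j, k). i + j + k \<le> n}"
    then obtain i j k where "t = (i, j, k)" "i + j + k \<le> n" by auto
    then have "i \<in> {0..<Suc n}" "j \<in> {0..<Suc (n - i)}"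
      "t \<in> (\<lambda>k. (i, j, k)) ` {0..<Suc (n - i - j)}" by auto
    then show "t \<in> (\<Union>i \<in> {0..<Suc n}. \<Union>j \<in> {0..<Suc (n - i)}.
        (\<lambda>k. (i, j, k)) ` {0..<Suc (n - i - j)})" by blast
  qed auto
  finally show ?thesis .
qed

lemma distinct_triples: "distinct (triples n)"
proof -
  have *: "distinct (concat (map f xs))"
    if "distinct xs" "\<And>x. distinct (f x)" "\<And>x y. x \<noteq> y \<Longrightarrow> set (f x) \<inter> set (f y) = {}"
    for f :: "nat \<Rightarrow> (nat \<times> nat \<times> nat) list" and xs
    using that(1)
  proof (induction xs)
    case (Cons x xs)
    then have "set (f x) \<inter> set (f y) = {}" if "y \<in> set xs" for y
      using that \<open>\<And>x y. x \<noteq> y \<Longrightarrow> set (f x) \<inter> set (f y) = {}\<close>[of x y] by auto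
    with Cons show ?case using that(2) by auto
  qed simp
  show ?thesis unfolding triples_def
    by (intro * distinct_upt) (auto simp: distinct_map inj_on_def simp del: upt_Suc)
qed

section \<open>Existence, uniqueness and degree of the trace polynomial\<close>

text \<open>\<open>F\<close> is given by an integer polynomial of total degree less than \<open>n\<close>; for \<open>n = 0\<close> this
  leaves only the zero polynomial.\<close>

definition repr3 :: "nat \<Rightarrow> (complex \<Rightarrow> complex \<Rightarrow> complex \<Rightarrow> complex) \<Rightarrow> bool" where
  "repr3 n F \<longleftrightarrow> (\<exists>f. Poly_Mapping.keys f \<subseteq> {(i, j, k). i + j + k < n} \<and>
     (\<forall>x y z. poly3 f x y z = F x y z))"

lemma poly3_superset:
  assumes "finite S" "Poly_Mapping.keys f \<subseteq> S"
  shows "poly3 f x y z =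
    (\<Sum>(i, j, k) \<in> S. of_int (Poly_Mapping.lookup f (i, j, k)) * x ^ i * y ^ j * z ^ k)"
  unfolding poly3_def using assms
  by (intro sum.mono_neutral_left) (auto simp: in_keys_iff)

lemma poly3_add: "poly3 (f + g) x y z = poly3 f x y z + poly3 g x y z"
proof -
  let ?S = "Poly_Mapping.keys f \<union> Poly_Mapping.keys g"
  have k: "Poly_Mapping.keys (f + g) \<subseteq> ?S" by (rule Poly_Mapping.keys_add)
  show ?thesis
    by (subst (1 2 3) poly3_superset[of ?S])
       (use k in \<open>auto simp: lookup_add algebra_simps sum.distrib[symmetric] intro!: sum.cong\<close>)
qed

lemma repr3_add: "repr3 n F \<Longrightarrow> repr3 n G \<Longrightarrow> repr3 n (\<lambda>x y z. F x y z + G x y z)"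
  unfolding repr3_def using Poly_Mapping.keys_add poly3_add by (metis (no_types, lifting) le_sup_iff order_trans)

lemma repr3_mono: "repr3 n F \<Longrightarrow> n \<le> m \<Longrightarrow> repr3 m F"
proof -
  assume "repr3 n F" "n \<le> m"
  then obtain f where "Poly_Mapping.keys f \<subseteq> {(i, j, k). i + j + k < n}"
    "\<forall>x y z. poly3 f x y z = F x y z" unfolding repr3_def by blast
  moreover have "{(i, j, k). i + j + k < n} \<subseteq> {(i, j, k). i + j + k < m}"
    using \<open>n \<le> m\<close> by auto
  ultimately show "repr3 m F" unfolding repr3_def by (meson order_trans)
qed

lemma repr3_monom:
  assumes "i + j + k < n"
  shows "repr3 n (\<lambda>x y z. of_int c * x ^ i * y ^ j * z ^ k)"
proof -
  have "poly3 (Poly_Mapping.single (i, j, k) c) x y z = of_int c * x ^ i * y ^ j * z ^ k" for x y z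
    by (subst poly3_superset[of "{(i,j,k)}"]) auto
  then show ?thesis unfolding repr3_def
    using assms by (intro exI[of _ "Poly_Mapping.single (i, j, k) c"]) auto
qed

lemma repr3_0: "repr3 n (\<lambda>x y z. 0)"
  unfolding repr3_def poly3_def by (intro exI[of _ 0]) auto

lemma repr3_sum:
  assumes "\<And>s. s \<in> S \<Longrightarrow> repr3 n (F s)"
  shows "repr3 n (\<lambda>x y z. \<Sum>s\<in>S. F s x y z)"
  using assms by (induction S rule: infinite_finite_induct) (auto intro: repr3_0 repr3_add)

lemma repr3_mult_monom:
  assumes "repr3 n F" "n + (a + b + d) \<le> m"
  shows "repr3 m (\<lambda>x y z. of_int c * x ^ a * y ^ b * z ^ d * F x y z)"
proof -
  obtain f where f: "Poly_Mapping.keys f \<subseteq> {(i, j, k). i + j + k < n}"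
    "\<And>x y z. poly3 f x y z = F x y z" using assms unfolding repr3_def by auto
  have "repr3 m (\<lambda>x y z. \<Sum>s\<in>Poly_Mapping.keys f. case s of (i, j, k) \<Rightarrow>
      of_int (c * Poly_Mapping.lookup f (i, j, k)) * x ^ (a + i) * y ^ (b + j) * z ^ (d + k))"
  proof (rule repr3_sum)
    fix s assume s: "s \<in> Poly_Mapping.keys f"
    obtain i j k where [simp]: "s = (i, j, k)" by (cases s)
    show "repr3 m (\<lambda>x y z. case s of (i, j, k) \<Rightarrow>
      of_int (c * Poly_Mapping.lookup f (i, j, k)) * x ^ (a + i) * y ^ (b + j) * z ^ (d + k))"
      using s f(1) assms(2) unfolding \<open>s = _\<close> prod.case by (intro repr3_monom) auto
  qed
  also have "(\<lambda>x y z. \<Sum>s\<in>Poly_Mapping.keys f. case s of (i, j, k) \<Rightarrow>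
      of_int (c * Poly_Mapping.lookup f (i, j, k)) * x ^ (a + i) * y ^ (b + j) * z ^ (d + k))
      = (\<lambda>x y z. of_int c * x ^ a * y ^ b * z ^ d * F x y z)"
    unfolding f(2)[symmetric] poly3_def sum_distrib_left
    by (intro ext sum.cong) (auto simp: power_add algebra_simps)
  finally show ?thesis .
qed

lemma repr3_x: "repr3 n F \<Longrightarrow> Suc n \<le> m \<Longrightarrow> repr3 m (\<lambda>x y z. x * F x y z)"
  using repr3_mult_monom[of n F 1 0 0 m 1] by simp

lemma repr3_y: "repr3 n F \<Longrightarrow> Suc n \<le> m \<Longrightarrow> repr3 m (\<lambda>x y z. y * F x y z)"
  using repr3_mult_monom[of n F 0 1 0 m 1] by simp

lemma repr3_z: "repr3 n F \<Longrightarrow> Suc n \<le> m \<Longrightarrow> repr3 m (\<lambda>x y z. z * F x y z)"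
  using repr3_mult_monom[of n F 0 0 1 m 1] by simp

lemma repr3_xy: "repr3 n F \<Longrightarrow> Suc (Suc n) \<le> m \<Longrightarrow> repr3 m (\<lambda>x y z. x * y * F x y z)"
  using repr3_mult_monom[of n F 1 1 0 m 1] by simp

lemma repr3_minus: "repr3 n F \<Longrightarrow> repr3 n (\<lambda>x y z. - F x y z)"
  using repr3_mult_monom[of n F 0 0 0 n "-1"] by simp

lemma repr3_diff: "repr3 n F \<Longrightarrow> repr3 n G \<Longrightarrow> repr3 n (\<lambda>x y z. F x y z - G x y z)"
  using repr3_add[of n F "\<lambda>x y z. - G x y z"] repr3_minus[of n G] by simp

lemma matrix_inv_SL2:
  assumes "A \<in> SL2"
  shows "matrix_inv A = mat (trace A) - A"
proof -
  have d: "A $ 1 $ 1 * A $ 2 $ 2 - A $ 1 $ 2 * A $ 2 $ 1 = 1"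
    using assms by (simp add: SL2_def det_2)
  have l: "A ** (mat (trace A) - A) = mat 1"
    using d by (simp add: vec_eq_iff matrix_matrix_mult_def mat_def trace_def forall_2 sum_2 algebra_simps)
  have r: "(mat (trace A) - A) ** A = mat 1"
    using d by (simp add: vec_eq_iff matrix_matrix_mult_def mat_def trace_def forall_2 sum_2 algebra_simps)
  have "A ** matrix_inv A = mat 1 \<and> matrix_inv A ** A = mat 1"
    unfolding matrix_inv_def by (rule someI[of _ "mat (trace A) - A"]) (simp add: l r)
  then show ?thesis
    by (metis l matrix_mul_assoc matrix_mul_lid matrix_mul_rid)
qed

definition comb :: "complex ^ 2 ^ 2 \<Rightarrow> complex ^ 2 ^ 2 \<Rightarrow> complex \<Rightarrow> complex \<Rightarrow> complex \<Rightarrow> complex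
  \<Rightarrow> complex ^ 2 ^ 2" where
  "comb A B p q r s = mat p + mat q ** A + mat r ** B + mat s ** (A ** B)"

lemma comb_entry:
  "comb A B p q r s $ i $ j = (if i = j then p else 0) + q * A $ i $ j + r * B $ i $ j
     + s * (A $ i $ 1 * B $ 1 $ j + A $ i $ 2 * B $ 2 $ j)"
  using exhaust_2[of i] exhaust_2[of j]
  by (auto simp: comb_def matrix_matrix_mult_def mat_def sum_2)

lemma comb_b:
  assumes "A \<in> SL2" "B \<in> SL2"
  shows "B ** comb A B p q r s =
    (let x = trace A; y = trace B; z = trace (A ** B) in
     comb A B (- r + q * (z - x * y) - x * s) (q * y + s) (p + r * y + q * x + s * z) (- q))"
    (is "?L = ?R")
proof -
  have d: "1 - (B $ 1 $ 1 * B $ 2 $ 2 - B $ 1 $ 2 * B $ 2 $ 1) = 0"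
    using assms by (simp add: SL2_def det_2)
  have "?L $ i $ j = ?R $ i $ j + (1 - (B $ 1 $ 1 * B $ 2 $ 2 - B $ 1 $ 2 * B $ 2 $ 1)) *
      ((if i = j then r + s * trace A else 0) - s * A $ i $ j)" for i j
    using exhaust_2[of i] exhaust_2[of j]
    by (auto simp: Let_def comb_entry matrix_matrix_mult_def[of B] matrix_matrix_mult_def[of A]
          sum_2 trace_def algebra_simps)
  then show ?thesis unfolding d by (simp add: vec_eq_iff)
qed

lemma comb_a:
  assumes "A \<in> SL2" "B \<in> SL2"
  shows "A ** comb A B p q r s =
    (let x = trace A in comb A B (- q) (p + x * q) (- s) (r + x * s))"
    (is "?L = ?R")
proof -
  have d: "1 - (A $ 1 $ 1 * A $ 2 $ 2 - A $ 1 $ 2 * A $ 2 $ 1) = 0"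
    using assms by (simp add: SL2_def det_2)
  have "?L $ i $ j = ?R $ i $ j + (1 - (A $ 1 $ 1 * A $ 2 $ 2 - A $ 1 $ 2 * A $ 2 $ 1)) *
      ((if i = j then q else 0) + s * B $ i $ j)" for i j
    using exhaust_2[of i] exhaust_2[of j]
    by (auto simp: Let_def comb_entry matrix_matrix_mult_def[of A] sum_2 trace_def algebra_simps)
  then show ?thesis unfolding d by (simp add: vec_eq_iff)
qed

lemma comb_diff:
  "mat t ** comb A B p q r s - comb A B p' q' r' s' =
     comb A B (t * p - p') (t * q - q') (t * r - r') (t * s - s')"
proof -
  have "(mat t ** X) $ i $ j = t * X $ i $ j" for X :: "complex ^ 2 ^ 2" and i j
    using exhaust_2[of i] by (auto simp: matrix_matrix_mult_def mat_def sum_2)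
  then show ?thesis
    by (simp add: vec_eq_iff comb_entry algebra_simps)
qed

lemma mat2_diff_mult: "(X - Y) ** Z = X ** Z - Y ** Z" for X Y Z :: "complex ^ 2 ^ 2"
  by (simp add: vec_eq_iff matrix_matrix_mult_def sum_2 algebra_simps)

lemma trace_comb: "trace (comb A B p q r s) = 2 * p + trace A * q + trace B * r + trace (A ** B) * s"
  by (simp add: trace_def comb_entry sum_2 matrix_matrix_mult_def algebra_simps)


lemma word_eval_comb:
  "\<exists>p q r s. repr3 (Suc (length w)) p \<and> repr3 (length w) q \<and> repr3 (length w) r \<and>
     repr3 (length w) s \<and>
     (\<forall>A \<in> SL2. \<forall>B \<in> SL2. word_eval A B w = (let x = trace A; y = trace B; z = trace (A ** B)
        in comb A B (p x y z) (q x y z) (r x y z) (s x y z)))"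
proof (induction w)
  case Nil
  have "comb A B 1 0 0 0 = mat 1" for A B
    by (simp add: vec_eq_iff comb_entry mat_def)
  then show ?case
    using repr3_monom[of 0 0 0 1 1]
    by (intro exI[of _ "\<lambda>x y z. 1"] exI[of _ "\<lambda>x y z. 0"]) (auto intro: repr3_0)
next
  case (Cons l w)
  then obtain p q r s where
    p: "repr3 (Suc (length w)) p" and q: "repr3 (length w) q" and r: "repr3 (length w) r" and
    s: "repr3 (length w) s" and
    eq: "\<And>A B. A \<in> SL2 \<Longrightarrow> B \<in> SL2 \<Longrightarrow> word_eval A B w = 
      (let x = trace A; y = trace B; z = trace (A ** B)
        in comb A B (p x y z) (q x y z) (r x y z) (s x y z))"
    by metis
  note mono = repr3_mono[OF p] repr3_mono[OF q] repr3_mono[OF r] repr3_mono[OF s]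
  note intros = repr3_add repr3_diff repr3_minus mono repr3_x[OF p] repr3_x[OF q] repr3_x[OF r]
    repr3_x[OF s] repr3_y[OF p] repr3_y[OF q] repr3_y[OF r] repr3_y[OF s] repr3_z[OF p]
    repr3_z[OF q] repr3_z[OF r] repr3_z[OF s] repr3_xy[OF q]
  define pa qa ra sa where pa_def: "pa = (\<lambda>x y z. - q x y z)" and qa_def: "qa = (\<lambda>x y z. p x y z + x * q x y z)"
    and ra_def: "ra = (\<lambda>x y z. - s x y z)" and sa_def: "sa = (\<lambda>x y z. r x y z + x * s x y z)"
  define pb qb rb sb where
    pb_def: "pb = (\<lambda>x y z. - r x y z + z * q x y z - x * y * q x y z - x * s x y z)" and
    qb_def: "qb = (\<lambda>x y z. y * q x y z + s x y z)" and 
    rb_def: "rb = (\<lambda>x y z. p x y z + y * r x y z + x * q x y z + z * s x y z)" and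
    sb_def: "sb = (\<lambda>x y z. - q x y z)"
  let ?n = "Suc (length w)"
  have ra: "repr3 (Suc ?n) pa" "repr3 ?n qa" "repr3 ?n ra" "repr3 ?n sa"
    unfolding pa_def qa_def ra_def sa_def by (intro intros; simp)+
  have rb: "repr3 (Suc ?n) pb" "repr3 ?n qb" "repr3 ?n rb" "repr3 ?n sb"
    unfolding pb_def qb_def rb_def sb_def by (intro intros; simp)+
  have ea: "A ** word_eval A B w = (let x = trace A; y = trace B; z = trace (A ** B)
        in comb A B (pa x y z) (qa x y z) (ra x y z) (sa x y z))" if "A \<in> SL2" "B \<in> SL2" for A B
    using that eq[OF that] by (simp add: comb_a Let_def pa_def qa_def ra_def sa_def)
  have eb: "B ** word_eval A B w = (let x = trace A; y = trace B; z = trace (A ** B)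
        in comb A B (pb x y z) (qb x y z) (rb x y z) (sb x y z))" if "A \<in> SL2" "B \<in> SL2" for A B
    using that eq[OF that] by (simp add: comb_b Let_def pb_def qb_def rb_def sb_def algebra_simps)
  show ?case
  proof (cases l)
    case Let_a
    show ?thesis unfolding Let_a
      by (rule exI[of _ pa], rule exI[of _ qa], rule exI[of _ ra], rule exI[of _ sa])
        (use ra ea in auto)
  next
    case Let_b
    show ?thesis unfolding Let_b
      by (rule exI[of _ pb], rule exI[of _ qb], rule exI[of _ rb], rule exI[of _ sb])
        (use rb eb in auto)
  next
    case Let_a_inv
    have 1: "word_eval A B (Let_a_inv # w) = (let x = trace A; y = trace B; z = trace (A ** B)
        in comb A B (x * p x y z - pa x y z) (x * q x y z - qa x y z) 
          (x * r x y z - ra x y z) (x * s x y z - sa x y z))" if "A \<in> SL2" "B \<in> SL2" for A B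
    proof -
      have "word_eval A B (Let_a_inv # w) = mat (trace A) ** word_eval A B w - A ** word_eval A B w"
        using that by (simp add: matrix_inv_SL2 mat2_diff_mult)
      then show ?thesis using ea[OF that] eq[OF that] by (simp add: Let_def comb_diff)
    qed
    have i: "repr3 (Suc ?n) (\<lambda>x y z. x * p x y z - pa x y z)"
      "repr3 ?n (\<lambda>x y z. x * q x y z - qa x y z)"
      "repr3 ?n (\<lambda>x y z. x * r x y z - ra x y z)"
      "repr3 ?n (\<lambda>x y z. x * s x y z - sa x y z)"
      using repr3_diff[OF repr3_x[OF p] ra(1)] repr3_diff[OF repr3_x[OF q] ra(2)]
        repr3_diff[OF repr3_x[OF r] ra(3)] repr3_diff[OF repr3_x[OF s] ra(4)] by simp_all
    show ?thesis unfolding Let_a_inv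
      by (rule exI[of _ "\<lambda>x y z. x * p x y z - pa x y z"], 
          rule exI[of _ "\<lambda>x y z. x * q x y z - qa x y z"], 
          rule exI[of _ "\<lambda>x y z. x * r x y z - ra x y z"], 
          rule exI[of _ "\<lambda>x y z. x * s x y z - sa x y z"])
        (use 1 i in \<open>simp del: word_eval.simps\<close>)
  next
    case Let_b_inv
    have 1: "word_eval A B (Let_b_inv # w) = (let x = trace A; y = trace B; z = trace (A ** B)
        in comb A B (y * p x y z - pb x y z) (y * q x y z - qb x y z) 
          (y * r x y z - rb x y z) (y * s x y z - sb x y z))" if "A \<in> SL2" "B \<in> SL2" for A B
    proof -
      have "word_eval A B (Let_b_inv # w) = mat (trace B) ** word_eval A B w - B ** word_eval A B w"
        using that by (simp add: matrix_inv_SL2 mat2_diff_mult)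
      then show ?thesis using eb[OF that] eq[OF that] by (simp add: Let_def comb_diff)
    qed
    have i: "repr3 (Suc ?n) (\<lambda>x y z. y * p x y z - pb x y z)"
      "repr3 ?n (\<lambda>x y z. y * q x y z - qb x y z)"
      "repr3 ?n (\<lambda>x y z. y * r x y z - rb x y z)"
      "repr3 ?n (\<lambda>x y z. y * s x y z - sb x y z)"
      using repr3_diff[OF repr3_y[OF p] rb(1)] repr3_diff[OF repr3_y[OF q] rb(2)]
        repr3_diff[OF repr3_y[OF r] rb(3)] repr3_diff[OF repr3_y[OF s] rb(4)] by simp_all
    show ?thesis unfolding Let_b_inv
      by (rule exI[of _ "\<lambda>x y z. y * p x y z - pb x y z"], 
          rule exI[of _ "\<lambda>x y z. y * q x y z - qb x y z"], 
          rule exI[of _ "\<lambda>x y z. y * r x y z - rb x y z"], 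
          rule exI[of _ "\<lambda>x y z. y * s x y z - sb x y z"])
        (use 1 i in \<open>simp del: word_eval.simps\<close>)
  qed
qed

lemma is_trace_poly_exists:
  "\<exists>f. is_trace_poly w f \<and> Poly_Mapping.keys f \<subseteq> {(i, j, k). i + j + k \<le> length w}"
proof -
  obtain p q r s where
    p: "repr3 (Suc (length w)) p" and q: "repr3 (length w) q" and r: "repr3 (length w) r" and
    s: "repr3 (length w) s" and
    eq: "\<And>A B. A \<in> SL2 \<Longrightarrow> B \<in> SL2 \<Longrightarrow> word_eval A B w = 
      (let x = trace A; y = trace B; z = trace (A ** B)
        in comb A B (p x y z) (q x y z) (r x y z) (s x y z))"
    using word_eval_comb[of w] by metis
  have "repr3 (Suc (length w)) (\<lambda>x y z. p x y z + p x y z + x * q x y z + y * r x y z + z * s x y z)"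
    by (intro repr3_add p repr3_x[OF q] repr3_y[OF r] repr3_z[OF s]) auto
  then obtain f where f: "Poly_Mapping.keys f \<subseteq> {(i, j, k). i + j + k < Suc (length w)}"
    "\<And>x y z. poly3 f x y z = p x y z + p x y z + x * q x y z + y * r x y z + z * s x y z"
    unfolding repr3_def by blast
  have "is_trace_poly w f"
    unfolding is_trace_poly_def using f(2) by (auto simp: eq Let_def trace_comb)
  with f(1) show ?thesis by (auto simp: less_Suc_eq_le)
qed

lemma SL2_traces: "\<exists>A \<in> SL2. \<exists>B \<in> SL2. trace A = x \<and> trace B = y \<and> trace (A ** B) = z"
proof -
  obtain q :: complex where q: "q * q - z * q + 1 = 0"
  proof -
    have "(z / 2 + csqrt (z\<^sup>2 / 4 - 1)) * (z / 2 + csqrt (z\<^sup>2 / 4 - 1)) 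
       - z * (z / 2 + csqrt (z\<^sup>2 / 4 - 1)) + 1 = (csqrt (z\<^sup>2 / 4 - 1))\<^sup>2 - (z\<^sup>2 / 4 - 1)"
      by (simp add: algebra_simps power2_eq_square)
    also have "\<dots> = 0" by simp
    finally show ?thesis using that by blast
  qed
  then have q0: "q \<noteq> 0" by auto
  with q have qz: "q + inverse q = z"
    by (simp add: field_simps)
  define A :: "complex ^ 2 ^ 2" where "A = vector [vector [x, -1], vector [1, 0]]"
  define B :: "complex ^ 2 ^ 2" where "B = vector [vector [0, q], vector [- inverse q, y]]"
  have "A \<in> SL2" "B \<in> SL2" using q0 by (auto simp: SL2_def A_def B_def det_2)
  moreover have "trace A = x" "trace B = y" "trace (A ** B) = z"
    using qz by (auto simp: A_def B_def trace_def sum_2 matrix_matrix_mult_def add.commute)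
  ultimately show ?thesis by blast
qed

lemma poly3_eq_0_imp:
  assumes "\<And>x y z. poly3 f x y z = 0"
  shows "f = 0"
proof -
  define N where "N = (\<Sum>(i, j, k) \<in> Poly_Mapping.keys f. i + j + k)"
  have N: "i + j + k \<le> N" if "(i, j, k) \<in> Poly_Mapping.keys f" for i j k
    using member_le_sum[of "(i, j, k)" "Poly_Mapping.keys f" "\<lambda>(i, j, k). i + j + k"] that
    by (auto simp: N_def)
  let ?c = "\<lambda>i j k. of_int (Poly_Mapping.lookup f (i, j, k)) :: complex"
  have sup: "Poly_Mapping.keys f \<subseteq> {..N} \<times> {..N} \<times> {..N}" using N by fastforce
  have "(\<Sum>i\<le>N. (\<Sum>j\<le>N. (\<Sum>k\<le>N. ?c i j k * z ^ k) * y ^ j) * x ^ i) = 0" for x y z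
  proof -
    have "0 = poly3 f x y z" using assms by simp
    also have "\<dots> = (\<Sum>(i, j, k) \<in> {..N} \<times> {..N} \<times> {..N}. ?c i j k * x ^ i * y ^ j * z ^ k)"
      by (rule poly3_superset) (use sup in auto)
    also have "\<dots> = (\<Sum>i\<le>N. \<Sum>j\<le>N. \<Sum>k\<le>N. ?c i j k * x ^ i * y ^ j * z ^ k)"
      by (simp add: sum.cartesian_product)
    finally show ?thesis by (simp add: sum_distrib_left sum_distrib_right algebra_simps)
  qed
  then have "(\<Sum>j\<le>N. (\<Sum>k\<le>N. ?c i j k * z ^ k) * y ^ j) = 0" if "i \<le> N" for i y z
    using polyfun_eq_0[where n = N and c = "\<lambda>i. (\<Sum>j\<le>N. (\<Sum>k\<le>N. ?c i j k * z ^ k) * y ^ j)"] that by blast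
  then have "(\<Sum>k\<le>N. ?c i j k * z ^ k) = 0" if "i \<le> N" "j \<le> N" for i j z
    using polyfun_eq_0[where n = N and c = "\<lambda>j. (\<Sum>k\<le>N. ?c i j k * z ^ k)"] that by blast
  then have c: "?c i j k = 0" if "i \<le> N" "j \<le> N" "k \<le> N" for i j k
    using polyfun_eq_0[where n = N and c = "\<lambda>k. ?c i j k"] that by blast
  have "Poly_Mapping.keys f = {}"
  proof (rule ccontr)
    assume "Poly_Mapping.keys f \<noteq> {}"
    then obtain i j k where *: "(i, j, k) \<in> Poly_Mapping.keys f" by (metis prod.exhaust ex_in_conv)
    with N[OF *] c[of i j k] show False by (simp add: in_keys_iff)
  qed
  then show ?thesis by simp
qed

lemma is_trace_poly_unique:
  assumes "is_trace_poly w f" "is_trace_poly w g"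
  shows "f = g"
proof -
  have "poly3 f x y z = poly3 g x y z" for x y z
  proof -
    obtain A B where "A \<in> SL2" "B \<in> SL2" "trace A = x" "trace B = y" "trace (A ** B) = z"
      using SL2_traces by blast
    with assms show ?thesis unfolding is_trace_poly_def by metis
  qed
  moreover have "poly3 (f - g) x y z + poly3 g x y z = poly3 f x y z" for x y z
    by (simp flip: poly3_add)
  ultimately have "poly3 (f - g) x y z = 0" for x y z
    by (metis add_cancel_left_left)
  from poly3_eq_0_imp[OF this] show ?thesis by simp
qed

lemma ex1_is_trace_poly: "\<exists>!f. is_trace_poly w f"
  using is_trace_poly_exists is_trace_poly_unique by blast

lemma is_trace_poly_trace_poly: "is_trace_poly w (trace_poly w)"
  unfolding trace_poly_def by (rule theI'[OF ex1_is_trace_poly])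

text \<open>Hence \<open>dense_table (length w) (trace_poly w)\<close> lists all nonzero coefficients.\<close>

lemma keys_trace_poly:
  "Poly_Mapping.keys (trace_poly w) \<subseteq> {(i, j, k). i + j + k \<le> length w}"
  using is_trace_poly_exists is_trace_poly_unique is_trace_poly_trace_poly by metis

end

theory Submission
  imports Defs
begin

text \<open>Appending a letter to a word \<open>w\<close> acts on the vector of traces of \<open>w\<close>, \<open>w A\<close>, \<open>w B\<close>,
  \<open>w A B\<close> by a bounded number of transvections, each adding to one entry another entry times
  plus or minus \<open>1\<close>, \<open>x\<close>, \<open>y\<close> or \<open>z\<close>; the inverse letter undoes them. Coefficients at most double
  in each transvection, so they have \<open>O(n)\<close> bits. Kronecker substitution \<open>z = 2 ^ W\<close>,
  \<open>y = 2 ^ (W N)\<close>, \<open>x = 2 ^ (W N\<^sup>2)\<close> with \<open>N = n + 1\<close> and \<open>W\<close> linear in \<open>n\<close> packs a polynomial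
  into a single two's complement number of \<open>W N ^ 3 = O(n ^ 4)\<close> bits. A transvection becomes
  the addition of a shifted number, which a machine does in linear time by letting one head start
  ahead of the other, so \<open>n\<close> letters cost \<open>O(n ^ 5)\<close>. Intermediate overflow is harmless, since
  only the final trace has to be recovered modulo \<open>2 ^ (W N ^ 3)\<close>. Its blocks, from the least
  significant one on, are the coefficients in lexicographic order of the exponents. All phases but
  the loop over the letters take \<open>O(n ^ 4)\<close> time, and so does one pass of that loop, which starts with all
  heads but the input head at the origin; this bounds the space.\<close>

section \<open>Structured programs and their compilation to Turing machines\<close>

type_synonym st = "(nat \<Rightarrow> int) \<times> (nat \<Rightarrow> tape)"

datatype com =
    Step "(nat \<Rightarrow> symbol) \<Rightarrow> nat \<Rightarrow> symbol \<times> move"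
  | Seq com com (infixr ";;" 60)
  | Cond "(nat \<Rightarrow> symbol) \<Rightarrow> bool" com com
  | Loop "(nat \<Rightarrow> symbol) \<Rightarrow> bool" com

definition scan :: "st \<Rightarrow> nat \<Rightarrow> symbol" where
  "scan \<sigma> = (\<lambda>i. snd \<sigma> i (fst \<sigma> i))"

definition idle :: "(nat \<Rightarrow> symbol) \<Rightarrow> nat \<Rightarrow> symbol \<times> move" where
  "idle rd = (\<lambda>i. (rd i, Stay))"

definition eff :: "(nat \<Rightarrow> symbol \<times> move) \<Rightarrow> st \<Rightarrow> st" where
  "eff g \<sigma> = (\<lambda>i. fst \<sigma> i + move_offset (snd (g i)), \<lambda>i. (snd \<sigma> i)(fst \<sigma> i := fst (g i)))"

definition heads_in :: "int set \<Rightarrow> st \<Rightarrow> bool" where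
  "heads_in S \<sigma> \<longleftrightarrow> range (fst \<sigma>) \<subseteq> S"

inductive exec :: "int set \<Rightarrow> com \<Rightarrow> st \<Rightarrow> nat \<Rightarrow> st \<Rightarrow> bool" for S where
  Step: "heads_in S \<sigma> \<Longrightarrow> heads_in S (eff (f (scan \<sigma>)) \<sigma>) \<Longrightarrow>
    exec S (Step f) \<sigma> 1 (eff (f (scan \<sigma>)) \<sigma>)"
| Seq: "exec S c1 \<sigma> t1 \<sigma>1 \<Longrightarrow> exec S c2 \<sigma>1 t2 \<sigma>2 \<Longrightarrow> exec S (c1 ;; c2) \<sigma> (t1 + t2) \<sigma>2"
| CondT: "b (scan \<sigma>) \<Longrightarrow> exec S c1 \<sigma> t \<sigma>1 \<Longrightarrow> exec S (Cond b c1 c2) \<sigma> (Suc t) \<sigma>1"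
| CondF: "\<not> b (scan \<sigma>) \<Longrightarrow> exec S c2 \<sigma> t \<sigma>1 \<Longrightarrow> exec S (Cond b c1 c2) \<sigma> (Suc t) \<sigma>1"
| LoopF: "\<not> b (scan \<sigma>) \<Longrightarrow> heads_in S \<sigma> \<Longrightarrow> exec S (Loop b c) \<sigma> 1 \<sigma>"
| LoopT: "b (scan \<sigma>) \<Longrightarrow> exec S c \<sigma> t1 \<sigma>1 \<Longrightarrow> exec S (Loop b c) \<sigma>1 t2 \<sigma>2 \<Longrightarrow>
    exec S (Loop b c) \<sigma> (Suc (t1 + t2)) \<sigma>2"

definition runs :: "int set \<Rightarrow> nat \<Rightarrow> com \<Rightarrow> st \<Rightarrow> st \<Rightarrow> bool" where
  "runs S T c \<sigma> \<sigma>' \<longleftrightarrow> (\<exists>t \<le> T. exec S c \<sigma> t \<sigma>')"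

lemma exec_head_move: "exec S c \<sigma> t \<sigma>' \<Longrightarrow> \<bar>fst \<sigma>' i - fst \<sigma> i\<bar> \<le> int t"
proof (induction rule: exec.induct)
  case (Step \<sigma> f)
  then show ?case by (cases "snd (f (scan \<sigma>) i)") (auto simp: eff_def)
qed auto

lemma exec_local:
  assumes "exec S c \<sigma> t \<sigma>'" "\<And>i. {fst \<sigma> i - int t .. fst \<sigma> i + int t} \<subseteq> S'"
  shows "exec S' c \<sigma> t \<sigma>'"
  using assms
proof (induction rule: exec.induct)
  case (Step \<sigma> f)
  have "fst \<sigma> i \<in> S' \<and> fst (eff (f (scan \<sigma>)) \<sigma>) i \<in> S'" for i
    using Step(3)[of i] by (cases "snd (f (scan \<sigma>) i)") (auto simp: eff_def)
  then show ?case by (intro exec.Step) (auto simp: heads_in_def)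
next
  case (Seq c1 \<sigma> t1 \<sigma>1 c2 t2 \<sigma>2)
  have 1: "{fst \<sigma> i - int t1 .. fst \<sigma> i + int t1} \<subseteq> S'" for i
    using Seq.prems[of i] by (rule order_trans[rotated]) auto
  have 2: "{fst \<sigma>1 i - int t2 .. fst \<sigma>1 i + int t2} \<subseteq> S'" for i
    using Seq.prems[of i] exec_head_move[OF Seq.hyps(1), of i]
    by (intro order_trans[rotated, OF Seq.prems[of i]]) auto
  show ?case using Seq.IH(1)[OF 1] Seq.IH(2)[OF 2] by (rule exec.Seq)
next
  case (CondT b \<sigma> c1 t \<sigma>1 c2)
  have *: "{fst \<sigma> i - int t .. fst \<sigma> i + int t} \<subseteq> S'" for i
    using CondT.prems[of i] by (rule order_trans[rotated]) auto
  show ?case using CondT.hyps(1) CondT.IH[OF *] by (rule exec.CondT)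
next
  case (CondF b \<sigma> c2 t \<sigma>1 c1)
  have *: "{fst \<sigma> i - int t .. fst \<sigma> i + int t} \<subseteq> S'" for i
    using CondF.prems[of i] by (rule order_trans[rotated]) auto
  show ?case using CondF.hyps(1) CondF.IH[OF *] by (rule exec.CondF)
next
  case (LoopF b \<sigma> c)
  have "fst \<sigma> i \<in> S'" for i using LoopF.prems[of i] by auto
  with LoopF show ?case by (intro exec.LoopF) (auto simp: heads_in_def)
next
  case (LoopT b \<sigma> c t1 \<sigma>1 t2 \<sigma>2)
  have 1: "{fst \<sigma> i - int t1 .. fst \<sigma> i + int t1} \<subseteq> S'" for i
    using LoopT.prems[of i] by (rule order_trans[rotated]) auto
  have 2: "{fst \<sigma>1 i - int t2 .. fst \<sigma>1 i + int t2} \<subseteq> S'" for i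
    using LoopT.prems[of i] exec_head_move[OF LoopT.hyps(2), of i]
    by (intro order_trans[rotated, OF LoopT.prems[of i]]) auto
  show ?case using LoopT.hyps(1) LoopT.IH(1)[OF 1] LoopT.IH(2)[OF 2] by (rule exec.LoopT)
qed

lemma exec_heads_in: "exec S c \<sigma> t \<sigma>' \<Longrightarrow> heads_in S \<sigma> \<and> heads_in S \<sigma>'"
  by (induction rule: exec.induct) auto

fun len :: "com \<Rightarrow> nat" where
  "len (Step f) = 1"
| "len (c1 ;; c2) = len c1 + len c2"
| "len (Cond b c1 c2) = Suc (len c1 + len c2)"
| "len (Loop b c) = Suc (len c)"

text \<open>The code of \<open>c\<close> occupies the states from \<open>s\<close> to \<open>s + len c - 1\<close>; it is entered at \<open>s\<close>
  and left to \<open>e\<close>.\<close>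

fun code :: "com \<Rightarrow> nat \<Rightarrow> nat \<Rightarrow> nat \<Rightarrow> (nat \<Rightarrow> symbol) \<Rightarrow> nat \<times> (nat \<Rightarrow> symbol \<times> move)" where
  "code (Step f) s e q rd = (e, f rd)"
| "code (c1 ;; c2) s e q rd =
     (if q < s + len c1 then code c1 s (s + len c1) q rd else code c2 (s + len c1) e q rd)"
| "code (Cond b c1 c2) s e q rd =
     (if q = s then (if b rd then Suc s else Suc (s + len c1), idle rd)
      else if q < Suc (s + len c1) then code c1 (Suc s) e q rd
      else code c2 (Suc (s + len c1)) e q rd)"
| "code (Loop b c) s e q rd =
     (if q = s then (if b rd then Suc s else e, idle rd) else code c (Suc s) s q rd)"

definition symbols :: "symbol set" where
  "symbols = {Blank, Plus, Minus, Sep} \<union> range Letter \<union> range Bit"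

fun wf_com :: "nat \<Rightarrow> com \<Rightarrow> bool" where
  "wf_com k (Step f) \<longleftrightarrow> (\<forall>rd. (\<forall>i \<ge> k. f rd i = (rd i, Stay)) \<and>
     (range rd \<subseteq> symbols \<longrightarrow> (\<forall>i. fst (f rd i) \<in> symbols)))"
| "wf_com k (c1 ;; c2) \<longleftrightarrow> wf_com k c1 \<and> wf_com k c2"
| "wf_com k (Cond b c1 c2) \<longleftrightarrow> wf_com k c1 \<and> wf_com k c2"
| "wf_com k (Loop b c) \<longleftrightarrow> wf_com k c"

lemma len_pos: "0 < len c"
  by (induction c) auto

lemma code_state:
  assumes "s \<le> q" "q < s + len c"
  shows "fst (code c s e q rd) \<in> insert e {s..<s + len c}"
  using assms
proof (induction c arbitrary: s e)
  case (Seq c1 c2)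
  show ?case
  proof (cases "q < s + len c1")
    case True
    then show ?thesis using Seq.IH(1)[of s "s + len c1"] Seq.prems len_pos[of c2] by auto
  next
    case False
    then show ?thesis using Seq.IH(2)[of "s + len c1" e] Seq.prems by auto
  qed
next
  case (Cond b c1 c2)
  consider "q = s" | "s < q" "q < Suc (s + len c1)" | "Suc (s + len c1) \<le> q"
    using Cond.prems by linarith
  then show ?case
  proof cases
    case 1
    then show ?thesis using len_pos[of c1] len_pos[of c2] by auto
  next
    case 2
    then show ?thesis using Cond.IH(1)[of "Suc s" e] by auto
  next
    case 3
    then show ?thesis using Cond.IH(2)[of "Suc (s + len c1)" e] Cond.prems by auto
  qed
next
  case (Loop b c)
  show ?case
  proof (cases "q = s")
    case True
    then show ?thesis using len_pos[of c] by auto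
  next
    case False
    then show ?thesis using Loop.IH[of "Suc s" s] Loop.prems by auto
  qed
qed auto

lemma code_symbols:
  assumes "wf_com k c" "range rd \<subseteq> symbols"
  shows "fst (snd (code c s e q rd) i) \<in> symbols"
  using assms by (induction c arbitrary: s e) (auto simp: idle_def)

lemma code_beyond:
  assumes "wf_com k c" "k \<le> i"
  shows "snd (code c s e q rd) i = (rd i, Stay)"
  using assms by (induction c arbitrary: s e) (auto simp: idle_def)

definition astep :: "(nat \<Rightarrow> (nat \<Rightarrow> symbol) \<Rightarrow> nat \<times> (nat \<Rightarrow> symbol \<times> move)) \<Rightarrow> nat \<times> st \<Rightarrow> nat \<times> st"
  where "astep D = (\<lambda>(q, \<sigma>). (fst (D q (scan \<sigma>)), eff (snd (D q (scan \<sigma>))) \<sigma>))"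

lemma eff_idle [simp]: "eff (idle (scan \<sigma>)) \<sigma> = \<sigma>"
  by (simp add: eff_def idle_def scan_def prod_eq_iff)

definition trace_to :: "(nat \<Rightarrow> (nat \<Rightarrow> symbol) \<Rightarrow> nat \<times> (nat \<Rightarrow> symbol \<times> move)) \<Rightarrow>
    int set \<Rightarrow> nat set \<Rightarrow> nat \<times> st \<Rightarrow> nat \<Rightarrow> nat \<times> st \<Rightarrow> bool" where
  "trace_to D S I x t y \<longleftrightarrow> (astep D ^^ t) x = y \<and>
     (\<forall>t' \<le> t. heads_in S (snd ((astep D ^^ t') x))) \<and>
     (\<forall>t' < t. fst ((astep D ^^ t') x) \<in> I)"

lemma trace_to_1:
  "heads_in S (snd x) \<Longrightarrow> heads_in S (snd y) \<Longrightarrow> fst x \<in> I \<Longrightarrow> astep D x = y \<Longrightarrow> trace_to D S I x 1 y"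
  by (auto simp: trace_to_def le_Suc_eq)

lemma trace_to_mono: "trace_to D S I x t y \<Longrightarrow> I \<subseteq> J \<Longrightarrow> trace_to D S J x t y"
  by (auto simp: trace_to_def)

lemma trace_to_trans:
  assumes "trace_to D S I x t1 y" "trace_to D S I y t2 z"
  shows "trace_to D S I x (t1 + t2) z"
proof -
  have *: "(astep D ^^ (t' + t1)) x = (astep D ^^ t') y" for t'
    using assms(1) by (simp add: funpow_add trace_to_def)
  have "heads_in S (snd ((astep D ^^ t') x))" if "t' \<le> t1 + t2" for t'
  proof (cases "t' \<le> t1")
    case False
    then show ?thesis using assms(2) *[of "t' - t1"] that by (simp add: trace_to_def)
  qed (use assms(1) in \<open>simp add: trace_to_def\<close>)
  moreover have "fst ((astep D ^^ t') x) \<in> I" if "t' < t1 + t2" for t'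
  proof (cases "t' < t1")
    case False
    then show ?thesis using assms(2) *[of "t' - t1"] that by (simp add: trace_to_def)
  qed (use assms(1) in \<open>simp add: trace_to_def\<close>)
  moreover have "(astep D ^^ (t1 + t2)) x = z"
    using assms(2) *[of t2] by (simp add: trace_to_def add.commute)
  ultimately show ?thesis by (simp add: trace_to_def)
qed

lemma exec_code:
  assumes "exec S c \<sigma> t \<sigma>'"
    and "\<And>q rd. s \<le> q \<Longrightarrow> q < s + len c \<Longrightarrow> D q rd = code c s e q rd"
  shows "trace_to D S {s..<s + len c} (s, \<sigma>) t (e, \<sigma>')"
  using assms
proof (induction arbitrary: s e rule: exec.induct)
  case (Step \<sigma> f)
  then show ?case by (intro trace_to_1) (auto simp: astep_def)
next
  case (Seq c1 \<sigma> t1 \<sigma>1 c2 t2 \<sigma>2)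
  have 1: "trace_to D S {s..<s + len c1} (s, \<sigma>) t1 (s + len c1, \<sigma>1)"
    using Seq.prems by (intro Seq.IH) auto
  have 2: "trace_to D S {s + len c1..<s + len c1 + len c2} (s + len c1, \<sigma>1) t2 (e, \<sigma>2)"
    using Seq.prems by (intro Seq.IH) auto
  show ?case
    by (rule trace_to_trans[OF trace_to_mono[OF 1] trace_to_mono[OF 2]]) auto
next
  case (CondT b \<sigma> c1 t \<sigma>1 c2)
  have 1: "trace_to D S {Suc s..<Suc s + len c1} (Suc s, \<sigma>) t (e, \<sigma>1)"
    using CondT.prems by (intro CondT.IH) auto
  have "trace_to D S {s..<s + len (Cond b c1 c2)} (s, \<sigma>) 1 (Suc s, \<sigma>)"
    using CondT.hyps CondT.prems[of s] exec_heads_in[OF CondT.hyps(2)]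
    by (intro trace_to_1) (auto simp: astep_def)
  from trace_to_trans[OF this trace_to_mono[OF 1]] show ?case by auto
next
  case (CondF b \<sigma> c2 t \<sigma>1 c1)
  have 1: "trace_to D S {Suc (s + len c1)..<Suc (s + len c1) + len c2} (Suc (s + len c1), \<sigma>) t (e, \<sigma>1)"
    using CondF.prems by (intro CondF.IH) auto
  have "trace_to D S {s..<s + len (Cond b c1 c2)} (s, \<sigma>) 1 (Suc (s + len c1), \<sigma>)"
    using CondF.hyps CondF.prems[of s] exec_heads_in[OF CondF.hyps(2)]
    by (intro trace_to_1) (auto simp: astep_def)
  from trace_to_trans[OF this trace_to_mono[OF 1]] show ?case by auto
next
  case (LoopF b \<sigma> c)
  then show ?case by (intro trace_to_1) (auto simp: astep_def)
next
  case (LoopT b \<sigma> c t1 \<sigma>1 t2 \<sigma>2)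
  have 1: "trace_to D S {Suc s..<Suc s + len c} (Suc s, \<sigma>) t1 (s, \<sigma>1)"
    using LoopT.prems by (intro LoopT.IH) auto
  have 2: "trace_to D S {s..<s + len (Loop b c)} (s, \<sigma>1) t2 (e, \<sigma>2)"
    using LoopT.prems by (intro LoopT.IH) auto
  have 0: "trace_to D S {s..<s + len (Loop b c)} (s, \<sigma>) 1 (Suc s, \<sigma>)"
    using LoopT.hyps LoopT.prems[of s] exec_heads_in[OF LoopT.hyps(2)]
    by (intro trace_to_1) (auto simp: astep_def)
  from trace_to_trans[OF trace_to_trans[OF 0 trace_to_mono[OF 1]] 2] show ?case by auto
qed

definition machine :: "nat \<Rightarrow> com \<Rightarrow> tm" where
  "machine k c = \<lparr> n_tapes = k, states = {..len c}, alphabet = symbols, start_state = 0,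
     halt_state = len c,
     delta = (\<lambda>q rs. let rd = (\<lambda>i. if i < k then rs ! i else Blank);
                        (q', g) = (if q < len c then code c 0 (len c) q rd else (q, idle rd))
                    in (q', map g [0..<k])) \<rparr>"

definition conf :: "nat \<Rightarrow> nat \<times> st \<Rightarrow> config" where
  "conf k x = \<lparr> state = fst x, heads = map (fst (snd x)) [0..<k], tapes = map (snd (snd x)) [0..<k] \<rparr>"

lemma finite_symbols: "finite symbols"
proof -
  have "(UNIV :: letter set) = {Let_a, Let_a_inv, Let_b, Let_b_inv}"
    by (auto intro: letter.exhaust)
  then have "finite (UNIV :: letter set)" by (metis finite.simps)
  then show ?thesis by (simp add: symbols_def)
qed

lemma valid_machine:
  assumes "wf_com k c" "k \<ge> 2"
  shows "valid_tm (machine k c)"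
proof -
  have "fst (delta (machine k c) q rs) \<in> {..len c} \<and>
      length (snd (delta (machine k c) q rs)) = k \<and>
      fst ` set (snd (delta (machine k c) q rs)) \<subseteq> symbols"
    if "q \<le> len c" "length rs = k" "set rs \<subseteq> symbols" for q rs
  proof -
    define rd where "rd = (\<lambda>i. if i < k then rs ! i else Blank)"
    have "Blank \<in> symbols" by (simp add: symbols_def)
    then have rd: "range rd \<subseteq> symbols" using that nth_mem[of _ rs] by (auto simp: rd_def)
    define r where "r = (if q < len c then code c 0 (len c) q rd else (q, idle rd))"
    have d: "delta (machine k c) q rs = (fst r, map (snd r) [0..<k])"
      by (simp add: machine_def r_def rd_def Let_def case_prod_beta')
    have "fst r \<le> len c"
      using code_state[of 0 q c "len c" rd] that(1) by (auto simp: r_def)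
    moreover have "fst (snd r i) \<in> symbols" for i
      using code_symbols[OF assms(1) rd] rd by (auto simp: r_def idle_def)
    ultimately show ?thesis by (auto simp: d)
  qed
  moreover have sym: "Blank \<in> symbols" "range Letter \<subseteq> symbols"
    by (auto simp: symbols_def)
  ultimately show ?thesis
    using assms(2) finite_symbols unfolding valid_tm_def by (simp add: machine_def)
qed

lemma step_conf:
  assumes "wf_com k c" "fst x < len c" "\<forall>i \<ge> k. snd (snd x) i = blank_tape"
  shows "step (machine k c) (conf k x) = conf k (astep (code c 0 (len c)) x)"
    and "\<forall>i \<ge> k. snd (snd (astep (code c 0 (len c)) x)) i = blank_tape"
proof -
  have sc: "(\<lambda>i. if i < k then read_symbols (conf k x) ! i else Blank) = scan (snd x)"
    using assms(3) by (auto simp: read_symbols_def conf_def scan_def blank_tape_def)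
  show "step (machine k c) (conf k x) = conf k (astep (code c 0 (len c)) x)"
    using assms(2) unfolding step_def
    by (simp add: machine_def Let_def sc[unfolded conf_def] case_prod_beta' conf_def astep_def)
       (auto simp: eff_def list_eq_iff_nth_eq)
  show "\<forall>i \<ge> k. snd (snd (astep (code c 0 (len c)) x)) i = blank_tape"
    using assms(3) code_beyond[OF assms(1)]
    by (simp add: astep_def eff_def case_prod_beta' scan_def)
qed

lemma init_config_machine: assumes "k \<ge> 1"
  shows "init_config (machine k c) inp = conf k (0, (\<lambda>_. 0, (\<lambda>_. blank_tape)(0 := tape_of inp)))"
proof -
    obtain k' where k: "k = Suc k'" using assms by (cases k) auto
    have u: "[0..<k] = 0 # map Suc [0..<k']"
      by (simp add: k map_Suc_upt upt_conv_Cons del: upt_Suc)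
    have 1: "map (\<lambda>_. 0) [0..<k] = replicate k (0::int)" by (simp add: map_replicate_const)
    have 2: "map ((\<lambda>_. blank_tape)(0 := tape_of inp)) [0..<k] = tape_of inp # replicate (k - 1) blank_tape"
      unfolding u by (simp add: k map_replicate_const comp_def)
    show ?thesis unfolding init_config_def conf_def by (simp only: 1 2 fst_conv snd_conv) (simp add: machine_def)
qed

lemma machine_computes:
  assumes "wf_com k c" "k \<ge> 2"
    and "runs {-int b..int b} T c (\<lambda>_. 0, (\<lambda>_. blank_tape)(0 := tape_of inp)) \<sigma>'"
    and "snd \<sigma>' 1 = tape_of out"
  shows "computes_within (machine k c) inp out T (k * (2 * b + 1))"
proof -
  define \<sigma> :: st where "\<sigma> = (\<lambda>_. 0, (\<lambda>_. blank_tape)(0 := tape_of inp))"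
  define D where "D = code c 0 (len c)"
  let ?M = "machine k c"
  obtain t where t: "t \<le> T" "exec {-int b..int b} c \<sigma> t \<sigma>'"
    using assms(3) by (auto simp: runs_def \<sigma>_def)
  have tr: "trace_to D {-int b..int b} {0..<len c} (0, \<sigma>) t (len c, \<sigma>')"
    using exec_code[OF t(2), of 0 D "len c"] by (simp add: D_def)
  have init: "init_config ?M inp = conf k (0, \<sigma>)"
    unfolding \<sigma>_def using assms(2) by (intro init_config_machine) simp
  have sim: "run ?M inp t' = conf k ((astep D ^^ t') (0, \<sigma>)) \<and>
      (\<forall>i \<ge> k. snd (snd ((astep D ^^ t') (0, \<sigma>))) i = blank_tape)" if "t' \<le> t" for t'
    using that
  proof (induction t')
    case 0
    have "\<forall>i \<ge> k. snd \<sigma> i = blank_tape" using assms(2) by (simp add: \<sigma>_def)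
    then show ?case by (simp add: run_def init)
  next
    case (Suc t')
    have "fst ((astep D ^^ t') (0, \<sigma>)) < len c" using tr Suc.prems by (auto simp: trace_to_def)
    moreover have IH: "run ?M inp t' = conf k ((astep D ^^ t') (0, \<sigma>))"
      "\<forall>i \<ge> k. snd (snd ((astep D ^^ t') (0, \<sigma>))) i = blank_tape"
      using Suc by auto
    moreover have "run ?M inp (Suc t') = step ?M (run ?M inp t')" by (simp add: run_def)
    moreover have "(astep D ^^ Suc t') (0, \<sigma>) = astep D ((astep D ^^ t') (0, \<sigma>))" by simp
    ultimately show ?case unfolding D_def using step_conf[OF assms(1)] by metis
  qed
  have fin: "run ?M inp t = conf k (len c, \<sigma>')" using sim[of t] tr by (simp add: trace_to_def)
  have "card ((\<lambda>t'. heads (run ?M inp t') ! i) ` {..t}) \<le> 2 * b + 1" if "i < k" for i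
  proof -
    have "heads (run ?M inp t') ! i \<in> {-int b..int b}" if "t' \<le> t" for t'
    proof -
      have "heads_in {-int b..int b} (snd ((astep D ^^ t') (0, \<sigma>)))"
        using tr that by (simp add: trace_to_def)
      then have "fst (snd ((astep D ^^ t') (0, \<sigma>))) i \<in> {-int b..int b}"
        unfolding heads_in_def by blast
      then show ?thesis using sim[OF that] \<open>i < k\<close> by (simp add: conf_def)
    qed
    then have "(\<lambda>t'. heads (run ?M inp t') ! i) ` {..t} \<subseteq> {-int b..int b}" by blast
    from card_mono[OF _ this] show ?thesis by simp
  qed
  then have "(\<Sum>i<k. card ((\<lambda>t'. heads (run ?M inp t') ! i) ` {..t})) \<le> (\<Sum>i<k. 2 * b + 1)"
    by (intro sum_mono) auto
  moreover have "n_tapes ?M = k" by (simp add: machine_def)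
  ultimately have "space_used ?M inp t \<le> k * (2 * b + 1)" by (simp add: space_used_def)
  then show ?thesis
    unfolding computes_within_def using t(1) assms(2,4)
    by (intro exI[of _ t]) (simp add: fin conf_def, simp add: machine_def)
qed

section \<open>Runs of simple programs\<close>

lemma runsI: "exec S c \<sigma> t \<sigma>' \<Longrightarrow> t \<le> T \<Longrightarrow> runs S T c \<sigma> \<sigma>'"
  by (auto simp: runs_def)

lemma runsE:
  assumes "runs S T c \<sigma> \<sigma>'"
  obtains t where "t \<le> T" "exec S c \<sigma> t \<sigma>'"
  using assms by (auto simp: runs_def)

lemma runs_mono: "runs S T c \<sigma> \<sigma>' \<Longrightarrow> T \<le> T' \<Longrightarrow> runs S T' c \<sigma> \<sigma>'"
  by (elim runsE) (erule runsI, simp)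

lemma runs_Seq: "runs S T1 c1 \<sigma> \<sigma>1 \<Longrightarrow> runs S T2 c2 \<sigma>1 \<sigma>2 \<Longrightarrow> runs S (T1 + T2) (c1 ;; c2) \<sigma> \<sigma>2"
  by (elim runsE) (rule runsI, erule (1) exec.Seq, simp)

lemma runs_Seq_le:
  "runs S T1 c1 \<sigma> \<sigma>1 \<Longrightarrow> runs S T2 c2 \<sigma>1 \<sigma>2 \<Longrightarrow> T1 + T2 \<le> T \<Longrightarrow> runs S T (c1 ;; c2) \<sigma> \<sigma>2"
  by (rule runs_mono[OF runs_Seq])

lemma runs_Cond:
  assumes "b (scan \<sigma>) \<Longrightarrow> runs S T c1 \<sigma> \<sigma>1" "\<not> b (scan \<sigma>) \<Longrightarrow> runs S T c2 \<sigma> \<sigma>1"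
  shows "runs S (Suc T) (Cond b c1 c2) \<sigma> \<sigma>1"
proof (cases "b (scan \<sigma>)")
  case True
  from assms(1)[OF this] True show ?thesis by (elim runsE) (rule runsI, erule (1) exec.CondT, simp)
next
  case False
  from assms(2)[OF this] False show ?thesis by (elim runsE) (rule runsI, erule (1) exec.CondF, simp)
qed

lemma runs_LoopF: "\<not> b (scan \<sigma>) \<Longrightarrow> heads_in S \<sigma> \<Longrightarrow> runs S 1 (Loop b c) \<sigma> \<sigma>"
  by (rule runsI, erule (1) exec.LoopF, simp)

lemma runs_LoopT: "b (scan \<sigma>) \<Longrightarrow> runs S T1 c \<sigma> \<sigma>1 \<Longrightarrow> runs S T2 (Loop b c) \<sigma>1 \<sigma>2 \<Longrightarrow>
    runs S (Suc (T1 + T2)) (Loop b c) \<sigma> \<sigma>2"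
  by (elim runsE) (rule runsI, erule (2) exec.LoopT, simp)

lemma runs_Step: "eff (f (scan \<sigma>)) \<sigma> = \<sigma>' \<Longrightarrow> runs UNIV 1 (Step f) \<sigma> \<sigma>'"
  using exec.Step[of UNIV \<sigma> f] by (intro runsI[of _ _ _ 1]) (auto simp: heads_in_def)

lemma heads_in_UNIV [simp]: "heads_in UNIV \<sigma>"
  by (simp add: heads_in_def)

lemma runs_local:
  assumes "runs UNIV T c \<sigma> \<sigma>'" "\<And>i. {fst \<sigma> i - int T .. fst \<sigma> i + int T} \<subseteq> S"
  shows "runs S T c \<sigma> \<sigma>'"
proof -
  obtain t where t: "t \<le> T" "exec UNIV c \<sigma> t \<sigma>'" using assms(1) by (rule runsE)
  have "{fst \<sigma> i - int t .. fst \<sigma> i + int t} \<subseteq> S" for i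
    using t(1) by (intro order_trans[OF _ assms(2)[of i]]) auto
  from exec_local[OF t(2) this] t(1) show ?thesis by (rule runsI)
qed

lemma eff_upd [simp]:
  "eff (g(i := (s, m))) \<sigma> = ((fst (eff g \<sigma>))(i := fst \<sigma> i + move_offset m),
     (snd (eff g \<sigma>))(i := (snd \<sigma> i)(fst \<sigma> i := s)))"
  by (auto simp: eff_def)

definition tapes_of :: "(nat \<Rightarrow> symbol list) \<Rightarrow> nat \<Rightarrow> tape" where
  "tapes_of v = (\<lambda>i. tape_of (v i))"

definition st_of :: "(nat \<Rightarrow> int) \<Rightarrow> (nat \<Rightarrow> symbol list) \<Rightarrow> st" where
  "st_of h v = (h, tapes_of v)"

lemma tapes_of_apply [simp]: "tapes_of v i = tape_of (v i)"
  and tapes_of_upd [simp]: "(tapes_of v)(i := tape_of xs) = tapes_of (v(i := xs))"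
  by (auto simp: tapes_of_def)

lemma fst_st_of [simp]: "fst (st_of h v) = h"
  and snd_st_of [simp]: "snd (st_of h v) = tapes_of v"
  and pair_st_of [simp]: "(h, tapes_of v) = st_of h v"
  and scan_st_of [simp]: "scan (st_of h v) i = tape_of (v i) (h i)"
  by (simp_all add: st_of_def scan_def)

lemma tape_of_end [simp]: "tape_of xs (int (length xs)) = Blank" "tape_of xs (-1) = Blank"
  by (simp_all add: tape_of_def)

lemma tape_of_mid [simp]:
  "tape_of (xs @ y # ys) (int (length xs)) = y"
  "(tape_of (xs @ y # ys))(int (length xs) := z) = tape_of (xs @ z # ys)"
  by (auto simp: tape_of_def fun_eq_iff nth_append nth_Cons split: nat.split)

lemma tape_of_snoc [simp]: "(tape_of xs)(int (length xs) := z) = tape_of (xs @ [z])"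
  by (auto simp: tape_of_def fun_eq_iff nth_append)

lemma tape_of_eq_Blank_iff:
  assumes "Blank \<notin> set xs"
  shows "tape_of xs p = Blank \<longleftrightarrow> p < 0 \<or> p \<ge> int (length xs)"
  using assms by (auto simp: tape_of_def) (metis nat_less_iff nth_mem not_le)

definition shift :: "nat list \<Rightarrow> int \<Rightarrow> (nat \<Rightarrow> int) \<Rightarrow> nat \<Rightarrow> int" where
  "shift Y d h = (\<lambda>i. if i \<in> set Y then h i + d else h i)"

lemma shift_0 [simp]: "shift Y 0 h = h"
  and shift_shift [simp]: "shift Y d (shift Y d' h) = shift Y (d + d') h"
  and shift_apply: "shift Y d h i = (if i \<in> set Y then h i + d else h i)"
  by (auto simp: shift_def)

definition move_all :: "move \<Rightarrow> nat list \<Rightarrow> com" where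
  "move_all m Y = Step (\<lambda>rd i. (rd i, if i \<in> set Y then m else Stay))"

lemma runs_move_all: "runs UNIV 1 (move_all m Y) (st_of h v) (st_of (shift Y (move_offset m) h) v)"
  unfolding move_all_def by (rule runs_Step) (auto simp: eff_def shift_def st_of_def scan_def tapes_of_def simp del: pair_st_of)

lemmas runs_move_left = runs_move_all[of Move_left, unfolded move_offset.simps]
lemmas runs_move_right = runs_move_all[of Move_right, unfolded move_offset.simps]

definition put :: "nat \<Rightarrow> symbol \<Rightarrow> com" where
  "put y s = Step (\<lambda>rd. (idle rd)(y := (s, Move_right)))"

lemma runs_put:
  assumes "h y = int (length (v y))"
  shows "runs UNIV 1 (put y s) (st_of h v) (st_of (h(y := h y + 1)) (v(y := v y @ [s])))"
  unfolding put_def using assms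
  by (intro runs_Step) simp

definition forward :: "nat list \<Rightarrow> nat \<Rightarrow> com" where
  "forward Y y = Loop (\<lambda>rd. rd y \<noteq> Blank) (move_all Move_right Y)"

lemma runs_forward:
  assumes "Blank \<notin> set (v y)" "y \<in> set Y" "h y = int p" "length (v y) = p + m"
  shows "runs UNIV (2 * m + 1) (forward Y y) (st_of h v) (st_of (shift Y (int m) h) v)"
  using assms
proof (induction m arbitrary: h p)
  case 0
  then show ?case unfolding forward_def
    using runs_LoopF[of "\<lambda>rd. rd y \<noteq> Blank" "st_of h v" UNIV] by (simp add: tape_of_eq_Blank_iff)
next
  case (Suc m)
  have 1: "runs UNIV (2 * m + 1) (forward Y y) (st_of (shift Y 1 h) v)
      (st_of (shift Y (int m) (shift Y 1 h)) v)"
    by (rule Suc.IH[of _ "Suc p"]) (use Suc.prems in \<open>auto simp: shift_apply\<close>)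
  have "runs UNIV (Suc (1 + (2 * m + 1))) (forward Y y) (st_of h v)
      (st_of (shift Y (int m) (shift Y 1 h)) v)"
    unfolding forward_def
    by (rule runs_LoopT[OF _ runs_move_right 1[unfolded forward_def]])
       (use Suc.prems in \<open>simp add: tape_of_eq_Blank_iff\<close>)
  then show ?case by (simp add: add.commute)
qed

definition rewind :: "nat list \<Rightarrow> nat \<Rightarrow> com" where
  "rewind Y y = move_all Move_left Y ;; Loop (\<lambda>rd. rd y \<noteq> Blank) (move_all Move_left Y) ;;
     move_all Move_right Y"

lemma runs_rewind_loop:
  assumes "Blank \<notin> set (v y)" "y \<in> set Y" "h y = int m - 1" "m \<le> length (v y)"
  shows "runs UNIV (2 * m + 1) (Loop (\<lambda>rd. rd y \<noteq> Blank) (move_all Move_left Y)) (st_of h v)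
    (st_of (shift Y (- int m) h) v)"
  using assms
proof (induction m arbitrary: h)
  case 0
  then show ?case
    using runs_LoopF[of "\<lambda>rd. rd y \<noteq> Blank" "st_of h v" UNIV] by (simp add: tape_of_eq_Blank_iff)
next
  case (Suc m)
  have 1: "runs UNIV (2 * m + 1) (Loop (\<lambda>rd. rd y \<noteq> Blank) (move_all Move_left Y))
      (st_of (shift Y (-1) h) v) (st_of (shift Y (- int m) (shift Y (-1) h)) v)"
    by (rule Suc.IH) (use Suc.prems in \<open>auto simp: shift_apply\<close>)
  have "runs UNIV (Suc (1 + (2 * m + 1))) (Loop (\<lambda>rd. rd y \<noteq> Blank) (move_all Move_left Y))
      (st_of h v) (st_of (shift Y (- int m) (shift Y (-1) h)) v)"
    by (rule runs_LoopT[OF _ runs_move_left 1])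
       (use Suc.prems in \<open>simp add: tape_of_eq_Blank_iff\<close>)
  then show ?case by (simp add: add.commute)
qed

lemma runs_rewind:
  assumes "Blank \<notin> set (v y)" "y \<in> set Y" "h y = int m" "m \<le> length (v y)"
  shows "runs UNIV (2 * m + 3) (rewind Y y) (st_of h v) (st_of (shift Y (- int m) h) v)"
proof -
  have "runs UNIV (2 * m + 1) (Loop (\<lambda>rd. rd y \<noteq> Blank) (move_all Move_left Y))
      (st_of (shift Y (-1) h) v) (st_of (shift Y (- int m) (shift Y (-1) h)) v)"
    using assms by (intro runs_rewind_loop) (auto simp: shift_apply)
  from runs_Seq[OF runs_move_left runs_Seq[OF this runs_move_right[of Y]]]
  show ?thesis unfolding rewind_def by (simp add: eval_nat_numeral)
qed

definition for_each :: "nat list \<Rightarrow> nat \<Rightarrow> com \<Rightarrow> com" where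
  "for_each Y y c = Loop (\<lambda>rd. rd y \<noteq> Blank) (c ;; move_all Move_right Y) ;; rewind Y y"

lemma runs_for_each_loop:
  assumes "y \<in> set Y"
    and "\<And>k. k \<le> m \<Longrightarrow> Blank \<notin> set (v k y) \<and> length (v k y) = m \<and> h k y = 0"
    and "\<And>k. k < m \<Longrightarrow> runs S T c (st_of (shift Y (int k) (h k)) (v k))
      (st_of (shift Y (int k) (h (Suc k))) (v (Suc k)))"
    and S: "\<And>k i. k \<le> m \<Longrightarrow> {h k i - 1 .. h k i + int m + 1} \<subseteq> S"
    and "k \<le> m"
  shows "runs S ((m - k) * (T + 2) + 1) (Loop (\<lambda>rd. rd y \<noteq> Blank) (c ;; move_all Move_right Y))
    (st_of (shift Y (int k) (h k)) (v k)) (st_of (shift Y (int m) (h m)) (v m))"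
  using assms(5)
proof (induction "m - k" arbitrary: k)
  case 0
  then have "m = k" by simp
  moreover have "heads_in S (st_of (shift Y (int m) (h m)) (v m))"
  proof -
    have "{h m i - 1 .. h m i + int m + 1} \<subseteq> S" for i by (rule S) simp
    moreover have "shift Y (int m) (h m) i \<in> {h m i - 1 .. h m i + int m + 1}" for i
      by (simp add: shift_apply)
    ultimately have "shift Y (int m) (h m) i \<in> S" for i by blast
    then show ?thesis by (auto simp: heads_in_def)
  qed
  moreover have "scan (st_of (shift Y (int m) (h m)) (v m)) y = Blank"
    using assms(1) assms(2)[of m] by (simp add: shift_apply tape_of_eq_Blank_iff)
  ultimately show ?case
    using runs_LoopF[of "\<lambda>rd. rd y \<noteq> Blank" "st_of (shift Y (int m) (h m)) (v m)" S] by simp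
next
  case (Suc d)
  then have k: "k < m" "Suc k \<le> m" "d = m - Suc k" by auto
  have "runs UNIV 1 (move_all Move_right Y) (st_of (shift Y (int k) (h (Suc k))) (v (Suc k)))
      (st_of (shift Y (int (Suc k)) (h (Suc k))) (v (Suc k)))"
    using runs_move_right[of Y "shift Y (int k) (h (Suc k))" "v (Suc k)"]
    by (simp add: add.commute)
  then have mv: "runs S 1 (move_all Move_right Y) (st_of (shift Y (int k) (h (Suc k))) (v (Suc k)))
      (st_of (shift Y (int (Suc k)) (h (Suc k))) (v (Suc k)))"
  proof (rule runs_local)
    fix i
    show "{fst (st_of (shift Y (int k) (h (Suc k))) (v (Suc k))) i - int 1..
       fst (st_of (shift Y (int k) (h (Suc k))) (v (Suc k))) i + int 1} \<subseteq> S"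
      using k by (intro order_trans[OF _ S[of "Suc k" i]]) (auto simp: shift_apply)
  qed
  have "runs S (T + 1) (c ;; move_all Move_right Y) (st_of (shift Y (int k) (h k)) (v k))
      (st_of (shift Y (int (Suc k)) (h (Suc k))) (v (Suc k)))"
    using assms(3)[OF k(1)] mv by (rule runs_Seq)
  then have "runs S (Suc ((T + 1) + ((m - Suc k) * (T + 2) + 1)))
      (Loop (\<lambda>rd. rd y \<noteq> Blank) (c ;; move_all Move_right Y))
      (st_of (shift Y (int k) (h k)) (v k)) (st_of (shift Y (int m) (h m)) (v m))"
    using Suc.hyps(1)[OF k(3) k(2)] assms(1) assms(2)[of k] k(1)
    by (intro runs_LoopT) (auto simp: shift_apply tape_of_eq_Blank_iff)
  moreover have "m - k = Suc (m - Suc k)" using k by simp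
  ultimately show ?case by (simp add: algebra_simps)
qed

lemma runs_for_each:
  assumes "y \<in> set Y"
    and "\<And>k. k \<le> m \<Longrightarrow> Blank \<notin> set (v k y) \<and> length (v k y) = m \<and> h k y = 0"
    and "\<And>k. k < m \<Longrightarrow> runs S T c (st_of (shift Y (int k) (h k)) (v k))
      (st_of (shift Y (int k) (h (Suc k))) (v (Suc k)))"
    and S: "\<And>k i. k \<le> m \<Longrightarrow> {h k i - int (2 * m + 3) .. h k i + int (3 * m + 3)} \<subseteq> S"
  shows "runs S (m * (T + 4) + 4) (for_each Y y c) (st_of (h 0) (v 0)) (st_of (h m) (v m))"
proof -
  have S1: "{h k i - 1 .. h k i + int m + 1} \<subseteq> S" if "k \<le> m" for k i
    by (rule order_trans[OF _ S[OF that, of i]]) auto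
  have 1: "runs S (m * (T + 2) + 1) (Loop (\<lambda>rd. rd y \<noteq> Blank) (c ;; move_all Move_right Y))
    (st_of (h 0) (v 0)) (st_of (shift Y (int m) (h m)) (v m))"
    using runs_for_each_loop[OF assms(1,2,3) S1, of 0] by simp
  have "runs UNIV (2 * m + 3) (rewind Y y) (st_of (shift Y (int m) (h m)) (v m))
      (st_of (shift Y (- int m) (shift Y (int m) (h m))) (v m))"
    using assms(1) assms(2)[of m] by (intro runs_rewind) (auto simp: shift_apply)
  then have 2: "runs S (2 * m + 3) (rewind Y y) (st_of (shift Y (int m) (h m)) (v m)) (st_of (h m) (v m))"
    unfolding shift_shift minus_add shift_0 left_minus
  proof (rule runs_local)
    fix i
    show "{fst (st_of (shift Y (int m) (h m)) (v m)) i - int (2 * m + 3)..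
       fst (st_of (shift Y (int m) (h m)) (v m)) i + int (2 * m + 3)} \<subseteq> S"
      by (intro order_trans[OF _ S[of m i]]) (auto simp: shift_apply)
  qed
  show ?thesis unfolding for_each_def
    by (rule runs_mono[OF runs_Seq[OF 1 2]]) (simp add: algebra_simps)
qed

definition append_map :: "(symbol \<Rightarrow> symbol) \<Rightarrow> nat \<Rightarrow> nat \<Rightarrow> com" where
  "append_map f y x = Loop (\<lambda>rd. rd x \<noteq> Blank)
     (Step (\<lambda>rd. (idle rd)(x := (rd x, Move_right), y := (f (rd x), Move_right)))) ;;
   rewind [x] x"

lemma runs_append_map_loop:
  assumes "x \<noteq> y" "h y = int (length (v y))" "h x = int (length ps)" "v x = ps @ zs" "Blank \<notin> set zs"
  shows "runs UNIV (2 * length zs + 1) (Loop (\<lambda>rd. rd x \<noteq> Blank)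
     (Step (\<lambda>rd. (idle rd)(x := (rd x, Move_right), y := (f (rd x), Move_right)))))
     (st_of h v) (st_of (h(x := h x + int (length zs), y := h y + int (length zs)))
       (v(y := v y @ map f zs)))"
  using assms
proof (induction zs arbitrary: ps h v)
  case Nil
  have "h(x := h x + int (length []), y := h y + int (length [])) = h" "v(y := v y @ map f []) = v"
    by simp_all
  moreover have "scan (st_of h v) x = Blank" using Nil by simp
  ultimately show ?case using runs_LoopF[of "\<lambda>rd. rd x \<noteq> Blank" "st_of h v" UNIV] by simp
next
  case (Cons z zs)
  let ?c = "Step (\<lambda>rd. (idle rd)(x := (rd x, Move_right), y := (f (rd x), Move_right)))"
  let ?h = "h(x := h x + 1, y := h y + 1)" and ?v = "v(y := v y @ [f z])"
  have t: "tape_of (v x) (h x) = z" "(tape_of (v y))(h y := f z) = tape_of (v y @ [f z])"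
    using Cons.prems by simp_all
  have t': "(tape_of (v x))(h x := z) = tape_of (v x)" using t(1) by auto
  have 1: "runs UNIV 1 ?c (st_of h v) (st_of ?h ?v)"
    by (rule runs_Step) (use Cons.prems(1) in \<open>simp add: t t'\<close>)
  have 2: "runs UNIV (2 * length zs + 1) (Loop (\<lambda>rd. rd x \<noteq> Blank) ?c) (st_of ?h ?v)
      (st_of (?h(x := ?h x + int (length zs), y := ?h y + int (length zs))) (?v(y := ?v y @ map f zs)))"
    using Cons.prems by (intro Cons.IH[of _ _ "ps @ [z]"]) auto
  have "(?h(x := ?h x + int (length zs), y := ?h y + int (length zs))) =
      h(x := h x + int (length (z # zs)), y := h y + int (length (z # zs)))"
    using Cons.prems(1) by auto
  moreover have "?v(y := ?v y @ map f zs) = v(y := v y @ map f (z # zs))" by simp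
  moreover have "scan (st_of h v) x \<noteq> Blank" using Cons.prems by auto
  ultimately show ?case
    using runs_LoopT[of "\<lambda>rd. rd x \<noteq> Blank", OF _ 1 2] by (simp del: fun_upd_apply)
qed

lemma runs_append_map:
  assumes "x \<noteq> y" "h y = int (length (v y))" "h x = 0" "Blank \<notin> set (v x)"
  shows "runs UNIV (4 * length (v x) + 4) (append_map f y x) (st_of h v)
    (st_of (h(y := h y + int (length (v x)))) (v(y := v y @ map f (v x))))"
proof -
  let ?m = "length (v x)"
  let ?h = "h(x := h x + int ?m, y := h y + int ?m)" and ?v = "v(y := v y @ map f (v x))"
  have "runs UNIV (2 * ?m + 3) (rewind [x] x) (st_of ?h ?v) (st_of (shift [x] (- int ?m) ?h) ?v)"
    using assms by (intro runs_rewind) auto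
  moreover have "shift [x] (- int ?m) ?h = h(y := h y + int ?m)"
    using assms by (auto simp: shift_def)
  ultimately show ?thesis unfolding append_map_def using assms
    by (intro runs_Seq_le[OF runs_append_map_loop[where ps = "[]"]]) auto
qed

definition repeat_append :: "nat \<Rightarrow> nat \<Rightarrow> nat \<Rightarrow> com" where
  "repeat_append c y x = for_each [c] c (append_map id y x)"

lemma runs_repeat_append:
  assumes "x \<noteq> y" "c \<noteq> y" "c \<noteq> x" "h y = int (length (v y))" "h x = 0" "h c = 0"
    and "Blank \<notin> set (v x)" "Blank \<notin> set (v c)"
    and "xs = concat (replicate (length (v c)) (v x))"
  shows "runs UNIV (length (v c) * (4 * length (v x) + 8) + 4) (repeat_append c y x) (st_of h v)
    (st_of (h(y := h y + int (length xs))) (v(y := v y @ xs)))"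
proof -
  let ?v = "\<lambda>k. v(y := v y @ concat (replicate k (v x)))"
  let ?h = "\<lambda>k. h(y := h y + int (length (concat (replicate k (v x)))))"
  have "runs UNIV (length (v c) * ((4 * length (v x) + 4) + 4) + 4) (for_each [c] c (append_map id y x))
     (st_of (?h 0) (?v 0)) (st_of (?h (length (v c))) (?v (length (v c))))"
  proof (rule runs_for_each)
    fix k
    let ?H = "shift [c] (int k) (?h k)"
    have e: "concat (replicate k (v x)) @ v x = concat (replicate (Suc k) (v x))"
      by (metis concat.simps(2) concat_append append_Nil2 concat.simps(1) replicate_Suc
          replicate_append_same)
    have "runs UNIV (4 * length (?v k x) + 4) (append_map id y x) (st_of ?H (?v k))
      (st_of (?H(y := ?H y + int (length (?v k x)))) ((?v k)(y := ?v k y @ map id (?v k x))))"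
      using assms by (intro runs_append_map) (auto simp: shift_apply)
    moreover have "?H(y := ?H y + int (length (?v k x))) = shift [c] (int k) (?h (Suc k))"
      using assms by (auto simp: shift_def)
    moreover have "(?v k)(y := ?v k y @ map id (?v k x)) = ?v (Suc k)"
      using assms(1) by (simp add: e del: replicate_Suc concat.simps)
    ultimately show "runs UNIV (4 * length (v x) + 4) (append_map id y x)
      (st_of (shift [c] (int k) (?h k)) (?v k)) (st_of (shift [c] (int k) (?h (Suc k))) (?v (Suc k)))"
      using assms(1) by simp
  qed (use assms in auto)
  then show ?thesis using assms(9) by (simp add: repeat_append_def add.assoc)
qed

section \<open>Addition of shifted two's complement numbers\<close>

abbreviation val :: "bool list \<Rightarrow> int" where
  "val \<equiv> horner_sum of_bool 2"

fun addc :: "bool \<Rightarrow> bool \<Rightarrow> bool list \<Rightarrow> bool list \<Rightarrow> bool list" where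
  "addc n c (x # xs) (y # ys) =
     (x \<noteq> ((y \<noteq> n) \<noteq> c)) # addc n ((x \<and> (y \<noteq> n)) \<or> (x \<and> c) \<or> ((y \<noteq> n) \<and> c)) xs ys"
| "addc n c _ _ = []"

lemma length_addc: "length xs \<le> length ys \<Longrightarrow> length (addc n c xs ys) = length xs"
  by (induction n c xs ys rule: addc.induct) auto

lemma val_addc:
  assumes "length xs \<le> length ys"
  shows "\<exists>q. val (addc n c xs ys) =
    val xs + (if n then - val ys - 1 else val ys) + of_bool c + q * 2 ^ length xs"
  using assms
proof (induction n c xs ys rule: addc.induct)
  case (1 n c x xs y ys)
  then obtain q where "val (addc n ((x \<and> (y \<noteq> n)) \<or> (x \<and> c) \<or> ((y \<noteq> n) \<and> c)) xs ys) =
      val xs + (if n then - val ys - 1 else val ys) +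
      of_bool ((x \<and> (y \<noteq> n)) \<or> (x \<and> c) \<or> ((y \<noteq> n) \<and> c)) + q * 2 ^ length xs"
    by auto
  then show ?case by (intro exI[of _ q]) (cases n; cases c; cases x; cases y; simp)
next
  case ("2_1" n c ys)
  then show ?case by (intro exI[of _ "- (if n then - val ys - 1 else val ys) - of_bool c"]) simp
next
  case ("2_2" n c xs)
  then show ?case by (intro exI[of _ "- (if n then - 1 else 0) - of_bool c"]) simp
qed

definition add_at :: "nat \<Rightarrow> bool \<Rightarrow> bool list \<Rightarrow> bool list \<Rightarrow> bool list" where
  "add_at k n xs ys = take k xs @ addc n n (drop k xs) ys"

lemma length_add_at: "k \<le> length xs \<Longrightarrow> length xs \<le> length ys \<Longrightarrow> length (add_at k n xs ys) = length xs"
  by (simp add: add_at_def length_addc)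

lemma val_add_at:
  assumes "k \<le> length xs" "length xs \<le> length ys"
  shows "\<exists>q. val (add_at k n xs ys) =
    val xs + (if n then - 1 else 1) * 2 ^ k * val ys + q * 2 ^ length xs"
proof -
  have "length (drop k xs) \<le> length ys" using assms by simp
  from val_addc[OF this, of n n] obtain q where "val (addc n n (drop k xs) ys) =
      val (drop k xs) + (if n then - val ys - 1 else val ys) + of_bool n + q * 2 ^ length (drop k xs)"
    by blast
  then have q: "val (addc n n (drop k xs) ys) =
      val (drop k xs) + (if n then - val ys - 1 else val ys) + of_bool n + q * 2 ^ (length xs - k)"
    by simp
  have "val xs = val (take k xs @ drop k xs)" by simp
  also have "\<dots> = val (take k xs) + 2 ^ k * val (drop k xs)"
    unfolding horner_sum_append using assms by (simp add: min_def)
  finally have x: "val xs = val (take k xs) + 2 ^ k * val (drop k xs)" .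
  have p: "(2::int) ^ length xs = 2 ^ k * 2 ^ (length xs - k)"
    using assms by (simp flip: power_add)
  show ?thesis unfolding add_at_def horner_sum_append q p x using assms
    by (intro exI[of _ q]) (auto simp: min_def algebra_simps)
qed

definition add_step :: "nat \<Rightarrow> nat \<Rightarrow> bool \<Rightarrow> com" where
  "add_step d s n = Step (\<lambda>rd.
       let x = (rd d = Bit True); y = (rd s = Bit True); c = (rd 17 = Bit True) in
         (idle rd)(d := (Bit (x \<noteq> ((y \<noteq> n) \<noteq> c)), Move_right), s := (rd s, Move_right),
           17 := (Bit ((x \<and> (y \<noteq> n)) \<or> (x \<and> c) \<or> ((y \<noteq> n) \<and> c)), Stay)))"

definition add_loop :: "nat \<Rightarrow> nat \<Rightarrow> bool \<Rightarrow> com" where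
  "add_loop d s n = Loop (\<lambda>rd. rd d \<noteq> Blank) (add_step d s n)"

definition add_reg :: "nat \<Rightarrow> nat \<Rightarrow> nat \<Rightarrow> bool \<Rightarrow> com" where
  "add_reg d s r n =
     forward [r, d] r ;; rewind [r] r ;;
     Step (\<lambda>rd. (idle rd)(17 := (Bit n, Stay))) ;;
     add_loop d s n ;;
     Step (\<lambda>rd. (idle rd)(17 := (Blank, Stay))) ;; rewind [d] d ;; rewind [s] s"

lemma tape_of_single: "tape_of [y] 0 = y" "(tape_of [y])(0 := z) = tape_of [z]"
  "(tape_of [])(0 := z) = tape_of [z]" "(tape_of [y])(0 := Blank) = tape_of []"
  by (auto simp: tape_of_def fun_eq_iff)

lemma runs_add_loop:
  assumes "d \<noteq> s" "d \<noteq> 17" "s \<noteq> 17" "h d = int (length ps)" "v d = ps @ map Bit xs"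
    and "h s = int (length qs)" "v s = qs @ map Bit ys" "h 17 = 0" "v 17 = [Bit c]"
    and "length xs \<le> length ys"
  shows "\<exists>c'. runs UNIV (2 * length xs + 1)
    (add_loop d s n)
    (st_of h v) (st_of (h(d := h d + int (length xs), s := h s + int (length xs)))
      (v(d := ps @ map Bit (addc n c xs ys), 17 := [Bit c'])))"
  using assms
proof (induction xs arbitrary: c ys ps qs h v)
  case Nil
  have "h(d := h d + int (length []), s := h s + int (length [])) = h" by simp
  moreover have "v(d := ps @ map Bit (addc n c [] ys), 17 := [Bit c]) = v" using Nil by auto
  moreover have "scan (st_of h v) d = Blank" using Nil by simp
  ultimately show ?case
    using runs_LoopF[of "\<lambda>rd. rd d \<noteq> Blank" "st_of h v" UNIV "add_step d s n"]
    by (intro exI[of _ c]) (simp add: add_loop_def del: fun_upd_apply)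
next
  case (Cons x xs c ys0)
  then obtain y ys where ys0: "ys0 = y # ys" by (cases ys0) auto
  note 1 = Cons.prems[unfolded ys0]
  define z where "z = (x \<noteq> ((y \<noteq> n) \<noteq> c))"
  define c1 where "c1 = ((x \<and> (y \<noteq> n)) \<or> (x \<and> c) \<or> ((y \<noteq> n) \<and> c))"
  let ?h = "h(d := h d + 1, s := h s + 1)"
  let ?v = "v(d := ps @ Bit z # map Bit xs, 17 := [Bit c1])"
  have sc: "tape_of (v d) (h d) = Bit x" "tape_of (v s) (h s) = Bit y" "tape_of (v 17) (h 17) = Bit c"
    using 1 by (simp_all add: tape_of_single)
  have st: "runs UNIV 1 (add_step d s n) (st_of h v) (st_of ?h ?v)"
    unfolding add_step_def
  proof (rule runs_Step)
    have t: "(tape_of (v 17))(h 17 := Bit c1) = tape_of [Bit c1]"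
      "(tape_of (v d))(h d := Bit z) = tape_of (ps @ Bit z # map Bit xs)"
      "(tape_of (v s))(h s := Bit y) = tape_of (v s)"
      using 1 sc by (auto simp: tape_of_single)
    have h: "h(d := h d + 1, s := h s + 1, 17 := h 17) = ?h"
      and v: "v(d := ps @ Bit z # map Bit xs, s := v s, 17 := [Bit c1]) = ?v"
      using 1 by auto
    have "eff ((idle (scan (st_of h v)))(d := (Bit z, Move_right), s := (Bit y, Move_right),
           17 := (Bit c1, Stay))) (st_of h v) = st_of ?h ?v"
      using 1(1-3) by (simp add: t h v)
    then show "eff (let x = (scan (st_of h v) d = Bit True); y = (scan (st_of h v) s = Bit True);
        c = (scan (st_of h v) 17 = Bit True) in
         (idle (scan (st_of h v)))(d := (Bit (x \<noteq> ((y \<noteq> n) \<noteq> c)), Move_right),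
           s := (scan (st_of h v) s, Move_right),
           17 := (Bit ((x \<and> (y \<noteq> n)) \<or> (x \<and> c) \<or> ((y \<noteq> n) \<and> c)), Stay))) (st_of h v) =
        st_of ?h ?v"
      by (simp only: Let_def scan_st_of sc symbol.inject eq_True z_def c1_def)
  qed
  have "\<exists>c'. runs UNIV (2 * length xs + 1) (add_loop d s n)
    (st_of ?h ?v) (st_of (?h(d := ?h d + int (length xs), s := ?h s + int (length xs)))
      (?v(d := (ps @ [Bit z]) @ map Bit (addc n c1 xs ys), 17 := [Bit c'])))"
    unfolding c1_def
    by (rule Cons.IH[where qs = "qs @ [Bit y]"]) (use 1 in \<open>auto simp: c1_def\<close>)
  then obtain c' where 2: "runs UNIV (2 * length xs + 1) (add_loop d s n)
    (st_of ?h ?v) (st_of (?h(d := ?h d + int (length xs), s := ?h s + int (length xs)))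
      (?v(d := (ps @ [Bit z]) @ map Bit (addc n c1 xs ys), 17 := [Bit c'])))" ..
  have "?h(d := ?h d + int (length xs), s := ?h s + int (length xs)) =
      h(d := h d + int (length (x # xs)), s := h s + int (length (x # xs)))"
    using 1 by auto
  moreover have "?v(d := (ps @ [Bit z]) @ map Bit (addc n c1 xs ys), 17 := [Bit c']) =
      v(d := ps @ map Bit (addc n c (x # xs) (y # ys)), 17 := [Bit c'])"
    using 1 by (auto simp: z_def c1_def)
  ultimately show ?case
    using runs_LoopT[of "\<lambda>rd. rd d \<noteq> Blank", OF _ st 2[unfolded add_loop_def]] sc(1)
    unfolding ys0 add_loop_def by (intro exI[of _ c']) (simp del: fun_upd_apply)
qed

lemma runs_add_reg:
  assumes "distinct [d, s, r, 17]" "h d = 0" "h s = 0" "h r = 0" "h 17 = 0"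
    and "v d = map Bit xs" "v s = map Bit ys" "v 17 = []" "Blank \<notin> set (v r)"
    and "length (v r) \<le> length xs" "length xs \<le> length ys"
  shows "runs UNIV (8 * length xs + 13) (add_reg d s r n) (st_of h v)
    (st_of h (v(d := map Bit (add_at (length (v r)) n xs ys))))"
proof -
  define k where "k = length (v r)"
  let ?m = "length xs"
  let ?h1 = "shift [r, d] (int k) h" and ?h2 = "h(d := int k)"
  let ?v3 = "v(17 := [Bit n])"
  have 1: "runs UNIV (2 * k + 1) (forward [r, d] r) (st_of h v) (st_of ?h1 v)"
    using assms by (intro runs_forward[where p = 0]) (auto simp: k_def)
  have "runs UNIV (2 * k + 3) (rewind [r] r) (st_of ?h1 v) (st_of (shift [r] (- int k) ?h1) v)"
    using assms by (intro runs_rewind) (auto simp: k_def shift_apply)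
  moreover have "shift [r] (- int k) ?h1 = ?h2" using assms by (auto simp: shift_def)
  ultimately have 2: "runs UNIV (2 * k + 3) (rewind [r] r) (st_of ?h1 v) (st_of ?h2 v)" by simp
  have 3: "runs UNIV 1 (Step (\<lambda>rd. (idle rd)(17 := (Bit n, Stay)))) (st_of ?h2 v) (st_of ?h2 ?v3)"
  proof (rule runs_Step)
    have "?h2(17 := 0) = ?h2" using assms by auto
    then show "eff ((idle (scan (st_of ?h2 v)))(17 := (Bit n, Stay))) (st_of ?h2 v) = st_of ?h2 ?v3"
      using assms(1,5,8) by (simp add: tape_of_single)
  qed
  let ?zs = "addc n n (drop k xs) ys"
  have "?v3 d = map Bit (take k xs) @ map Bit (drop k xs)"
    using assms(1,6) by (simp flip: map_append)
  then have "\<exists>c'. runs UNIV (2 * length (drop k xs) + 1) (add_loop d s n)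
    (st_of ?h2 ?v3) (st_of (?h2(d := ?h2 d + int (length (drop k xs)), s := ?h2 s + int (length (drop k xs))))
      (?v3(d := map Bit (take k xs) @ map Bit ?zs, 17 := [Bit c'])))"
    by (intro runs_add_loop[where qs = "[]"]) (use assms in \<open>auto simp: k_def min_def\<close>)
  then obtain c' where 4: "runs UNIV (2 * length (drop k xs) + 1) (add_loop d s n)
    (st_of ?h2 ?v3) (st_of (?h2(d := ?h2 d + int (length (drop k xs)), s := ?h2 s + int (length (drop k xs))))
      (?v3(d := map Bit (take k xs) @ map Bit ?zs, 17 := [Bit c'])))" ..
  let ?h4 = "h(d := int ?m, s := int (?m - k))"
  let ?v5 = "v(d := map Bit (add_at k n xs ys))"
  let ?v4 = "?v5(17 := [Bit c'])"
  have "?h2(d := ?h2 d + int (length (drop k xs)), s := ?h2 s + int (length (drop k xs))) = ?h4"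
    using assms by (auto simp: k_def of_nat_diff)
  moreover have "?v3(d := map Bit (take k xs) @ map Bit ?zs, 17 := [Bit c']) = ?v4"
    using assms(1) by (auto simp: add_at_def)
  ultimately have 4: "runs UNIV (2 * (?m - k) + 1) (add_loop d s n)
    (st_of ?h2 ?v3) (st_of ?h4 ?v4)"
    using 4 by simp
  have 5: "runs UNIV 1 (Step (\<lambda>rd. (idle rd)(17 := (Blank, Stay)))) (st_of ?h4 ?v4) (st_of ?h4 ?v5)"
  proof (rule runs_Step)
    have "?h4(17 := 0) = ?h4" "?v4(17 := []) = ?v5" using assms by auto
    then show "eff ((idle (scan (st_of ?h4 ?v4)))(17 := (Blank, Stay))) (st_of ?h4 ?v4) = st_of ?h4 ?v5"
      using assms(1,5) by (simp add: tape_of_single(4))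
  qed
  have "runs UNIV (2 * ?m + 3) (rewind [d] d) (st_of ?h4 ?v5) (st_of (shift [d] (- int ?m) ?h4) ?v5)"
    using assms by (intro runs_rewind) (auto simp: k_def length_add_at)
  moreover have "shift [d] (- int ?m) ?h4 = h(s := int (?m - k))" using assms by (auto simp: shift_def)
  ultimately have 6: "runs UNIV (2 * ?m + 3) (rewind [d] d) (st_of ?h4 ?v5)
      (st_of (h(s := int (?m - k))) ?v5)" by simp
  have "runs UNIV (2 * (?m - k) + 3) (rewind [s] s) (st_of (h(s := int (?m - k))) ?v5)
      (st_of (shift [s] (- int (?m - k)) (h(s := int (?m - k)))) ?v5)"
    using assms by (intro runs_rewind) (auto simp: k_def)
  moreover have "shift [s] (- int (?m - k)) (h(s := int (?m - k))) = h" using assms by (auto simp: shift_def)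
  ultimately have 7: "runs UNIV (2 * (?m - k) + 3) (rewind [s] s) (st_of (h(s := int (?m - k))) ?v5)
      (st_of h ?v5)" by simp
  show ?thesis
    unfolding add_reg_def k_def[symmetric]
    by (rule runs_mono[OF runs_Seq[OF 1 runs_Seq[OF 2 runs_Seq[OF 3 runs_Seq[OF 4
      runs_Seq[OF 5 runs_Seq[OF 6 7]]]]]]]) (use assms in \<open>simp add: k_def\<close>)
qed

section \<open>Printing the table\<close>

definition mag :: "bool list \<Rightarrow> symbol list" where
  "mag bs = (let r = dropWhile Not (rev (butlast bs)) in if r = [] then [Bit False] else map Bit r)"

definition put_mag :: "nat \<Rightarrow> com" where
  "put_mag x = move_all Move_left [7, 14, 15] ;;
     Loop (\<lambda>rd. rd 7 \<noteq> Blank \<and> rd x = Bit False) (move_all Move_left [7, 14, 15]) ;;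
     Cond (\<lambda>rd. rd 7 = Blank) (put 1 (Bit False))
       (Loop (\<lambda>rd. rd 7 \<noteq> Blank)
         (Step (\<lambda>rd. (idle rd)(1 := (rd x, Move_right))) ;; move_all Move_left [7, 14, 15])) ;;
     move_all Move_right [7, 14, 15]"

lemma tape_of_block:
  "k < length bs \<Longrightarrow> tape_of (ps @ map Bit bs @ qs) (int (length ps) + int k) = Bit (bs ! k)"
  by (simp add: tape_of_def nth_append nat_add_distrib)

lemma runs_skip_zeros:
  assumes "x \<in> {14, 15}" "v x = ps @ map Bit bs @ qs" "length bs = length (v 7)" "Blank \<notin> set (v 7)"
    and "h 7 = int m - 1" "h x = int (length ps) + int m - 1" "m \<le> length bs"
  shows "runs UNIV (2 * m + 1)
    (Loop (\<lambda>rd. rd 7 \<noteq> Blank \<and> rd x = Bit False) (move_all Move_left [7, 14, 15])) (st_of h v)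
    (st_of (shift [7, 14, 15] (int (length (dropWhile Not (rev (take m bs)))) - int m) h) v)"
  using assms(5-)
proof (induction m arbitrary: h)
  case 0
  have "scan (st_of h v) 7 = Blank" using 0 by simp
  then show ?case
    using runs_LoopF[of "\<lambda>rd. rd 7 \<noteq> Blank \<and> rd x = Bit False" "st_of h v" UNIV
        "move_all Move_left [7, 14, 15]"] by simp
next
  case (Suc m)
  have r: "rev (take (Suc m) bs) = bs ! m # rev (take m bs)"
    using Suc.prems by (simp add: take_Suc_conv_app_nth)
  have x: "scan (st_of h v) x = Bit (bs ! m)"
    using Suc.prems assms(2) tape_of_block[of m bs ps qs] by simp
  have 7: "scan (st_of h v) 7 \<noteq> Blank"
    using Suc.prems assms(3,4) by (simp add: tape_of_eq_Blank_iff)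
  show ?case
  proof (cases "bs ! m")
    case True
    then show ?thesis using r x Suc.prems(3)
        runs_LoopF[of "\<lambda>rd. rd 7 \<noteq> Blank \<and> rd x = Bit False" "st_of h v" UNIV
        "move_all Move_left [7, 14, 15]"]
      by (auto simp: min_def intro: runs_mono)
  next
    case False
    have "runs UNIV (2 * m + 1)
      (Loop (\<lambda>rd. rd 7 \<noteq> Blank \<and> rd x = Bit False) (move_all Move_left [7, 14, 15]))
      (st_of (shift [7, 14, 15] (-1) h) v)
      (st_of (shift [7, 14, 15] (int (length (dropWhile Not (rev (take m bs)))) - int m)
        (shift [7, 14, 15] (-1) h)) v)"
      by (rule Suc.IH) (use Suc.prems assms(1) in \<open>auto simp: shift_apply\<close>)
    from runs_LoopT[of "\<lambda>rd. rd 7 \<noteq> Blank \<and> rd x = Bit False", OF _ runs_move_left this]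
    show ?thesis using False x 7 r by (simp add: algebra_simps)
  qed
qed

lemma runs_put_bits:
  assumes "x \<in> {14, 15}" "v x = ps @ map Bit bs @ qs" "length bs = length (v 7)" "Blank \<notin> set (v 7)"
    and "h 7 = int m - 1" "h x = int (length ps) + int m - 1" "m \<le> length bs" "h 1 = int (length (v 1))"
  shows "runs UNIV (3 * m + 1)
    (Loop (\<lambda>rd. rd 7 \<noteq> Blank)
         (Step (\<lambda>rd. (idle rd)(1 := (rd x, Move_right))) ;; move_all Move_left [7, 14, 15])) (st_of h v)
    (st_of ((shift [7, 14, 15] (- int m) h)(1 := h 1 + int m)) (v(1 := v 1 @ map Bit (rev (take m bs)))))"
  using assms
proof (induction m arbitrary: h v)
  case 0
  have "scan (st_of h v) 7 = Blank" using 0 by simp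
  moreover have "h(1 := h 1 + int 0) = h" "v(1 := v 1 @ map Bit (rev (take 0 bs))) = v" by simp_all
  ultimately show ?case
    using runs_LoopF[of "\<lambda>rd. rd 7 \<noteq> Blank" "st_of h v" UNIV] by (simp del: fun_upd_apply)
next
  case (Suc m)
  have r: "rev (take (Suc m) bs) = bs ! m # rev (take m bs)"
    using Suc.prems by (simp add: take_Suc_conv_app_nth)
  have x: "tape_of (v x) (h x) = Bit (bs ! m)"
    using Suc.prems tape_of_block[of m bs ps qs] by simp
  have 7: "scan (st_of h v) 7 \<noteq> Blank"
    using Suc.prems by (simp add: tape_of_eq_Blank_iff)
  let ?c = "Step (\<lambda>rd. (idle rd)(1 := (rd x, Move_right)))"
  let ?h1 = "h(1 := h 1 + 1)" and ?v = "v(1 := v 1 @ [Bit (bs ! m)])"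
  let ?h = "shift [7, 14, 15] (-1) ?h1"
  have w: "(tape_of (v 1))(h 1 := Bit (bs ! m)) = tape_of (v 1 @ [Bit (bs ! m)])"
    using Suc.prems(8) by simp
  have "runs UNIV 1 ?c (st_of h v) (st_of ?h1 ?v)"
    by (rule runs_Step) (simp add: x w del: One_nat_def)
  from runs_Seq[OF this runs_move_left]
  have 1: "runs UNIV (1 + 1) (?c ;; move_all Move_left [7, 14, 15]) (st_of h v) (st_of ?h ?v)" .
  have 2: "runs UNIV (3 * m + 1) (Loop (\<lambda>rd. rd 7 \<noteq> Blank) (?c ;; move_all Move_left [7, 14, 15]))
    (st_of ?h ?v) (st_of ((shift [7, 14, 15] (- int m) ?h)(1 := ?h 1 + int m))
      (?v(1 := ?v 1 @ map Bit (rev (take m bs)))))"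
    by (rule Suc.IH) (use Suc.prems in \<open>auto simp: shift_apply\<close>)
  have "(shift [7, 14, 15] (- int m) ?h)(1 := ?h 1 + int m) =
      (shift [7, 14, 15] (- int (Suc m)) h)(1 := h 1 + int (Suc m))"
    by (auto simp: shift_def)
  moreover have "?v(1 := ?v 1 @ map Bit (rev (take m bs))) =
      v(1 := v 1 @ map Bit (rev (take (Suc m) bs)))"
    using r by simp
  ultimately show ?case
    using runs_mono[OF runs_LoopT[of "\<lambda>rd. rd 7 \<noteq> Blank", OF _ 1 2], of "3 * Suc m + 1"] 7
    by (simp del: fun_upd_apply)
qed

lemma rev_take_dropWhile:
  assumes "m = length (dropWhile P (rev xs))"
  shows "rev (take m xs) = dropWhile P (rev xs)"
proof -
  have "dropWhile P (rev xs) = drop (length xs - m) (rev xs)"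
    using assms by (metis dropWhile_eq_drop length_dropWhile_le length_rev length_drop
        diff_diff_cancel length_takeWhile_le)
  then show ?thesis using assms length_dropWhile_le[of P "rev xs"] by (simp add: drop_rev)
qed

lemma runs_put_mag:
  assumes "x \<in> {14, 15}" "v x = ps @ map Bit bs @ qs" "length bs = length (v 7)" "Blank \<notin> set (v 7)"
    and "h 7 = int (length bs) - 1" "h x = int (length ps) + int (length bs) - 1" "bs \<noteq> []"
    and "h 1 = int (length (v 1))"
  shows "runs UNIV (5 * length bs + 7) (put_mag x) (st_of h v)
    (st_of ((shift [7, 14, 15] (1 - int (length bs)) h)(1 := h 1 + int (length (mag bs))))
      (v(1 := v 1 @ mag bs)))"
proof -
  define lo where "lo = butlast bs"
  define r where "r = dropWhile Not (rev lo)"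
  define m where "m = length r"
  let ?w = "length bs - 1"
  have w: "?w \<le> length bs" "take ?w bs = lo" "length lo = ?w" "length bs \<ge> 1"
    using assms(7) by (auto simp: lo_def butlast_conv_take Suc_leI)
  have mw: "m \<le> ?w" using length_dropWhile_le[of Not "rev lo"] w by (simp add: m_def r_def)
  let ?h1 = "shift [7, 14, 15] (-1) h"
  let ?h2 = "shift [7, 14, 15] (int m - int ?w) ?h1"
  let ?h3 = "(shift [7, 14, 15] (- int m) ?h2)(1 := h 1 + int (length (mag bs)))"
  let ?v = "v(1 := v 1 @ mag bs)"
  have 2: "runs UNIV (2 * ?w + 1)
    (Loop (\<lambda>rd. rd 7 \<noteq> Blank \<and> rd x = Bit False) (move_all Move_left [7, 14, 15])) (st_of ?h1 v)
    (st_of ?h2 v)"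
    using runs_skip_zeros[OF assms(1-4), of ?h1 ?w] assms(1,5,6) w
    by (auto simp: shift_apply r_def m_def)
  have h2: "?h2 7 = int m - 1" "?h2 x = int (length ps) + int m - 1" "?h2 1 = int (length (v 1))"
    using assms(1,5,6,8) w by (auto simp: shift_apply of_nat_diff)
  have 3: "runs UNIV (Suc (3 * ?w + 1)) (Cond (\<lambda>rd. rd 7 = Blank) (put 1 (Bit False))
       (Loop (\<lambda>rd. rd 7 \<noteq> Blank)
         (Step (\<lambda>rd. (idle rd)(1 := (rd x, Move_right))) ;; move_all Move_left [7, 14, 15])))
     (st_of ?h2 v) (st_of ?h3 ?v)"
  proof (rule runs_Cond)
    assume "scan (st_of ?h2 v) 7 = Blank"
    then have m: "m = 0" using h2(1) mw w(4) assms(3,4) by (auto simp: tape_of_eq_Blank_iff)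
    then have "r = []" by (simp add: m_def)
    then have "mag bs = [Bit False]" unfolding mag_def lo_def[symmetric] r_def[symmetric] by simp
    moreover have "?h2(1 := ?h2 1 + 1) = (shift [7, 14, 15] (- int m) ?h2)(1 := h 1 + 1)"
      by (auto simp: m shift_def)
    ultimately have "runs UNIV 1 (put 1 (Bit False)) (st_of ?h2 v) (st_of ?h3 ?v)"
      using runs_put[of ?h2 1 v "Bit False"] h2(3) by simp
    then show "runs UNIV (3 * ?w + 1) (put 1 (Bit False)) (st_of ?h2 v) (st_of ?h3 ?v)"
      by (rule runs_mono) simp
  next
    assume "scan (st_of ?h2 v) 7 \<noteq> Blank"
    then have "r \<noteq> []" using h2(1) by (auto simp: m_def)
    then have mg: "mag bs = map Bit r"
      unfolding mag_def lo_def[symmetric] r_def[symmetric] by simp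
    have "take m bs = take m lo" using mw w(2) by (metis min.absorb1 take_take)
    then have rt: "rev (take m bs) = r"
      using rev_take_dropWhile[of m Not lo] by (simp add: m_def r_def)
    have "runs UNIV (3 * m + 1) (Loop (\<lambda>rd. rd 7 \<noteq> Blank)
         (Step (\<lambda>rd. (idle rd)(1 := (rd x, Move_right))) ;; move_all Move_left [7, 14, 15]))
     (st_of ?h2 v) (st_of ((shift [7, 14, 15] (- int m) ?h2)(1 := ?h2 1 + int m))
       (v(1 := v 1 @ map Bit (rev (take m bs)))))"
      by (rule runs_put_bits[OF assms(1-4) h2(1,2)]) (use h2(3) mw in auto)
    moreover have "?h2 1 + int m = h 1 + int (length (mag bs))"
      by (simp add: mg m_def shift_apply)
    ultimately have "runs UNIV (3 * m + 1) (Loop (\<lambda>rd. rd 7 \<noteq> Blank)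
         (Step (\<lambda>rd. (idle rd)(1 := (rd x, Move_right))) ;; move_all Move_left [7, 14, 15]))
     (st_of ?h2 v) (st_of ?h3 ?v)" by (simp only: rt mg)
    then show "runs UNIV (3 * ?w + 1) (Loop (\<lambda>rd. rd 7 \<noteq> Blank)
         (Step (\<lambda>rd. (idle rd)(1 := (rd x, Move_right))) ;; move_all Move_left [7, 14, 15]))
     (st_of ?h2 v) (st_of ?h3 ?v)" by (rule runs_mono) (use mw in simp)
  qed
  have h3: "shift [7, 14, 15] 1 ?h3 =
      (shift [7, 14, 15] (1 - int (length bs)) h)(1 := h 1 + int (length (mag bs)))"
    using w(4) by (auto simp: shift_def of_nat_diff)
  from runs_Seq[OF runs_move_left runs_Seq[OF 2 runs_Seq[OF 3 runs_move_right[of "[7, 14, 15]"]]]]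
  have "runs UNIV (1 + ((2 * ?w + 1) + (Suc (3 * ?w + 1) + 1))) (put_mag x) (st_of h v)
      (st_of ((shift [7, 14, 15] (1 - int (length bs)) h)(1 := h 1 + int (length (mag bs)))) ?v)"
    unfolding h3 put_mag_def .
  then show ?thesis by (rule runs_mono) simp
qed

definition put_entry :: com where
  "put_entry = forward [7, 14, 15] 7 ;; move_all Move_left [7, 14, 15] ;;
     Cond (\<lambda>rd. rd 14 = Bit True) (put 1 Plus ;; put_mag 14) (put 1 Minus ;; put_mag 15) ;;
     put 1 Sep"

definition entry :: "bool list \<Rightarrow> bool list \<Rightarrow> symbol list" where
  "entry bs cs = (if last bs then Plus # mag bs else Minus # mag cs) @ [Sep]"

lemma runs_put_entry:
  assumes "v 14 = ps @ map Bit bs @ qs" "v 15 = ps' @ map Bit cs @ qs'" "length ps = length ps'"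
    and "length bs = length (v 7)" "length cs = length (v 7)" "Blank \<notin> set (v 7)" "v 7 \<noteq> []"
    and "h 7 = 0" "h 14 = int (length ps)" "h 15 = int (length ps)" "h 1 = int (length (v 1))"
  shows "runs UNIV (7 * length bs + 12) put_entry (st_of h v)
    (st_of (h(1 := h 1 + int (length (entry bs cs)))) (v(1 := v 1 @ entry bs cs)))"
proof -
  let ?w = "length bs"
  let ?Y = "[7, 14, 15]"
  let ?h1 = "shift ?Y (int ?w) h" and ?h2 = "shift ?Y (int ?w - 1) h"
  have w: "?w \<ge> 1" using assms(4,7) by (simp add: Suc_leI)
  have 1: "runs UNIV (2 * ?w + 1) (forward ?Y 7) (st_of h v) (st_of ?h1 v)"
    using assms by (intro runs_forward[where p = 0]) auto
  have "shift ?Y (-1) ?h1 = ?h2" by simp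
  then have 2: "runs UNIV 1 (move_all Move_left ?Y) (st_of ?h1 v) (st_of ?h2 v)"
    using runs_move_left[of ?Y ?h1 v] by simp
  have pm: "runs UNIV (1 + (5 * ?w + 7)) (put 1 s ;; put_mag x) (st_of ?h2 v)
      (st_of (h(1 := h 1 + 1 + int (length (mag ds)))) (v(1 := v 1 @ s # mag ds)))"
    if x: "x \<in> {14, 15}" "v x = rs @ map Bit ds @ rs'" "length rs = length ps" "length ds = ?w" for s x rs rs' ds
  proof -
    let ?h3 = "?h2(1 := ?h2 1 + 1)" and ?v3 = "v(1 := v 1 @ [s])"
    have a: "runs UNIV 1 (put 1 s) (st_of ?h2 v) (st_of ?h3 ?v3)"
      using assms(11) by (intro runs_put) (simp add: shift_apply)
    have b: "runs UNIV (5 * length ds + 7) (put_mag x) (st_of ?h3 ?v3)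
      (st_of ((shift ?Y (1 - int (length ds)) ?h3)(1 := ?h3 1 + int (length (mag ds))))
        (?v3(1 := ?v3 1 @ mag ds)))"
      by (rule runs_put_mag[where ps = rs and qs = rs']) (use assms x w in \<open>auto simp: shift_apply\<close>)
    have c: "(shift ?Y (1 - int (length ds)) ?h3)(1 := ?h3 1 + int (length (mag ds))) =
        h(1 := h 1 + 1 + int (length (mag ds)))"
      using that(4) by (auto simp: shift_def)
    have d: "?v3(1 := ?v3 1 @ mag ds) = v(1 := v 1 @ s # mag ds)" by simp
    show ?thesis using runs_Seq[OF a b] unfolding c d unfolding that(4) .
  qed
  have last: "scan (st_of ?h2 v) 14 = Bit (last bs)"
    using tape_of_block[of "?w - 1" bs ps qs] w assms(1,9) last_conv_nth[of bs]
    by (cases "bs = []") (simp_all add: shift_apply of_nat_diff add_diff_eq)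
  let ?s = "if last bs then Plus # mag bs else Minus # mag cs"
  have 3: "runs UNIV (Suc (1 + (5 * ?w + 7)))
      (Cond (\<lambda>rd. rd 14 = Bit True) (put 1 Plus ;; put_mag 14) (put 1 Minus ;; put_mag 15))
      (st_of ?h2 v) (st_of (h(1 := h 1 + int (length ?s))) (v(1 := v 1 @ ?s)))"
  proof (rule runs_Cond)
    assume "scan (st_of ?h2 v) 14 = Bit True"
    with last have "last bs" by simp
    then show "runs UNIV (1 + (5 * ?w + 7)) (put 1 Plus ;; put_mag 14) (st_of ?h2 v)
        (st_of (h(1 := h 1 + int (length ?s))) (v(1 := v 1 @ ?s)))"
      using pm[of 14 ps bs qs Plus] assms by (simp add: add.assoc)
  next
    assume "scan (st_of ?h2 v) 14 \<noteq> Bit True"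
    with last have "\<not> last bs" by simp
    then show "runs UNIV (1 + (5 * ?w + 7)) (put 1 Minus ;; put_mag 15) (st_of ?h2 v)
        (st_of (h(1 := h 1 + int (length ?s))) (v(1 := v 1 @ ?s)))"
      using pm[of 15 ps' cs qs' Minus] assms by (simp add: add.assoc)
  qed
  let ?h4 = "h(1 := h 1 + int (length ?s))" and ?v4 = "v(1 := v 1 @ ?s)"
  have 4: "runs UNIV 1 (put 1 Sep) (st_of ?h4 ?v4) (st_of (?h4(1 := ?h4 1 + 1)) (?v4(1 := ?v4 1 @ [Sep])))"
    using assms(11) by (intro runs_put) simp
  have e: "?h4(1 := ?h4 1 + 1) = h(1 := h 1 + int (length (entry bs cs)))"
    "?v4(1 := ?v4 1 @ [Sep]) = v(1 := v 1 @ entry bs cs)"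
    by (auto simp: entry_def)
  show ?thesis
    unfolding put_entry_def
    by (rule runs_mono[OF runs_Seq[OF 1 runs_Seq[OF 2 runs_Seq[OF 3 4[unfolded e]]]]]) simp
qed


definition put_cell :: com where
  "put_cell = Cond (\<lambda>rd. rd 5 \<noteq> Blank) put_entry (move_all Stay []) ;;
     forward [7, 14, 15] 7 ;; rewind [7] 7"

definition put_table :: com where
  "put_table = for_each [2, 5] 2 (for_each [3, 5] 3 (for_each [4, 5] 4 put_cell))"

definition block :: "nat \<Rightarrow> nat \<Rightarrow> bool list \<Rightarrow> bool list" where
  "block w p bs = take w (drop (w * p) bs)"

text \<open>\<open>p\<close> is the number of blocks passed; the head position \<open>d\<close> on tape 5 is the total degree
  of the current monomial.\<close>

definition out_st :: "(nat \<Rightarrow> symbol list) \<Rightarrow> (nat \<Rightarrow> int) \<Rightarrow> nat \<Rightarrow> nat \<Rightarrow> symbol list \<Rightarrow> st" where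
  "out_st v h d p out = st_of (h(1 := int (length out), 5 := int d,
     14 := int (length (v 7) * p), 15 := int (length (v 7) * p))) (v(1 := out))"

definition prints :: "(nat \<Rightarrow> symbol list) \<Rightarrow> nat \<Rightarrow> nat set \<Rightarrow> com \<Rightarrow> nat \<Rightarrow> nat \<Rightarrow>
    (nat \<Rightarrow> nat \<Rightarrow> symbol list) \<Rightarrow> bool" where
  "prints v M Z c T s f \<longleftrightarrow> (\<forall>h d p out. (\<forall>z \<in> Z. h z = 0) \<longrightarrow> p + s \<le> M \<longrightarrow>
     runs UNIV T c (out_st v h d p out) (out_st v h d (p + s) (out @ f d p)))"

lemma prints_cell:
  assumes "v 14 = map Bit bs" "v 15 = map Bit cs"
    and "length bs = length (v 7) * M" "length cs = length (v 7) * M"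
    and "Blank \<notin> set (v 7)" "v 7 \<noteq> []" "Blank \<notin> set (v 5)"
  shows "prints v M {7} put_cell (11 * length (v 7) + 18) 1
    (\<lambda>d p. if d < length (v 5) then entry (block (length (v 7)) p bs) (block (length (v 7)) p cs) else [])"
  unfolding prints_def
proof (intro allI impI)
  fix h :: "nat \<Rightarrow> int" and d p :: nat and out
  assume h: "\<forall>z \<in> {7}. h z = 0" and p: "p + 1 \<le> M"
  define w where "w = length (v 7)"
  let ?e = "if d < length (v 5) then entry (block w p bs) (block w p cs) else []"
  let ?h = "\<lambda>p out. h(1 := int (length out), 5 := int d, 14 := int (w * p), 15 := int (w * p))"
  have "w * Suc p \<le> w * M" by (rule mult_le_mono2) (use p in simp)
  then have wp: "w * p + w \<le> w * M" by simp
  have split: "map Bit xs = map Bit (take (w * p) xs) @ map Bit (block w p xs) @ map Bit (drop (w * p + w) xs)"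
    "length (take (w * p) xs) = w * p" "length (block w p xs) = w"
    if "length xs = w * M" for xs
  proof -
    have "xs = take (w * p) xs @ take w (drop (w * p) xs) @ drop w (drop (w * p) xs)"
      by (simp only: append_take_drop_id)
    then show "map Bit xs = map Bit (take (w * p) xs) @ map Bit (block w p xs) @ map Bit (drop (w * p + w) xs)"
      unfolding block_def by (metis drop_drop map_append add.commute)
  qed (use that wp in \<open>auto simp: block_def\<close>)
  note sb = split[OF assms(3)[folded w_def]] and sc = split[OF assms(4)[folded w_def]]
  have 1: "runs UNIV (Suc (7 * w + 12)) (Cond (\<lambda>rd. rd 5 \<noteq> Blank) put_entry (move_all Stay []))
      (st_of (?h p out) (v(1 := out))) (st_of (?h p (out @ ?e)) (v(1 := out @ ?e)))"
  proof (rule runs_Cond)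
    assume "scan (st_of (?h p out) (v(1 := out))) 5 \<noteq> Blank"
    then have d: "d < length (v 5)" using assms(7) by (simp add: tape_of_eq_Blank_iff)
    let ?e' = "entry (block w p bs) (block w p cs)"
    have "runs UNIV (7 * length (block w p bs) + 12) put_entry (st_of (?h p out) (v(1 := out)))
        (st_of ((?h p out)(1 := ?h p out 1 + int (length ?e')))
          ((v(1 := out))(1 := (v(1 := out)) 1 @ ?e')))"
      by (rule runs_put_entry[where ps = "map Bit (take (w * p) bs)" and ps' = "map Bit (take (w * p) cs)"
            and qs = "map Bit (drop (w * p + w) bs)" and qs' = "map Bit (drop (w * p + w) cs)"])
         (use assms h sb sc in \<open>simp_all add: w_def\<close>)
    moreover have "(?h p out)(1 := ?h p out 1 + int (length ?e')) = ?h p (out @ ?e')" by auto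
    moreover have "(v(1 := out))(1 := (v(1 := out)) 1 @ ?e') = v(1 := out @ ?e')" by simp
    ultimately show "runs UNIV (7 * w + 12) put_entry (st_of (?h p out) (v(1 := out)))
        (st_of (?h p (out @ ?e)) (v(1 := out @ ?e)))"
      using d sb(3) by (simp only: if_True)
  next
    assume "\<not> scan (st_of (?h p out) (v(1 := out))) 5 \<noteq> Blank"
    then have d: "\<not> d < length (v 5)" using assms(7) by (simp add: tape_of_eq_Blank_iff)
    have "shift [] (move_offset Stay) (?h p out) = ?h p out" by simp
    then have "runs UNIV 1 (move_all Stay []) (st_of (?h p out) (v(1 := out))) (st_of (?h p out) (v(1 := out)))"
      using runs_move_all[of Stay "[]" "?h p out" "v(1 := out)"] by (simp only:)
    then have "runs UNIV (7 * w + 12) (move_all Stay []) (st_of (?h p out) (v(1 := out))) (st_of (?h p out) (v(1 := out)))"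
      by (rule runs_mono) simp
    then show "runs UNIV (7 * w + 12) (move_all Stay []) (st_of (?h p out) (v(1 := out)))
        (st_of (?h p (out @ ?e)) (v(1 := out @ ?e)))"
      using d by (simp only: if_False append_Nil2)
  qed
  let ?o = "out @ ?e"
  have 2: "runs UNIV (2 * w + 1) (forward [7, 14, 15] 7) (st_of (?h p ?o) (v(1 := ?o)))
      (st_of (shift [7, 14, 15] (int w) (?h p ?o)) (v(1 := ?o)))"
    using assms h by (intro runs_forward[where p = 0]) (auto simp: w_def)
  have 3: "runs UNIV (2 * w + 3) (rewind [7] 7) (st_of (shift [7, 14, 15] (int w) (?h p ?o)) (v(1 := ?o)))
      (st_of (shift [7] (- int w) (shift [7, 14, 15] (int w) (?h p ?o))) (v(1 := ?o)))"
    using assms h by (intro runs_rewind) (auto simp: w_def shift_apply)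
  have e: "shift [7] (- int w) (shift [7, 14, 15] (int w) (?h p ?o)) = ?h (p + 1) ?o"
    using h by (auto simp: shift_def algebra_simps)
  show "runs UNIV (11 * length (v 7) + 18) put_cell (out_st v h d p out) (out_st v h d (p + 1) (out @
      (if d < length (v 5) then entry (block (length (v 7)) p bs) (block (length (v 7)) p cs) else [])))"
    unfolding out_st_def w_def[symmetric] put_cell_def
    by (rule runs_mono[OF runs_Seq[OF 1 runs_Seq[OF 2 3[unfolded e]]]]) simp
qed

lemma prints_for_each:
  assumes "prints v M Z c T s f" "y \<notin> Z" "y \<notin> {1, 5, 14, 15}" "Z \<inter> {1, 5, 14, 15} = {}"
    and "Blank \<notin> set (v y)" "length (v y) = m"
  shows "prints v M (insert y Z) (for_each [y, 5] y c) (m * (T + 4) + 4) (m * s)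
    (\<lambda>d p. concat (map (\<lambda>k. f (d + k) (p + k * s)) [0..<m]))"
  unfolding prints_def
proof (intro allI impI)
  fix h :: "nat \<Rightarrow> int" and d p :: nat and out
  assume h: "\<forall>z \<in> insert y Z. h z = 0" and p: "p + m * s \<le> M"
  let ?o = "\<lambda>k. out @ concat (map (\<lambda>k. f (d + k) (p + k * s)) [0..<k])"
  let ?h = "\<lambda>k. h(1 := int (length (?o k)), 5 := int d, 14 := int (length (v 7) * (p + k * s)),
    15 := int (length (v 7) * (p + k * s)))"
  have "runs UNIV (m * (T + 4) + 4) (for_each [y, 5] y c) (st_of (?h 0) (v(1 := ?o 0)))
      (st_of (?h m) (v(1 := ?o m)))"
  proof (rule runs_for_each)
    fix k assume k: "k < m"
    have "p + k * s + s \<le> M"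
      using mult_le_mono1[of "Suc k" m s] k p by simp
    then have "runs UNIV T c (out_st v (h(y := int k)) (d + k) (p + k * s) (?o k))
        (out_st v (h(y := int k)) (d + k) (p + k * s + s) (?o k @ f (d + k) (p + k * s)))"
      using assms(1,2) h unfolding prints_def by (auto simp del: append_assoc)
    moreover have "out_st v (h(y := int k)) (d + k) (p + k * s) (?o k) =
        st_of (shift [y, 5] (int k) (?h k)) (v(1 := ?o k))"
      unfolding out_st_def using assms(3) h by (intro arg_cong2[where f = st_of]) (auto simp: shift_def)
    moreover have "out_st v (h(y := int k)) (d + k) (p + k * s + s) (?o k @ f (d + k) (p + k * s)) =
        st_of (shift [y, 5] (int k) (?h (Suc k))) (v(1 := ?o (Suc k)))"
      unfolding out_st_def using assms(3) h
      by (intro arg_cong2[where f = st_of]) (auto simp: shift_def algebra_simps)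
    ultimately show "runs UNIV T c (st_of (shift [y, 5] (int k) (?h k)) (v(1 := ?o k)))
        (st_of (shift [y, 5] (int k) (?h (Suc k))) (v(1 := ?o (Suc k))))" by simp
  qed (use assms(3,5,6) h in auto)
  then show "runs UNIV (m * (T + 4) + 4) (for_each [y, 5] y c) (out_st v h d p out)
      (out_st v h d (p + m * s) (out @ concat (map (\<lambda>k. f (d + k) (p + k * s)) [0..<m])))"
    by (simp add: out_st_def)
qed

lemma runs_put_table:
  assumes "v 14 = map Bit bs" "v 15 = map Bit cs"
    and "length bs = w * N ^ 3" "length cs = w * N ^ 3" "length (v 7) = w" "w > 0" "v 1 = []"
    and "Blank \<notin> set (v 7)"
    and "\<And>y. y \<in> {2, 3, 4, 5} \<Longrightarrow> length (v y) = N \<and> Blank \<notin> set (v y)"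
  shows "\<exists>h'. runs UNIV (N * (N * (N * (11 * w + 22) + 8) + 8) + 4) put_table (st_of (\<lambda>_. 0) v)
    (st_of h' (v(1 := concat (map (\<lambda>i. concat (map (\<lambda>j. concat (map (\<lambda>k.
       if i + j + k < N then entry (block w (i * N\<^sup>2 + j * N + k) bs) (block w (i * N\<^sup>2 + j * N + k) cs)
       else []) [0..<N])) [0..<N])) [0..<N]))))"
proof -
  let ?f = "\<lambda>d p. if d < N then entry (block w p bs) (block w p cs) else []"
  have "v 7 \<noteq> []" using assms(5,6) by auto
  then have "prints v (N ^ 3) {7} put_cell (11 * w + 18) 1 ?f"
    using prints_cell[OF assms(1,2), of "N ^ 3", unfolded assms(5)] assms(3,4,8) assms(9)[of 5]
    by simp
  from prints_for_each[OF this, of 4 N] have 1: "prints v (N ^ 3) {4, 7} (for_each [4, 5] 4 put_cell)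
      (N * (11 * w + 22) + 4) N (\<lambda>d p. concat (map (\<lambda>k. ?f (d + k) (p + k)) [0..<N]))"
    using assms(9)[of 4] by (simp add: add.commute[of 22] cong: if_cong)
  from prints_for_each[OF this, of 3 N]
  have 2: "prints v (N ^ 3) {3, 4, 7} (for_each [3, 5] 3 (for_each [4, 5] 4 put_cell))
      (N * (N * (11 * w + 22) + 8) + 4) (N * N) (\<lambda>d p. concat (map (\<lambda>j.
        concat (map (\<lambda>k. ?f (d + j + k) (p + j * N + k)) [0..<N])) [0..<N]))"
    using assms(9)[of 3] by (simp add: add.commute[of 8])
  from prints_for_each[OF this, of 2 N]
  have 3: "prints v (N ^ 3) {2, 3, 4, 7} put_table
      (N * (N * (N * (11 * w + 22) + 8) + 8) + 4) (N * (N * N)) (\<lambda>d p. concat (map (\<lambda>i. concat (map (\<lambda>j.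
        concat (map (\<lambda>k. ?f (d + i + j + k) (p + i * (N * N) + j * N + k)) [0..<N])) [0..<N])) [0..<N]))"
    using assms(9)[of 2] by (simp add: put_table_def add.commute[of 8])
  let ?out = "concat (map (\<lambda>i. concat (map (\<lambda>j.
        concat (map (\<lambda>k. ?f (i + j + k) (i * (N * N) + j * N + k)) [0..<N])) [0..<N])) [0..<N])"
  have "runs UNIV (N * (N * (N * (11 * w + 22) + 8) + 8) + 4) put_table (out_st v (\<lambda>_. 0) 0 0 [])
      (out_st v (\<lambda>_. 0) 0 (N * (N * N)) ?out)"
    using 3[unfolded prints_def, rule_format, of "\<lambda>_. 0" 0 0 "[]"]
    by (simp add: power3_eq_cube cong: if_cong)
  moreover have "out_st v (\<lambda>_. 0) 0 0 [] = st_of (\<lambda>_. 0) v"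
    using assms(7) unfolding out_st_def by (intro arg_cong2[where f = st_of]) auto
  ultimately show ?thesis unfolding out_st_def power2_eq_square by auto
qed

section \<open>Letters act on trace vectors by transvections\<close>

text \<open>\<open>(d, s, r, n)\<close> adds to entry \<open>d\<close> the entry \<open>s\<close> times the monomial coded by \<open>r\<close>,
  with a minus sign if \<open>n\<close> holds. The entries and monomials are numbered by the tapes of
  the machine that hold them.\<close>

type_synonym transvection = "nat \<times> nat \<times> nat \<times> bool"

definition apply_op :: "(nat \<Rightarrow> 'a) \<Rightarrow> transvection \<Rightarrow> (nat \<Rightarrow> 'a) \<Rightarrow> nat \<Rightarrow> 'a::comm_ring_1" where
  "apply_op \<mu> = (\<lambda>(d, s, r, n) V. V(d := V d + (if n then - 1 else 1) * \<mu> r * V s))"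

definition apply_ops :: "(nat \<Rightarrow> 'a) \<Rightarrow> transvection list \<Rightarrow> (nat \<Rightarrow> 'a) \<Rightarrow> nat \<Rightarrow> 'a::comm_ring_1" where
  "apply_ops \<mu> = fold (apply_op \<mu>)"

definition inverse_ops :: "transvection list \<Rightarrow> transvection list" where
  "inverse_ops ops = rev (map (\<lambda>(d, s, r, n). (d, s, r, \<not> n)) ops)"

lemma apply_ops_append: "apply_ops \<mu> (xs @ ys) V = apply_ops \<mu> ys (apply_ops \<mu> xs V)"
  by (simp add: apply_ops_def)

lemma apply_ops_Nil: "apply_ops \<mu> [] V = V"
  and apply_ops_Cons: "apply_ops \<mu> (op # ops) V = apply_ops \<mu> ops (apply_op \<mu> op V)"
  by (simp_all add: apply_ops_def)

lemma apply_inverse_ops: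
  assumes "\<forall>(d, s, r, n) \<in> set ops. d \<noteq> s"
  shows "apply_ops \<mu> (inverse_ops ops) (apply_ops \<mu> ops V) = V"
  using assms
proof (induction ops arbitrary: V)
  case (Cons op ops)
  obtain d s r n where op: "op = (d, s, r, n)" by (cases op)
  have "apply_ops \<mu> (inverse_ops (op # ops)) (apply_ops \<mu> (op # ops) V) =
      apply_op \<mu> (d, s, r, \<not> n) (apply_ops \<mu> (inverse_ops ops) (apply_ops \<mu> ops (apply_op \<mu> op V)))"
    by (simp add: inverse_ops_def apply_ops_def op)
  also have "\<dots> = V"
    using Cons by (auto simp: op apply_op_def fun_eq_iff)
  finally show ?case .
qed (simp add: inverse_ops_def apply_ops_def)

lemma apply_ops_hom:
  assumes "\<And>x y. \<phi> (x + y) = \<phi> x + \<phi> y" "\<And>x y. \<phi> (x - y) = \<phi> x - \<phi> y"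
    "\<And>r x. \<phi> (\<mu> r * x) = \<nu> r * \<phi> x"
  shows "(\<lambda>i. \<phi> (apply_ops \<mu> ops V i)) = apply_ops \<nu> ops (\<lambda>i. \<phi> (V i))"
proof (induction ops arbitrary: V)
  case (Cons op ops)
  have "(\<lambda>i. \<phi> (apply_op \<mu> op V i)) = apply_op \<nu> op (\<lambda>i. \<phi> (V i))"
    using assms(1)[of "V x" for x] assms(2)[of "V x" for x] assms(3)
    by (auto simp: apply_op_def fun_eq_iff split: prod.split)
  with Cons[of "apply_op \<mu> op V"] show ?case by (simp add: apply_ops_def)
qed (simp add: apply_ops_def)

text \<open>\<open>rotate u v r\<close> maps \<open>(u, v)\<close> to \<open>(v, m * v - u)\<close>.\<close>

definition rotate_ops :: "nat \<Rightarrow> nat \<Rightarrow> nat \<Rightarrow> transvection list" where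
  "rotate_ops u v r = [(u, v, 1, False), (v, u, 1, True), (u, v, 1, False), (v, u, r, False)]"

definition ops_a :: "transvection list" where
  "ops_a = rotate_ops 10 11 9 @ rotate_ops 12 13 9"

definition ops_b :: "transvection list" where
  "ops_b = [(13, 11, 1, False), (11, 13, 1, True), (13, 11, 1, False), (11, 13, 8, False),
     (11, 10, 7, False), (12, 10, 8, True), (11, 12, 9, False), (12, 10, 8, False),
     (13, 12, 7, False), (13, 10, 9, True)] @ rotate_ops 10 12 8"

fun letter_ops :: "letter \<Rightarrow> transvection list" where
  "letter_ops Let_a = ops_a"
| "letter_ops Let_a_inv = inverse_ops ops_a"
| "letter_ops Let_b = ops_b"
| "letter_ops Let_b_inv = inverse_ops ops_b"

definition start_ops :: "transvection list" where
  "start_ops = [(10, 16, 1, False), (10, 16, 1, False), (11, 16, 9, False), (12, 16, 8, False),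
     (13, 16, 7, False)]"

definition word_ops :: "letter list \<Rightarrow> transvection list" where
  "word_ops w = start_ops @ concat (map letter_ops w)"

definition mon :: "'a \<Rightarrow> 'a \<Rightarrow> 'a \<Rightarrow> nat \<Rightarrow> 'a::one" where
  "mon x y z r = (if r = 9 then x else if r = 8 then y else if r = 7 then z else 1)"

definition unit_vec :: "nat \<Rightarrow> 'a::zero_neq_one" where
  "unit_vec = (\<lambda>_. 0)(16 := 1)"

definition traces :: "complex^2^2 \<Rightarrow> complex^2^2 \<Rightarrow> complex^2^2 \<Rightarrow> (nat \<Rightarrow> complex) \<Rightarrow> nat \<Rightarrow> complex" where
  "traces A B W V = V(10 := trace W, 11 := trace (W ** A), 12 := trace (W ** B),
     13 := trace (W ** (A ** B)))"

lemma trace_identities: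
  fixes A B W :: "complex^2^2"
  shows "trace (W ** A ** A) = trace A * trace (W ** A) - det A * trace W"
    and "trace (W ** A ** (A ** B)) = trace A * trace (W ** (A ** B)) - det A * trace (W ** B)"
    and "trace (W ** B ** A) = (trace (A ** B) - trace A * trace B) * trace W +
      trace B * trace (W ** A) + trace A * trace (W ** B) - trace (W ** (A ** B))"
    and "trace (W ** B ** (A ** B)) = det B * (trace (W ** A) - trace A * trace W) +
      trace (A ** B) * trace (W ** B)"
  by (simp_all add: trace_def matrix_matrix_mult_def sum_2 det_2 algebra_simps)

lemma ops_a_traces:
  assumes "A \<in> SL2"
  shows "apply_ops (mon (trace A) (trace B) (trace (A ** B))) ops_a (traces A B W V) =
    traces A B (W ** A) V"
  using assms trace_identities(1,2)[of W A]
  by (auto simp: ops_a_def rotate_ops_def apply_ops_def apply_op_def traces_def mon_def fun_eq_iff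
      matrix_mul_assoc SL2_def)

lemma ops_b_traces:
  assumes "B \<in> SL2"
  shows "apply_ops (mon (trace A) (trace B) (trace (A ** B))) ops_b (traces A B W V) =
    traces A B (W ** B) V"
  using assms trace_identities(1)[of W B] trace_identities(3,4)[of W B A]
  by (auto simp: ops_b_def rotate_ops_def apply_ops_def apply_op_def traces_def mon_def fun_eq_iff
      SL2_def algebra_simps)

lemma matrix_inv_mult_SL2: "A \<in> SL2 \<Longrightarrow> matrix_inv A ** A = mat 1"
proof -
  assume A: "A \<in> SL2"
  then have d: "A $ 1 $ 1 * A $ 2 $ 2 - A $ 1 $ 2 * A $ 2 $ 1 = 1"
    by (simp add: SL2_def det_2)
  show ?thesis unfolding matrix_inv_SL2[OF A]
    using d by (simp add: vec_eq_iff matrix_matrix_mult_def mat_def trace_def forall_2 sum_2 algebra_simps)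
qed

lemma letter_ops_distinct: "\<forall>(d, s, r, n) \<in> set (letter_ops l). d \<in> {10..13} \<and> s \<in> {10..13} \<and> d \<noteq> s \<and> r \<in> {1, 7, 8, 9}"
  by (cases l) (auto simp: ops_a_def ops_b_def rotate_ops_def inverse_ops_def)

lemma letter_ops_traces:
  assumes "A \<in> SL2" "B \<in> SL2"
  shows "apply_ops (mon (trace A) (trace B) (trace (A ** B))) (letter_ops l) (traces A B W V) =
    traces A B (W ** letter_eval A B l) V"
proof -
  let ?\<mu> = "mon (trace A) (trace B) (trace (A ** B))"
  have inv: "apply_ops ?\<mu> (inverse_ops ops) (traces A B W V) = traces A B (W ** matrix_inv C) V"
    if "C \<in> SL2" "\<And>W. apply_ops ?\<mu> ops (traces A B W V) = traces A B (W ** C) V"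
      "\<forall>(d, s, r, n) \<in> set ops. d \<noteq> s" for ops C
  proof -
    have "W ** matrix_inv C ** C = W"
      by (simp add: matrix_inv_mult_SL2 that(1) flip: matrix_mul_assoc)
    then show ?thesis
      using that(2)[of "W ** matrix_inv C"] apply_inverse_ops[OF that(3)] by metis
  qed
  show ?thesis
    using letter_ops_distinct[of Let_a] letter_ops_distinct[of Let_b]
    by (cases l)
       (auto simp: ops_a_traces ops_b_traces assms intro!: inv[of A ops_a] inv[of B ops_b])
qed

lemma word_eval_snoc: "word_eval A B (w @ [l]) = word_eval A B w ** letter_eval A B l"
  by (induction w) (simp_all add: matrix_mul_assoc)

lemma word_ops_traces:
  assumes "A \<in> SL2" "B \<in> SL2"
  shows "apply_ops (mon (trace A) (trace B) (trace (A ** B))) (word_ops w) unit_vec =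
    traces A B (word_eval A B w) unit_vec"
proof (induction w rule: rev_induct)
  case Nil
  have "trace (mat 1 :: complex^2^2) = 2" by (simp add: trace_def mat_def sum_2)
  then show ?case
    by (auto simp: word_ops_def start_ops_def apply_ops_def apply_op_def unit_vec_def traces_def mon_def
        fun_eq_iff)
next
  case (snoc l w)
  then show ?case
    using letter_ops_traces[OF assms]
    by (simp add: word_ops_def apply_ops_append word_eval_snoc flip: append_assoc)
qed

section \<open>Evaluation of polynomials\<close>

lemma poly_mapping_add_induct [case_names zero add]:
  assumes "P 0" "\<And>f m c. P f \<Longrightarrow> P (f + Poly_Mapping.single m c)"
  shows "P (f :: 'a \<Rightarrow>\<^sub>0 'b::comm_monoid_add)"
proof (induction f rule: update_induct)
  case const
  show ?case using assms(1) .
next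
  case (update f m c)
  have "Poly_Mapping.update m c f = f + Poly_Mapping.single m c"
    using update(1)
    by (intro poly_mapping_eqI) (auto simp: lookup_update lookup_add lookup_single in_keys_iff when_def)
  then show ?case using assms(2)[OF update(3)] by simp
qed

definition eval3 :: "(nat \<times> nat \<times> nat \<Rightarrow> 'a) \<Rightarrow> int_poly3 \<Rightarrow> 'a::comm_ring_1" where
  "eval3 \<phi> f = (\<Sum>m \<in> Poly_Mapping.keys f. of_int (Poly_Mapping.lookup f m) * \<phi> m)"

lemma eval3_superset:
  "finite K \<Longrightarrow> Poly_Mapping.keys f \<subseteq> K \<Longrightarrow>
    eval3 \<phi> f = (\<Sum>m \<in> K. of_int (Poly_Mapping.lookup f m) * \<phi> m)"
  unfolding eval3_def by (intro sum.mono_neutral_left) (auto simp: in_keys_iff)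

lemma eval3_add: "eval3 \<phi> (f + g) = eval3 \<phi> f + eval3 \<phi> g"
proof -
  let ?K = "Poly_Mapping.keys f \<union> Poly_Mapping.keys g"
  have "Poly_Mapping.keys (f + g) \<subseteq> ?K" by (rule Poly_Mapping.keys_add)
  then have "eval3 \<phi> (f + g) = (\<Sum>m \<in> ?K. of_int (Poly_Mapping.lookup (f + g) m) * \<phi> m)"
    by (intro eval3_superset) auto
  also have "\<dots> = (\<Sum>m \<in> ?K. of_int (Poly_Mapping.lookup f m) * \<phi> m) +
      (\<Sum>m \<in> ?K. of_int (Poly_Mapping.lookup g m) * \<phi> m)"
    by (simp add: lookup_add distrib_right sum.distrib)
  also have "\<dots> = eval3 \<phi> f + eval3 \<phi> g"
    using eval3_superset[of ?K f \<phi>] eval3_superset[of ?K g \<phi>] by auto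
  finally show ?thesis .
qed

lemma eval3_diff: "eval3 \<phi> (f - g) = eval3 \<phi> f - eval3 \<phi> g"
  using eval3_add[of \<phi> "f - g" g] by simp

lemma eval3_single: "eval3 \<phi> (Poly_Mapping.single m c) = of_int c * \<phi> m"
  by (cases "c = 0") (simp_all add: eval3_def)

lemma eval3_mult_single:
  assumes "\<And>m m'. \<phi> (m + m') = \<phi> m * \<phi> m'"
  shows "eval3 \<phi> (Poly_Mapping.single m 1 * f) = \<phi> m * eval3 \<phi> f"
proof (induction f rule: poly_mapping_add_induct)
  case zero
  then show ?case by (simp add: eval3_def)
next
  case (add f m' c)
  then show ?case
    by (simp add: distrib_left eval3_add mult_single eval3_single assms algebra_simps)
qed

definition mon3 :: "nat \<Rightarrow> int_poly3" where
  "mon3 = mon (Poly_Mapping.single (1, 0, 0) 1) (Poly_Mapping.single (0, 1, 0) 1)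
     (Poly_Mapping.single (0, 0, 1) 1)"

definition word_poly :: "letter list \<Rightarrow> nat \<Rightarrow> int_poly3" where
  "word_poly w = apply_ops mon3 (word_ops w) unit_vec"

lemma eval3_apply_ops:
  assumes "\<And>m m'. \<phi> (m + m') = \<phi> m * \<phi> m'" "\<phi> (0, 0, 0) = 1"
  shows "(\<lambda>i. eval3 \<phi> (apply_ops mon3 ops V i)) =
    apply_ops (mon (\<phi> (1, 0, 0)) (\<phi> (0, 1, 0)) (\<phi> (0, 0, 1))) ops (\<lambda>i. eval3 \<phi> (V i))"
  by (intro apply_ops_hom eval3_add eval3_diff)
     (simp add: mon3_def mon_def eval3_mult_single[OF assms(1)])

lemma eval3_unit_vec: "\<phi> (0, 0, 0) = 1 \<Longrightarrow> (\<lambda>i. eval3 \<phi> (unit_vec i)) = unit_vec"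
  using eval3_single[of \<phi> 0 1]
  by (auto simp: unit_vec_def eval3_def zero_prod_def fun_eq_iff simp flip: single_one)

lemma trace_poly_eq_word_poly: "trace_poly w = word_poly w 10"
proof (rule is_trace_poly_unique[OF is_trace_poly_trace_poly])
  show "is_trace_poly w (word_poly w 10)"
    unfolding is_trace_poly_def
  proof (intro ballI)
    fix A B :: "complex^2^2" assume AB: "A \<in> SL2" "B \<in> SL2"
    define \<phi> where "\<phi> = (\<lambda>(i, j, k). trace A ^ i * trace B ^ j * trace (A ** B) ^ k)"
    have m: "\<phi> (m + m') = \<phi> m * \<phi> m'" for m m'
      by (cases m; cases m') (simp add: \<phi>_def power_add)
    have 1: "\<phi> (0, 0, 0) = 1" by (simp add: \<phi>_def)
    have "eval3 \<phi> (word_poly w 10) =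
        apply_ops (mon (trace A) (trace B) (trace (A ** B))) (word_ops w) unit_vec 10"
      using fun_cong[OF eval3_apply_ops[of \<phi> "word_ops w" unit_vec, OF m 1], of 10] eval3_unit_vec[of \<phi>, OF 1]
      by (simp add: word_poly_def \<phi>_def)
    also have "\<dots> = trace (word_eval A B w)"
      by (simp add: word_ops_traces[OF AB]) (simp add: traces_def)
    also have "eval3 \<phi> (word_poly w 10) = poly3 (word_poly w 10) (trace A) (trace B) (trace (A ** B))"
      by (simp add: eval3_def poly3_def \<phi>_def case_prod_beta mult.assoc)
    finally show "trace (word_eval A B w) =
      poly3 (word_poly w 10) (trace A) (trace B) (trace (A ** B))" by simp
  qed
qed

lemma lookup_single_mult:
  fixes f :: int_poly3
  shows "Poly_Mapping.lookup (Poly_Mapping.single (a, b, d) 1 * f) (i, j, k) =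
    (if a \<le> i \<and> b \<le> j \<and> d \<le> k then Poly_Mapping.lookup f (i - a, j - b, k - d) else 0)"
proof (induction f rule: poly_mapping_add_induct)
  case (add f m c)
  obtain a' b' d' where m: "m = (a', b', d')" by (cases m)
  show ?case
    using add by (auto simp: m distrib_left lookup_add mult_single lookup_single when_def)
qed simp

lemma abs_lookup_apply_ops:
  assumes "\<And>i m. \<bar>Poly_Mapping.lookup (V i) m\<bar> \<le> C"
  shows "\<bar>Poly_Mapping.lookup (apply_ops mon3 ops V i) m\<bar> \<le> C * 2 ^ length ops"
  using assms
proof (induction ops arbitrary: V C)
  case (Cons op ops)
  obtain d s r n where op: "op = (d, s, r, n)" by (cases op)
  have "0 \<le> C" using Cons.prems[of 0 undefined] by linarith
  have mon: "\<bar>Poly_Mapping.lookup (mon3 r * V s) m\<bar> \<le> C" for m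
  proof -
    obtain i j k where m: "m = (i, j, k)" by (cases m)
    have "\<exists>a b d. mon3 r = Poly_Mapping.single (a, b, d) 1"
      using single_one[where ?'a = "nat \<times> nat \<times> nat" and ?'b = int]
      by (auto simp: mon3_def mon_def zero_prod_def)
    then obtain a b d where "mon3 r = Poly_Mapping.single (a, b, d) 1" by blast
    then show ?thesis using Cons.prems[of s] \<open>0 \<le> C\<close> by (simp add: m lookup_single_mult)
  qed
  have "\<bar>Poly_Mapping.lookup (apply_op mon3 op V i) m\<bar> \<le> C * 2" for i m
  proof -
    have "\<bar>Poly_Mapping.lookup (V d) m\<bar> + \<bar>Poly_Mapping.lookup (mon3 r * V s) m\<bar> \<le> C * 2"
      using Cons.prems[of d m] mon[of m] by simp
    then show ?thesis
      using Cons.prems[of i m] \<open>0 \<le> C\<close> by (auto simp: op apply_op_def lookup_add lookup_minus)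
  qed
  from Cons.IH[OF this] show ?case by (simp add: apply_ops_def mult.assoc)
qed (simp add: apply_ops_def)

lemma length_word_ops: "length (word_ops w) \<le> 5 + 14 * length w"
proof -
  have "length (letter_ops l) \<le> 14" for l
    by (cases l) (simp_all add: ops_a_def ops_b_def rotate_ops_def inverse_ops_def)
  then have "length (concat (map letter_ops w)) \<le> 14 * length w"
    by (induction w) (simp_all add: add_mono)
  then show ?thesis by (simp add: word_ops_def start_ops_def)
qed

lemma abs_lookup_trace_poly: "\<bar>Poly_Mapping.lookup (trace_poly w) m\<bar> \<le> 2 ^ (5 + 14 * length w)"
proof -
  have "\<bar>Poly_Mapping.lookup (unit_vec i :: int_poly3) m\<bar> \<le> 1" for i m
    by (simp add: unit_vec_def lookup_one when_def)
  then have "\<bar>Poly_Mapping.lookup (trace_poly w) m\<bar> \<le> 1 * 2 ^ length (word_ops w)"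
    unfolding trace_poly_eq_word_poly word_poly_def by (rule abs_lookup_apply_ops)
  also have "\<dots> \<le> 2 ^ (5 + 14 * length w)"
    using power_increasing[OF length_word_ops[of w], of "2 :: int"] by simp
  finally show ?thesis .
qed

section \<open>Decoding Kronecker substitution\<close>

lemma val_bounds: "0 \<le> val bs" "val bs < 2 ^ length bs"
  by (simp_all add: horner_sum_nonnegative horner_sum_of_bool_2_less)

lemma val_eq_0_iff: "val bs = 0 \<longleftrightarrow> dropWhile Not (rev bs) = []"
proof (induction bs)
  case (Cons b bs)
  have "0 \<le> val bs" by (rule val_bounds)
  then have "val (b # bs) = 0 \<longleftrightarrow> \<not> b \<and> val bs = 0" by (cases b) auto
  then show ?case unfolding Cons by (auto simp: dropWhile_eq_Nil_conv)
qed simp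

lemma binary_double:
  assumes "x > 0"
  shows "binary (nat (of_bool b + 2 * x)) = binary (nat x) @ [Bit b]"
proof -
  have "nat (of_bool b + 2 * x) = of_bool b + 2 * nat x" using assms by (cases b) auto
  moreover have "(of_bool b + 2 * nat x) div 2 = nat x" by (cases b) auto
  moreover have "odd (of_bool b + 2 * nat x) = b" by (cases b) auto
  moreover have "\<not> of_bool b + 2 * nat x < 2" using assms by auto
  ultimately show ?thesis using binary.simps[of "of_bool b + 2 * nat x"] by (simp only: if_False)
qed

lemma binary_val:
  "binary (nat (val bs)) = (let r = dropWhile Not (rev bs) in if r = [] then [Bit False] else map Bit r)"
proof (induction bs)
  case Nil
  have "binary 0 = [Bit False]" by (subst binary.simps) simp
  then show ?case by simp
next
  case (Cons b bs)
  define r where "r = dropWhile Not (rev bs)"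
  have r: "dropWhile Not (rev (b # bs)) = (if r = [] then (if b then [b] else []) else r @ [b])"
    by (auto simp: dropWhile_append r_def)
  have v: "val (b # bs) = of_bool b + 2 * val bs" by simp
  show ?case
  proof (cases "r = []")
    case True
    then have "val bs = 0" using val_eq_0_iff[of bs] by (simp add: r_def)
    then have "nat (val (b # bs)) = of_bool b" by simp
    moreover have "binary (of_bool b) = [Bit b]" by (subst binary.simps) simp
    ultimately show ?thesis unfolding r using True by simp
  next
    case False
    then have "val bs > 0" using val_eq_0_iff[of bs] val_bounds(1)[of bs] by (simp add: r_def less_le)
    from binary_double[OF this] have "binary (nat (val (b # bs))) = binary (nat (val bs)) @ [Bit b]"
      unfolding v .
    also have "\<dots> = map Bit r @ [Bit b]"
      using Cons False by (simp only: r_def[symmetric] Let_def if_False)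
    finally show ?thesis unfolding r using False by simp
  qed
qed
lemma mag_eq_binary: "mag bs = binary (nat (val (butlast bs)))"
  unfolding mag_def binary_val ..

lemma val_butlast:
  assumes "bs \<noteq> []"
  shows "val bs = val (butlast bs) + of_bool (last bs) * 2 ^ (length bs - 1)"
proof -
  have "val (butlast bs @ [last bs]) = val (butlast bs) + 2 ^ length (butlast bs) * val [last bs]"
    by (simp only: horner_sum_append)
  then show ?thesis using assms by simp
qed

lemma entry_eq_table_entry:
  assumes "length bs = w" "length cs = w" "w > 0"
    and "val bs = 2 ^ (w - 1) + c" "val cs = 2 ^ (w - 1) - c"
  shows "entry bs cs = table_entry c"
proof -
  have ne: "bs \<noteq> []" "cs \<noteq> []" using assms by auto
  note v = val_butlast[OF ne(1)] val_butlast[OF ne(2)] val_bounds[of "butlast bs"] val_bounds[of "butlast cs"]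
  show ?thesis
  proof (cases "last bs")
    case True
    then show ?thesis using v assms by (simp add: entry_def table_entry_def mag_eq_binary)
  next
    case False
    then have "c < 0" using v assms by simp
    moreover have "last cs"
      using v assms \<open>c < 0\<close> by (cases "last cs") simp_all
    ultimately show ?thesis using False v assms by (simp add: entry_def table_entry_def mag_eq_binary)
  qed
qed

lemma digit_sum_bounds:
  assumes "\<And>p. p < m \<Longrightarrow> 0 \<le> d p \<and> d p < (2::int) ^ w"
  shows "0 \<le> (\<Sum>p<m. d p * 2 ^ (w * p)) \<and> (\<Sum>p<m. d p * 2 ^ (w * p)) < 2 ^ (w * m)"
  using assms
proof (induction m)
  case (Suc m)
  have "d m * 2 ^ (w * m) \<le> (2 ^ w - 1) * 2 ^ (w * m)"
    using Suc.prems[of m] by (intro mult_right_mono) auto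
  moreover have "0 \<le> d m * 2 ^ (w * m)" using Suc.prems[of m] by simp
  moreover have "0 \<le> (\<Sum>p<m. d p * 2 ^ (w * p)) \<and> (\<Sum>p<m. d p * 2 ^ (w * p)) < 2 ^ (w * m)"
    using Suc by simp
  ultimately show ?case by (simp add: power_add algebra_simps)
qed simp

lemma val_block:
  assumes "length bs = w * m" "val bs = (\<Sum>p<m. d p * 2 ^ (w * p))"
    and "\<And>p. p < m \<Longrightarrow> 0 \<le> d p \<and> d p < (2::int) ^ w" and "p < m"
  shows "val (block w p bs) = d p"
  using assms
proof (induction m arbitrary: bs d p)
  case (Suc m)
  let ?s = "\<Sum>p<m. d (Suc p) * 2 ^ (w * p)"
  have "val bs = val (take w bs @ drop w bs)" by simp
  also have "\<dots> = val (take w bs) + 2 ^ w * val (drop w bs)"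
    unfolding horner_sum_append using Suc.prems(1) by (simp add: min_def)
  finally have 1: "val bs = val (take w bs) + 2 ^ w * val (drop w bs)" .
  have 2: "val bs = d 0 + 2 ^ w * ?s"
    unfolding Suc.prems(2) sum.lessThan_Suc_shift
    by (simp add: sum_distrib_left power_add mult_ac)
  have b: "0 \<le> val (take w bs)" "val (take w bs) < 2 ^ w" "0 \<le> d 0" "d 0 < 2 ^ w"
    using val_bounds[of "take w bs"] Suc.prems(1) Suc.prems(3)[of 0] by (auto simp: min_def split: if_splits)
  have "val bs mod 2 ^ w = val (take w bs)" unfolding 1 using b by simp
  moreover have "val bs mod 2 ^ w = d 0" unfolding 2 using b by simp
  ultimately have d0: "val (take w bs) = d 0" by simp
  with 1 2 have s: "val (drop w bs) = ?s" by simp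
  show ?case
  proof (cases p)
    case 0
    then show ?thesis using d0 by (simp add: block_def)
  next
    case (Suc q)
    have "val (block w q (drop w bs)) = d (Suc q)"
      using Suc.prems Suc by (intro Suc.IH[of "drop w bs" "\<lambda>p. d (Suc p)"]) (auto simp: s)
    then show ?thesis by (simp add: block_def Suc add.commute)
  qed
qed simp

lemma val_replicate_False: "val (replicate k False) = 0"
  by (induction k) simp_all

lemma val_mask:
  assumes "w > 0"
  shows "val (concat (replicate m (replicate (w - 1) False @ [True]))) = (\<Sum>p<m. 2 ^ (w - 1) * 2 ^ (w * p))"
proof (induction m)
  case (Suc m)
  define B where "B = replicate (w - 1) False @ [True]"
  have B: "val B = 2 ^ (w - 1)" "length B = w"
    unfolding B_def horner_sum_append using assms by (simp_all add: val_replicate_False)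
  have "val (concat (replicate (Suc m) B)) = val B + 2 ^ w * val (concat (replicate m B))"
    unfolding replicate_Suc concat.simps horner_sum_append B(2) ..
  also have "\<dots> = 2 ^ (w - 1) + 2 ^ w * (\<Sum>p<m. 2 ^ (w - 1) * 2 ^ (w * p))"
    unfolding B(1) Suc[folded B_def] ..
  also have "\<dots> = (\<Sum>p<Suc m. 2 ^ (w - 1) * 2 ^ (w * p))"
    unfolding sum.lessThan_Suc_shift by (simp add: sum_distrib_left power_add mult_ac)
  finally show ?case unfolding B_def .
qed simp

definition pos3 :: "nat \<Rightarrow> nat \<times> nat \<times> nat \<Rightarrow> nat" where
  "pos3 N = (\<lambda>(i, j, k). i * N\<^sup>2 + j * N + k)"

definition kron :: "nat \<Rightarrow> nat \<Rightarrow> nat \<times> nat \<times> nat \<Rightarrow> int" where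
  "kron w N m = 2 ^ (w * pos3 N m)"

lemma kron_add: "kron w N (m + m') = kron w N m * kron w N m'"
  by (cases m; cases m') (simp add: kron_def pos3_def algebra_simps flip: power_add)

definition unpos3 :: "nat \<Rightarrow> nat \<Rightarrow> nat \<times> nat \<times> nat" where
  "unpos3 N p = (p div N\<^sup>2, p div N mod N, p mod N)"

lemma unpos3_pos3:
  assumes "i < N" "j < N" "k < N"
  shows "unpos3 N (pos3 N (i, j, k)) = (i, j, k)" "pos3 N (i, j, k) < N ^ 3"
proof -
  have "j * N + k < j * N + N" using assms by simp
  also have "j * N + N = (j + 1) * N" by simp
  also have "\<dots> \<le> N * N" using assms by (intro mult_le_mono1) simp
  finally have jk: "j * N + k < N\<^sup>2" by (simp add: power2_eq_square)
  have "i * N\<^sup>2 + j * N + k < i * N\<^sup>2 + N\<^sup>2" using jk by simp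
  also have "\<dots> = (i + 1) * N\<^sup>2" by simp
  also have "\<dots> \<le> N * N\<^sup>2" using assms by (intro mult_le_mono1) simp
  finally show "pos3 N (i, j, k) < N ^ 3" by (simp add: pos3_def power3_eq_cube power2_eq_square)
  have "(i * N\<^sup>2 + j * N + k) div N\<^sup>2 = i" using jk by (intro div_nat_eqI) (auto simp: mult.commute)
  moreover have "i * N\<^sup>2 + j * N + k = (i * N + j) * N + k" by (simp add: power2_eq_square algebra_simps)
  ultimately show "unpos3 N (pos3 N (i, j, k)) = (i, j, k)"
    using assms by (simp add: unpos3_def pos3_def)
qed

lemma pos3_unpos3:
  assumes "p < N ^ 3"
  shows "pos3 N (unpos3 N p) = p" "unpos3 N p \<in> {..<N} \<times> {..<N} \<times> {..<N}"
proof -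
  have N: "N > 0" using assms by (cases N) auto
  have "p div N\<^sup>2 = p div N div N" by (simp add: power2_eq_square div_mult2_eq)
  moreover have "p div N div N * N + p div N mod N = p div N" "p div N * N + p mod N = p" by simp_all
  ultimately show "pos3 N (unpos3 N p) = p"
    unfolding pos3_def unpos3_def prod.case power2_eq_square by (metis distrib_right mult.assoc)
  have "p div N\<^sup>2 < N"
    using assms N by (simp add: div_less_iff_less_mult power2_eq_square power3_eq_cube mult.assoc)
  then show "unpos3 N p \<in> {..<N} \<times> {..<N} \<times> {..<N}" using N by (simp add: unpos3_def)
qed

lemma eval3_kron:
  assumes "Poly_Mapping.keys f \<subseteq> {(i, j, k). i + j + k < N}"
  shows "eval3 (kron w N) f = (\<Sum>p<N ^ 3. Poly_Mapping.lookup f (unpos3 N p) * 2 ^ (w * p))"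
proof -
  have "Poly_Mapping.keys f \<subseteq> {..<N} \<times> {..<N} \<times> {..<N}" using assms by fastforce
  then have "eval3 (kron w N) f =
      (\<Sum>m \<in> {..<N} \<times> {..<N} \<times> {..<N}. Poly_Mapping.lookup f m * kron w N m)"
    by (subst eval3_superset) auto
  also have "\<dots> = (\<Sum>p<N ^ 3. Poly_Mapping.lookup f (unpos3 N p) * 2 ^ (w * p))"
    by (rule sum.reindex_bij_witness[of _ "unpos3 N" "pos3 N"])
       (auto simp: unpos3_pos3 pos3_unpos3 kron_def)
  finally show ?thesis .
qed

lemma dense_table_loops:
  "dense_table n f = concat (map (\<lambda>i. concat (map (\<lambda>j. concat (map (\<lambda>k.
     if i + j + k < Suc n then table_entry (Poly_Mapping.lookup f (i, j, k)) else [])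
     [0..<Suc n])) [0..<Suc n])) [0..<Suc n])"
proof -
  have cut: "concat (map g [0..<m]) = concat (map g [0..<l])"
    if "l \<le> m" "\<And>k. l \<le> k \<Longrightarrow> g k = []" for g :: "nat \<Rightarrow> symbol list" and l m
  proof -
    have "[0..<m] = [0..<l] @ [l..<m]" using that(1) by (metis le_add_diff_inverse upt_add_eq_append zero_le)
    moreover have "concat (map g [l..<m]) = []" using that(2) by simp
    ultimately show ?thesis by simp
  qed
  let ?t = "\<lambda>i j k. table_entry (Poly_Mapping.lookup f (i, j, k))"
  have k: "concat (map (\<lambda>k. if i + j + k < Suc n then ?t i j k else []) [0..<Suc n]) =
      (if i + j \<le> n then concat (map (?t i j) [0..<Suc (n - i - j)]) else [])" for i j
  proof (cases "i + j \<le> n")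
    case True
    have "concat (map (\<lambda>k. if i + j + k < Suc n then ?t i j k else []) [0..<Suc n]) =
      concat (map (\<lambda>k. if i + j + k < Suc n then ?t i j k else []) [0..<Suc (n - i - j)])"
      using True by (intro cut) auto
    also have "\<dots> = concat (map (?t i j) [0..<Suc (n - i - j)])"
      using True by (intro arg_cong[where f = concat] map_cong) auto
    finally show ?thesis using True by simp
  qed (simp del: upt_Suc)
  have j: "concat (map (\<lambda>j. if i + j \<le> n then concat (map (?t i j) [0..<Suc (n - i - j)]) else []) [0..<Suc n]) =
      concat (map (\<lambda>j. concat (map (?t i j) [0..<Suc (n - i - j)])) [0..<Suc (n - i)])" if "i \<le> n" for i
  proof -
    have "concat (map (\<lambda>j. if i + j \<le> n then concat (map (?t i j) [0..<Suc (n - i - j)]) else []) [0..<Suc n]) =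
      concat (map (\<lambda>j. if i + j \<le> n then concat (map (?t i j) [0..<Suc (n - i - j)]) else []) [0..<Suc (n - i)])"
      using that by (intro cut) auto
    also have "\<dots> = concat (map (\<lambda>j. concat (map (?t i j) [0..<Suc (n - i - j)])) [0..<Suc (n - i)])"
      using that by (intro arg_cong[where f = concat] map_cong) auto
    finally show ?thesis .
  qed
  have cc: "concat (concat xs) = concat (map concat xs)" for xs :: "symbol list list list"
    by (induction xs) simp_all
  have "dense_table n f = concat (map (\<lambda>i. concat (map (\<lambda>j. concat (map (?t i j)
      [0..<Suc (n - i - j)])) [0..<Suc (n - i)])) [0..<Suc n])"
    by (simp add: dense_table_def triples_def map_concat comp_def cc del: upt_Suc)
  also have "\<dots> = concat (map (\<lambda>i. concat (map (\<lambda>j. concat (map (\<lambda>k.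
     if i + j + k < Suc n then ?t i j k else []) [0..<Suc n])) [0..<Suc n])) [0..<Suc n])"
    unfolding k
  proof (rule arg_cong[where f = concat], rule map_cong[OF refl])
    fix i assume "i \<in> set [0..<Suc n]"
    then have "i \<le> n" by auto
    from j[OF this] show "concat (map (\<lambda>j. concat (map (?t i j) [0..<Suc (n - i - j)])) [0..<Suc (n - i)]) =
      concat (map (\<lambda>j. if i + j \<le> n then concat (map (?t i j) [0..<Suc (n - i - j)]) else []) [0..<Suc n])"
      by (rule sym)
  qed
  finally show ?thesis .
qed

lemma entry_block:
  assumes "length bs = w * N ^ 3" "length cs = w * N ^ 3" "w > 0"
    and "2 ^ (w * N ^ 3) dvd val bs - ((\<Sum>p<N ^ 3. 2 ^ (w - 1) * 2 ^ (w * p)) + eval3 (kron w N) f)"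
    and "2 ^ (w * N ^ 3) dvd val cs - ((\<Sum>p<N ^ 3. 2 ^ (w - 1) * 2 ^ (w * p)) - eval3 (kron w N) f)"
    and "Poly_Mapping.keys f \<subseteq> {(i, j, k). i + j + k < N}"
    and "\<And>m. \<bar>Poly_Mapping.lookup f m\<bar> < 2 ^ (w - 1)"
    and "i < N" "j < N" "k < N"
  shows "entry (block w (i * N\<^sup>2 + j * N + k) bs) (block w (i * N\<^sup>2 + j * N + k) cs) =
    table_entry (Poly_Mapping.lookup f (i, j, k))"
proof -
  define c where "c = (\<lambda>p. Poly_Mapping.lookup f (unpos3 N p))"
  let ?p = "pos3 N (i, j, k)"
  have pow: "(2::int) ^ w = 2 ^ (w - 1) + 2 ^ (w - 1)"
    using assms(3) by (cases w) auto
  have digit: "val (block w ?p xs) = 2 ^ (w - 1) + s * c ?p"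
    if "length xs = w * N ^ 3" "s = 1 \<or> s = -1"
      "2 ^ (w * N ^ 3) dvd val xs - ((\<Sum>p<N ^ 3. 2 ^ (w - 1) * 2 ^ (w * p)) + s * eval3 (kron w N) f)"
    for xs s
  proof (rule val_block[OF that(1)])
    let ?d = "\<lambda>p. 2 ^ (w - 1) + s * c p"
    show b: "0 \<le> ?d p \<and> ?d p < 2 ^ w" for p
      using assms(7)[of "unpos3 N p"] that(2) unfolding c_def pow by auto
    have "(\<Sum>p<N ^ 3. 2 ^ (w - 1) * 2 ^ (w * p)) + s * eval3 (kron w N) f = (\<Sum>p<N ^ 3. ?d p * 2 ^ (w * p))"
      unfolding eval3_kron[OF assms(6)] c_def
      by (simp add: sum.distrib distrib_right sum_distrib_left mult.assoc)
    with that(3) have "val xs mod 2 ^ (w * N ^ 3) = (\<Sum>p<N ^ 3. ?d p * 2 ^ (w * p)) mod 2 ^ (w * N ^ 3)"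
      by (simp only: mod_eq_dvd_iff)
    then show "val xs = (\<Sum>p<N ^ 3. ?d p * 2 ^ (w * p))"
      using val_bounds[of xs] that(1) digit_sum_bounds[of "N ^ 3" ?d w] b
      by simp
    show "?p < N ^ 3" using unpos3_pos3(2) assms(8-10) .
  qed
  have len: "length (block w ?p xs) = w" if "length xs = w * N ^ 3" for xs :: "bool list"
  proof -
    have "w * Suc ?p \<le> w * N ^ 3"
      using unpos3_pos3(2)[OF assms(8-10)] by (intro mult_le_mono2) simp
    then show ?thesis using that by (simp add: block_def)
  qed
  have "entry (block w ?p bs) (block w ?p cs) = table_entry (c ?p)"
    by (rule entry_eq_table_entry[OF len[OF assms(1)] len[OF assms(2)] assms(3)])
       (use digit[OF assms(1), of 1] digit[OF assms(2), of "-1"] assms(4,5) in auto)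
  then show ?thesis
    using unpos3_pos3(1)[OF assms(8-10)] by (simp add: c_def pos3_def)
qed

lemma length_binary: "m < 2 ^ k \<Longrightarrow> k > 0 \<Longrightarrow> length (binary m) \<le> k"
proof (induction k arbitrary: m)
  case (Suc k)
  show ?case
  proof (cases "m < 2")
    case False
    then have "m div 2 < 2 ^ k" "k > 0" using Suc.prems by (auto intro: gr0I)
    with Suc.IH[of "m div 2"] False show ?thesis by (subst binary.simps) simp
  qed (subst binary.simps, simp)
qed simp

section \<open>The program\<close>

text \<open>Tapes, for \<open>N = n + 1\<close>: 2 to 4 are the counters of the three printing loops and 5 is the
  degree counter, of length \<open>N\<close>; 7, 8, 9 are rulers as long as the shifts by \<open>z\<close>, \<open>y\<close>, \<open>x\<close>, and the
  output tape 1, which stays empty until the end, is the ruler for the shift by 1; 10 to 13 hold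
  the traces of \<open>w\<close>, \<open>w A\<close>, \<open>w B\<close>, \<open>w A B\<close>; 14 and 15 start as the mask that has the top bit of
  every block set; 16 holds the number 1 and 17 the carry.\<close>

fun puts :: "nat \<Rightarrow> symbol list \<Rightarrow> com" where
  "puts y [] = move_all Stay []"
| "puts y (s # ss) = put y s ;; puts y ss"

lemma runs_skip: "runs UNIV 1 (move_all Stay []) (st_of h v) (st_of h v)"
  using runs_move_all[of Stay "[]" h v] by simp

lemma runs_puts:
  assumes "h y = int (length (v y))"
  shows "runs UNIV (length ss + 1) (puts y ss) (st_of h v)
    (st_of (h(y := h y + int (length ss))) (v(y := v y @ ss)))"
  using assms
proof (induction ss arbitrary: h v)
  case Nil
  have "h(y := h y + int (length [])) = h" "v(y := v y @ []) = v" by simp_all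
  then show ?case using runs_skip[of h v] by (simp del: fun_upd_apply)
next
  case (Cons s ss)
  let ?h = "h(y := h y + 1)" and ?v = "v(y := v y @ [s])"
  have "runs UNIV (length ss + 1) (puts y ss) (st_of ?h ?v)
    (st_of (?h(y := ?h y + int (length ss))) (?v(y := ?v y @ ss)))"
    using Cons.prems by (intro Cons.IH) simp
  moreover have "?h(y := ?h y + int (length ss)) = h(y := h y + int (length (s # ss)))"
    "?v(y := ?v y @ ss) = v(y := v y @ s # ss)" by (simp_all add: add.assoc)
  ultimately have "runs UNIV (length ss + 1) (puts y ss) (st_of ?h ?v)
    (st_of (h(y := h y + int (length (s # ss)))) (v(y := v y @ s # ss)))" by (simp only:)
  from runs_Seq[OF runs_put[of h y v s, OF Cons.prems] this] show ?case by (simp del: fun_upd_apply)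
qed

abbreviation ready :: "(nat \<Rightarrow> symbol list) \<Rightarrow> st" where
  "ready v \<equiv> st_of (\<lambda>_. 0) v"

definition build :: "(symbol \<Rightarrow> symbol) \<Rightarrow> nat \<Rightarrow> nat \<Rightarrow> symbol list \<Rightarrow> symbol list \<Rightarrow> com" where
  "build f y x ss ss' = puts y ss ;; append_map f y x ;; puts y ss' ;; rewind [y] y"

definition build_rep :: "nat \<Rightarrow> nat \<Rightarrow> symbol list \<Rightarrow> com" where
  "build_rep y x ss = repeat_append 2 y x ;; puts y ss ;; rewind [y] y"

lemma runs_rewind_single:
  assumes "Blank \<notin> set (v y)" "m = length (v y)"
  shows "runs UNIV (2 * m + 3) (rewind [y] y) (st_of ((\<lambda>_. 0)(y := int m)) v) (ready v)"
proof -
  have "shift [y] (- int m) ((\<lambda>_. 0)(y := int m)) = (\<lambda>_. 0)" by (auto simp: shift_def)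
  then show ?thesis
    using runs_rewind[of v y "[y]" "(\<lambda>_. 0)(y := int m)" m] assms by simp
qed

lemma runs_build:
  assumes "v y = []" "x \<noteq> y" "Blank \<notin> set (v x)" "Blank \<notin> set (ss @ map f (v x) @ ss')"
    and "zs = ss @ map f (v x) @ ss'" "3 * length ss + 3 * length ss' + 6 * length (v x) + 9 \<le> T"
  shows "runs UNIV T (build f y x ss ss') (ready v) (ready (v(y := zs)))"
proof -
  let ?a = "length (v x)"
  let ?h = "\<lambda>k. (\<lambda>_. 0 :: int)(y := int k)"
  have "runs UNIV (length ss + 1) (puts y ss) (ready v) (st_of ((\<lambda>_. 0)(y := 0 + int (length ss))) (v(y := v y @ ss)))"
    using assms(1) by (intro runs_puts) simp
  then have 1: "runs UNIV (length ss + 1) (puts y ss) (ready v) (st_of (?h (length ss)) (v(y := ss)))"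
    using assms(1) by simp
  have "runs UNIV (4 * length ((v(y := ss)) x) + 4) (append_map f y x) (st_of (?h (length ss)) (v(y := ss)))
      (st_of ((?h (length ss))(y := ?h (length ss) y + int (length ((v(y := ss)) x))))
        ((v(y := ss))(y := (v(y := ss)) y @ map f ((v(y := ss)) x))))"
    using assms by (intro runs_append_map) auto
  then have 2: "runs UNIV (4 * ?a + 4) (append_map f y x) (st_of (?h (length ss)) (v(y := ss)))
      (st_of (?h (length ss + ?a)) (v(y := ss @ map f (v x))))"
    using assms(2) by simp
  let ?v = "v(y := ss @ map f (v x))"
  have "runs UNIV (length ss' + 1) (puts y ss') (st_of (?h (length ss + ?a)) ?v)
      (st_of ((?h (length ss + ?a))(y := ?h (length ss + ?a) y + int (length ss'))) (?v(y := ?v y @ ss')))"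
    by (intro runs_puts) simp
  then have 3: "runs UNIV (length ss' + 1) (puts y ss') (st_of (?h (length ss + ?a)) ?v)
      (st_of (?h (length zs)) (v(y := zs)))"
    by (simp add: assms(5) add.assoc)
  have 4: "runs UNIV (2 * length zs + 3) (rewind [y] y) (st_of (?h (length zs)) (v(y := zs))) (ready (v(y := zs)))"
    using assms(4,5) by (intro runs_rewind_single) auto
  show ?thesis unfolding build_def
    by (rule runs_mono[OF runs_Seq[OF 1 runs_Seq[OF 2 runs_Seq[OF 3 4]]]]) (use assms(5,6) in simp)
qed

lemma runs_build_rep:
  assumes "v y = []" "distinct [2, x, y]" "Blank \<notin> set (v x)" "Blank \<notin> set (v 2)" "Blank \<notin> set ss"
    and "xs = concat (replicate (length (v 2)) (v x))" "zs = xs @ ss"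
    and "6 * (length (v 2) * length (v x)) + 8 * length (v 2) + 3 * length ss + 8 \<le> T"
  shows "runs UNIV T (build_rep y x ss) (ready v) (ready (v(y := zs)))"
proof -
  let ?N = "length (v 2)" and ?a = "length (v x)"
  let ?h = "\<lambda>k. (\<lambda>_. 0 :: int)(y := int k)"
  have xs: "length xs = ?N * ?a" "set xs \<subseteq> set (v x)"
    by (auto simp: assms(6) length_concat sum_list_replicate)
  have "runs UNIV (?N * (4 * ?a + 8) + 4) (repeat_append 2 y x) (ready v)
      (st_of ((\<lambda>_. 0)(y := 0 + int (length xs))) (v(y := v y @ xs)))"
    using assms by (intro runs_repeat_append) auto
  then have 1: "runs UNIV (?N * (4 * ?a + 8) + 4) (repeat_append 2 y x) (ready v) (st_of (?h (length xs)) (v(y := xs)))"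
    using assms(1) by simp
  let ?v = "v(y := xs)"
  have "runs UNIV (length ss + 1) (puts y ss) (st_of (?h (length xs)) ?v)
      (st_of ((?h (length xs))(y := ?h (length xs) y + int (length ss))) (?v(y := ?v y @ ss)))"
    by (intro runs_puts) simp
  then have 2: "runs UNIV (length ss + 1) (puts y ss) (st_of (?h (length xs)) ?v)
      (st_of (?h (length zs)) (v(y := zs)))"
    by (simp add: assms(7))
  have 3: "runs UNIV (2 * length zs + 3) (rewind [y] y) (st_of (?h (length zs)) (v(y := zs))) (ready (v(y := zs)))"
    using assms(3,5,7) xs(2) by (intro runs_rewind_single) auto
  show ?thesis unfolding build_rep_def
    by (rule runs_mono[OF runs_Seq[OF 1 runs_Seq[OF 2 3]]])
       (use assms(8) in \<open>simp add: assms(7) xs(1) algebra_simps\<close>)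
qed

definition prepare :: com where
  "prepare =
     build (\<lambda>_. Bit False) 2 0 [] [Bit False] ;; build (\<lambda>_. Bit False) 3 0 [] [Bit False] ;;
     build (\<lambda>_. Bit False) 4 0 [] [Bit False] ;; build (\<lambda>_. Bit False) 5 0 [] [Bit False] ;;
     build id 6 1 [] (replicate 16 (Bit False)) ;; build_rep 7 6 [Bit True] ;;
     build_rep 8 7 [] ;; build_rep 9 8 [] ;; build_rep 14 9 [] ;; build_rep 15 9 [] ;;
     build (\<lambda>_. Bit False) 10 14 [] [] ;; build (\<lambda>_. Bit False) 11 14 [] [] ;;
     build (\<lambda>_. Bit False) 12 14 [] [] ;; build (\<lambda>_. Bit False) 13 14 [] [] ;;
     build (\<lambda>_. Bit False) 16 14 [Bit True] []"

text \<open>The width \<open>wid N\<close> of a block leaves room for a sign and the coefficients, which at most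
  double in each of the at most \<open>14 n + 5\<close> transvections.\<close>

definition wid :: "nat \<Rightarrow> nat" where "wid N = 16 * N + 1"
definition siz :: "nat \<Rightarrow> nat" where "siz N = wid N * N ^ 3"

definition mask :: "nat \<Rightarrow> nat \<Rightarrow> bool list" where
  "mask N m = concat (replicate m (replicate (wid N - 1) False @ [True]))"

lemma length_mask: "length (mask N m) = m * wid N"
  by (simp add: mask_def length_concat sum_list_replicate wid_def)

lemma concat_replicate_mult: "concat (replicate m (concat (replicate k xs))) = concat (replicate (m * k) xs)"
  by (induction m) (simp_all add: replicate_add)

definition prepared :: "letter list \<Rightarrow> nat \<Rightarrow> symbol list" where
  "prepared w = (let N = Suc (length w); z = replicate N (Bit False); m = map Bit \<circ> mask N;
       o3 = map Bit (replicate (siz N) False) in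
     (\<lambda>_. [])(0 := map Letter w, 2 := z, 3 := z, 4 := z, 5 := z, 6 := replicate 16 (Bit False),
       7 := m 1, 8 := m N, 9 := m (N\<^sup>2), 14 := m (N ^ 3), 15 := m (N ^ 3),
       10 := o3, 11 := o3, 12 := o3, 13 := o3, 16 := Bit True # o3))"

lemma runs_prepare:
  "runs UNIV (15 * (14 * siz (Suc (length w)) + 100)) prepare (ready ((\<lambda>_. [])(0 := map Letter w)))
     (ready (prepared w))"
proof -
  define N where "N = Suc (length w)"
  define T where "T = 14 * siz N + 100"
  define z where "z = replicate N (Bit False)"
  define m where "m = (\<lambda>k. map Bit (mask N k))"
  define o3 where "o3 = map Bit (replicate (siz N) False)"
  define v1 where "v1 = (\<lambda>_ :: nat. [])(0 := map Letter w)"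
  define v2 where "v2 = v1(2 := z)"
  define v3 where "v3 = v2(3 := z)"
  define v4 where "v4 = v3(4 := z)"
  define v5 where "v5 = v4(5 := z)"
  define v6 where "v6 = v5(6 := replicate 16 (Bit False))"
  define v7 where "v7 = v6(7 := m 1)"
  define v8 where "v8 = v7(8 := m N)"
  define v9 where "v9 = v8(9 := m (N\<^sup>2))"
  define v10 where "v10 = v9(14 := m (N ^ 3))"
  define v11 where "v11 = v10(15 := m (N ^ 3))"
  define v12 where "v12 = v11(10 := o3)"
  define v13 where "v13 = v12(11 := o3)"
  define v14 where "v14 = v13(12 := o3)"
  define v15 where "v15 = v14(13 := o3)"
  note vs = v1_def v2_def v3_def v4_def v5_def v6_def v7_def v8_def v9_def v10_def v11_def v12_def
    v13_def v14_def v15_def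
  have N1: "N \<ge> 1" by (simp add: N_def)
  have NL: "N \<le> siz N"
  proof -
    have "N * 1 \<le> N * (N\<^sup>2 * wid N)" using N1 by (intro mult_le_mono2) (simp add: wid_def Suc_leI)
    then show ?thesis by (simp add: siz_def power3_eq_cube power2_eq_square mult_ac)
  qed
  have nw: "length w \<le> N" "Suc (length w) = N" by (simp_all add: N_def)
  have zw: "map (\<lambda>_. Bit False) (map Letter w) @ [Bit False] = z"
    by (simp add: z_def N_def map_replicate_const flip: replicate_append_same)
  have nb: "Blank \<notin> set (m k)" "Blank \<notin> set z" "Blank \<notin> set (map Letter w)" "Blank \<notin> set o3" for k
    by (auto simp: m_def z_def o3_def)
  have m1: "m 1 = concat (replicate N (replicate 16 (Bit False))) @ [Bit True]"
  proof -
    have "concat (replicate N (replicate 16 (Bit False))) = replicate (16 * N) (Bit False)"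
      using concat_replicate_mult[of N 16 "[Bit False]"] by (simp add: mult.commute concat_replicate_single)
    then show ?thesis by (simp add: m_def mask_def wid_def)
  qed
  have mm: "m (N * k) = concat (replicate N (m k))" for k
    by (simp add: m_def mask_def map_concat concat_replicate_mult)
  have lm: "length (m k) = k * wid N" for k by (simp add: m_def length_mask)
  have lz: "length z = N" by (simp add: z_def)
  have lo: "map (\<lambda>_. Bit False) (m (N ^ 3)) = o3"
    by (simp add: o3_def map_replicate_const lm siz_def mult.commute)
  have L3: "N ^ 3 * wid N = siz N" by (simp add: siz_def)
  have L2: "N * (N\<^sup>2 * wid N) = siz N" by (simp add: siz_def power3_eq_cube power2_eq_square)
  have LN: "N * (k * wid N) \<le> siz N" if "k \<le> N\<^sup>2" for k
    unfolding L2[symmetric] using that by simp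
  have b0: "runs UNIV T (build (\<lambda>_. Bit False) y 0 [] [Bit False]) (ready v) (ready (v(y := z)))"
    if "v 0 = map Letter w" "v y = []" "y \<noteq> 0" for v y
    by (rule runs_build) (use that nb nw NL zw in \<open>auto simp: T_def\<close>)
  have 2: "runs UNIV T (build (\<lambda>_. Bit False) 2 0 [] [Bit False]) (ready v1) (ready v2)"
    unfolding v2_def by (rule b0) (simp_all add: vs)
  have 3: "runs UNIV T (build (\<lambda>_. Bit False) 3 0 [] [Bit False]) (ready v2) (ready v3)"
    unfolding v3_def by (rule b0) (simp_all add: vs)
  have 4: "runs UNIV T (build (\<lambda>_. Bit False) 4 0 [] [Bit False]) (ready v3) (ready v4)"
    unfolding v4_def by (rule b0) (simp_all add: vs)
  have 5: "runs UNIV T (build (\<lambda>_. Bit False) 5 0 [] [Bit False]) (ready v4) (ready v5)"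
    unfolding v5_def by (rule b0) (simp_all add: vs)
  have 6: "runs UNIV T (build id 6 1 [] (replicate 16 (Bit False))) (ready v5) (ready v6)"
    unfolding v6_def by (rule runs_build) (simp_all add: vs T_def)
  have 7: "runs UNIV T (build_rep 7 6 [Bit True]) (ready v6) (ready v7)"
    unfolding v7_def
  proof (rule runs_build_rep[where xs = "concat (replicate N (replicate 16 (Bit False)))"])
    have "6 * (N * 16) + 8 * N + 11 \<le> T"
    proof -
      have "16 * N * 1 \<le> wid N * N ^ 3" using N1 by (intro mult_le_mono) (simp_all add: wid_def)
      then have "16 * N \<le> siz N" by (simp add: siz_def)
      then show ?thesis by (simp add: T_def)
    qed
    then show "6 * (length (v6 2) * length (v6 6)) + 8 * length (v6 2) + 3 * length [Bit True] + 8 \<le> T"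
      by (simp add: vs lz)
  qed (use nb m1 in \<open>simp_all add: vs lz\<close>)
  have rep: "runs UNIV T (build_rep y x []) (ready v) (ready (v(y := m (N * k))))"
    if "v 2 = z" "v y = []" "distinct [2, x, y]" "v x = m k" "k \<le> N\<^sup>2" for v y x k
  proof (rule runs_build_rep[where xs = "m (N * k)"])
    show "6 * (length (v 2) * length (v x)) + 8 * length (v 2) + 3 * length [] + 8 \<le> T"
      using LN[OF that(5)] NL by (simp add: that lz lm T_def)
  qed (use nb that mm lz in simp_all)
  have N2: "N \<le> N\<^sup>2" "1 \<le> N\<^sup>2" using N1 by (simp_all add: power2_eq_square)
  have 8: "runs UNIV T (build_rep 8 7 []) (ready v7) (ready v8)"
    unfolding v8_def using rep[of v7 8 7 1] N2 by (simp add: vs)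
  have 9: "runs UNIV T (build_rep 9 8 []) (ready v8) (ready v9)"
    unfolding v9_def using rep[of v8 9 8 N] N2 by (simp add: vs power2_eq_square)
  have 10: "runs UNIV T (build_rep 14 9 []) (ready v9) (ready v10)"
    unfolding v10_def using rep[of v9 14 9 "N\<^sup>2"] by (simp add: vs power2_eq_square power3_eq_cube mult.assoc)
  have 11: "runs UNIV T (build_rep 15 9 []) (ready v10) (ready v11)"
    unfolding v11_def using rep[of v10 15 9 "N\<^sup>2"] by (simp add: vs power2_eq_square power3_eq_cube mult.assoc)
  have fill: "runs UNIV T (build (\<lambda>_. Bit False) y 14 ss []) (ready v) (ready (v(y := ss @ o3)))"
    if "v 14 = m (N ^ 3)" "v y = []" "y \<noteq> 14" "Blank \<notin> set ss" "length ss \<le> 1" for v y ss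
    by (rule runs_build) (use that nb lo in \<open>auto simp: T_def lm L3\<close>)
  have 12: "runs UNIV T (build (\<lambda>_. Bit False) 10 14 [] []) (ready v11) (ready v12)"
    unfolding v12_def using fill[of v11 10 "[]"] by (simp add: vs)
  have 13: "runs UNIV T (build (\<lambda>_. Bit False) 11 14 [] []) (ready v12) (ready v13)"
    unfolding v13_def using fill[of v12 11 "[]"] by (simp add: vs)
  have 14: "runs UNIV T (build (\<lambda>_. Bit False) 12 14 [] []) (ready v13) (ready v14)"
    unfolding v14_def using fill[of v13 12 "[]"] by (simp add: vs)
  have 15: "runs UNIV T (build (\<lambda>_. Bit False) 13 14 [] []) (ready v14) (ready v15)"
    unfolding v15_def using fill[of v14 13 "[]"] by (simp add: vs)
  have 16: "runs UNIV T (build (\<lambda>_. Bit False) 16 14 [Bit True] []) (ready v15) (ready (v15(16 := Bit True # o3)))"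
    using fill[of v15 16 "[Bit True]"] by (simp add: vs)
  have fin: "v15(16 := Bit True # o3) = prepared w"
    unfolding prepared_def Let_def vs N_def[symmetric] z_def o3_def m_def comp_def ..
  show ?thesis
    unfolding prepare_def fin[symmetric] v1_def[symmetric] N_def[symmetric] T_def[symmetric]
    by (rule runs_mono[OF runs_Seq[OF 2 runs_Seq[OF 3 runs_Seq[OF 4 runs_Seq[OF 5 runs_Seq[OF 6
      runs_Seq[OF 7 runs_Seq[OF 8 runs_Seq[OF 9 runs_Seq[OF 10 runs_Seq[OF 11 runs_Seq[OF 12
      runs_Seq[OF 13 runs_Seq[OF 14 runs_Seq[OF 15 16]]]]]]]]]]]]]]]) simp
qed

fun add_regs :: "transvection list \<Rightarrow> com" where
  "add_regs [] = move_all Stay []"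
| "add_regs ((d, s, r, n) # ops) = add_reg d s r n ;; add_regs ops"

definition powers :: "nat \<Rightarrow> nat \<Rightarrow> int" where
  "powers N = mon (kron (wid N) N (1, 0, 0)) (kron (wid N) N (0, 1, 0)) (kron (wid N) N (0, 0, 1))"

text \<open>Register 16 is only a source of additions and may be longer than the others.\<close>

definition holds :: "nat \<Rightarrow> letter list \<Rightarrow> (nat \<Rightarrow> symbol list) \<Rightarrow> (nat \<Rightarrow> int) \<Rightarrow> bool" where
  "holds N w v V \<longleftrightarrow> v 0 = map Letter w \<and> v 1 = [] \<and> v 17 = [] \<and>
     (\<forall>y \<in> {2, 3, 4, 5}. v y = replicate N (Bit False)) \<and>
     (\<forall>y \<in> {7, 8, 9}. Blank \<notin> set (v y)) \<and>
     length (v 7) = wid N \<and> length (v 8) = wid N * N \<and> length (v 9) = wid N * N\<^sup>2 \<and>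
     (\<forall>r \<in> {10..16}. \<exists>bs. v r = map Bit bs \<and> siz N \<le> length bs \<and>
        (r < 16 \<longrightarrow> length bs = siz N) \<and> 2 ^ siz N dvd val bs - V r)"

definition valid_op :: "transvection \<Rightarrow> bool" where
  "valid_op = (\<lambda>(d, s, r, n). d \<in> {10..15} \<and> s \<in> {10..16} \<and> d \<noteq> s \<and> r \<in> {1, 7, 8, 9})"

lemma runs_op:
  assumes "holds N w v V" "valid_op (d, s, r, n)" "\<forall>i > 0. h i = 0" "N > 0"
  shows "\<exists>v'. runs UNIV (8 * siz N + 13) (add_reg d s r n) (st_of h v) (st_of h v') \<and>
    holds N w v' (apply_op (powers N) (d, s, r, n) V)"
proof -
  have op: "d \<in> {10..15}" "s \<in> {10..16}" "d \<noteq> s" "r \<in> {1, 7, 8, 9}"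
    using assms(2) by (auto simp: valid_op_def)
  have "d \<in> {10..16}" "d < 16" using op by auto
  then obtain xs where xs: "v d = map Bit xs" "length xs = siz N" "2 ^ siz N dvd val xs - V d"
    using assms(1) unfolding holds_def by blast
  obtain ys where ys: "v s = map Bit ys" "siz N \<le> length ys" "2 ^ siz N dvd val ys - V s"
    using assms(1) op(2) unfolding holds_def by blast
  have N2: "wid N * N \<le> siz N" "wid N * N\<^sup>2 \<le> siz N" "wid N \<le> siz N"
    using assms(4) power_increasing[of 1 3 N] power_increasing[of 2 3 N] power_increasing[of 0 3 N]
    by (auto simp: siz_def)
  have r: "Blank \<notin> set (v r)" "length (v r) \<le> siz N" "powers N r = 2 ^ length (v r)"
    using op(4) assms(1) N2 by (auto simp: holds_def powers_def mon_def kron_def pos3_def)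
  let ?k = "length (v r)"
  let ?zs = "add_at ?k n xs ys"
  let ?v = "v(d := map Bit ?zs)"
  have 1: "runs UNIV (8 * length xs + 13) (add_reg d s r n) (st_of h v) (st_of h ?v)"
  proof (rule runs_add_reg)
    show "v 17 = []" using assms(1) by (simp add: holds_def)
  qed (use op assms(3) xs ys r in auto)
  obtain q where q: "val ?zs = val xs + (if n then - 1 else 1) * 2 ^ ?k * val ys + q * 2 ^ siz N"
    using val_add_at[of ?k xs ys n] xs ys r by auto
  have "val ?zs - apply_op (powers N) (d, s, r, n) V d =
      (val xs - V d) + (if n then - 1 else 1) * 2 ^ ?k * (val ys - V s) + q * 2 ^ siz N"
    unfolding q by (simp add: apply_op_def r(3) right_diff_distrib)
  then have "2 ^ siz N dvd val ?zs - apply_op (powers N) (d, s, r, n) V d"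
    using xs(3) ys(3) by simp
  moreover have "length ?zs = siz N" using length_add_at[of ?k xs ys n] xs ys r by simp
  moreover have "apply_op (powers N) (d, s, r, n) V i = V i" if "i \<noteq> d" for i
    using that by (simp add: apply_op_def)
  ultimately have "\<exists>bs. ?v i = map Bit bs \<and> siz N \<le> length bs \<and> (i < 16 \<longrightarrow> length bs = siz N) \<and>
      2 ^ siz N dvd val bs - apply_op (powers N) (d, s, r, n) V i" if "i \<in> {10..16}" for i
  proof (cases "i = d")
    case True
    with \<open>length ?zs = siz N\<close> \<open>2 ^ siz N dvd val ?zs - _\<close> show ?thesis
      by (intro exI[of _ ?zs]) simp
  next
    case False
    then show ?thesis using assms(1) that \<open>\<And>i. i \<noteq> d \<Longrightarrow> _\<close> by (simp add: holds_def)
  qed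
  moreover have "d \<notin> {0, 1, 2, 3, 4, 5, 7, 8, 9, 17}" using op(1) by auto
  ultimately have "holds N w ?v (apply_op (powers N) (d, s, r, n) V)"
    using assms(1) unfolding holds_def by simp
  with 1 show ?thesis unfolding xs(2) by blast
qed

lemma runs_ops:
  assumes "holds N w v V" "\<forall>op \<in> set ops. valid_op op" "\<forall>i > 0. h i = 0" "N > 0"
  shows "\<exists>v'. runs UNIV (length ops * (8 * siz N + 13) + 1) (add_regs ops) (st_of h v) (st_of h v') \<and>
    holds N w v' (apply_ops (powers N) ops V)"
  using assms(1,2)
proof (induction ops arbitrary: v V)
  case Nil
  then show ?case using runs_skip by (auto simp: apply_ops_def)
next
  case (Cons op ops)
  obtain d s r n where op: "op = (d, s, r, n)" by (cases op)
  obtain v1 where v1: "runs UNIV (8 * siz N + 13) (add_reg d s r n) (st_of h v) (st_of h v1)"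
    "holds N w v1 (apply_op (powers N) op V)"
    using runs_op[OF Cons.prems(1) _ assms(3,4), of d s r n] Cons.prems(2) op by auto
  obtain v2 where v2: "runs UNIV (length ops * (8 * siz N + 13) + 1) (add_regs ops) (st_of h v1) (st_of h v2)"
    "holds N w v2 (apply_ops (powers N) ops (apply_op (powers N) op V))"
    using Cons.IH[OF v1(2)] Cons.prems(2) by auto
  from runs_Seq[OF v1(1) v2(1)] v2(2) show ?case
    by (intro exI[of _ v2]) (simp add: op apply_ops_def)
qed

definition letter_com :: com where
  "letter_com = Cond (\<lambda>rd. rd 0 = Letter Let_a) (add_regs (letter_ops Let_a))
     (Cond (\<lambda>rd. rd 0 = Letter Let_a_inv) (add_regs (letter_ops Let_a_inv))
     (Cond (\<lambda>rd. rd 0 = Letter Let_b) (add_regs (letter_ops Let_b))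
       (add_regs (letter_ops Let_b_inv))))"

lemma runs_letter_com:
  assumes "holds N w v V" "N > 0" "k < length w" "\<forall>i > 0. h i = 0" "h 0 = int k"
  shows "\<exists>v'. runs UNIV (14 * (8 * siz N + 13) + 4) letter_com (st_of h v) (st_of h v') \<and>
    holds N w v' (apply_ops (powers N) (letter_ops (w ! k)) V)"
proof -
  have "\<forall>op \<in> set (letter_ops (w ! k)). valid_op op"
    using letter_ops_distinct[of "w ! k"] by (fastforce simp: valid_op_def)
  then obtain v' where v': "runs UNIV (length (letter_ops (w ! k)) * (8 * siz N + 13) + 1)
      (add_regs (letter_ops (w ! k))) (st_of h v) (st_of h v')"
    "holds N w v' (apply_ops (powers N) (letter_ops (w ! k)) V)"
    using runs_ops[OF assms(1) _ assms(4,2)] by blast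
  have "length (letter_ops (w ! k)) \<le> 14"
    by (cases "w ! k") (simp_all add: ops_a_def ops_b_def rotate_ops_def inverse_ops_def)
  then have "length (letter_ops (w ! k)) * (8 * siz N + 13) + 1 \<le> 14 * (8 * siz N + 13) + 1"
    by (intro add_mono mult_le_mono1) simp_all
  from runs_mono[OF v'(1) this]
  have r: "runs UNIV T (add_regs (letter_ops l)) (st_of h v) (st_of h v')"
    if "l = w ! k" "14 * (8 * siz N + 13) + 1 \<le> T" for l T
    unfolding that(1) by (rule runs_mono) (rule that(2))
  have sc: "scan (st_of h v) 0 = Letter (w ! k)"
    using assms(1,3,5) by (simp add: holds_def tape_of_def)
  have "runs UNIV (Suc (Suc (Suc (14 * (8 * siz N + 13) + 1)))) letter_com (st_of h v) (st_of h v')"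
    unfolding letter_com_def
  proof (intro runs_Cond)
    assume "scan (st_of h v) 0 = Letter Let_a"
    then show "runs UNIV (Suc (Suc (14 * (8 * siz N + 13) + 1))) (add_regs (letter_ops Let_a)) (st_of h v) (st_of h v')"
      using sc by (intro r) auto
  next
    assume "scan (st_of h v) 0 = Letter Let_a_inv"
    then show "runs UNIV (Suc (14 * (8 * siz N + 13) + 1)) (add_regs (letter_ops Let_a_inv)) (st_of h v) (st_of h v')"
      using sc by (intro r) auto
  next
    assume "scan (st_of h v) 0 = Letter Let_b"
    then show "runs UNIV (14 * (8 * siz N + 13) + 1) (add_regs (letter_ops Let_b)) (st_of h v) (st_of h v')"
      using sc by (intro r) auto
  next
    assume "scan (st_of h v) 0 \<noteq> Letter Let_a" "scan (st_of h v) 0 \<noteq> Letter Let_a_inv"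
      "scan (st_of h v) 0 \<noteq> Letter Let_b"
    then have "w ! k = Let_b_inv" using sc by (cases "w ! k") auto
    then show "runs UNIV (14 * (8 * siz N + 13) + 1) (add_regs (letter_ops Let_b_inv)) (st_of h v) (st_of h v')"
      by (intro r) auto
  qed
  then have "runs UNIV (14 * (8 * siz N + 13) + 4) letter_com (st_of h v) (st_of h v')"
    by (simp add: eval_nat_numeral)
  with v'(2) show ?thesis by blast
qed

lemma runs_letters:
  assumes "holds N w v V" "N > length w"
    and "14 * (8 * siz N + 13) + 3 * N + 4 \<le> b"
  shows "\<exists>v'. runs {-int b..int b} (length w * (14 * (8 * siz N + 13) + 8) + 4) (for_each [0] 0 letter_com)
      (ready v) (ready v') \<and> holds N w v' (apply_ops (powers N) (concat (map letter_ops w)) V)"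
proof -
  define T where "T = 14 * (8 * siz N + 13) + 4"
  let ?S = "{-int b..int b}"
  let ?h = "\<lambda>k. shift [0] (int k) (\<lambda>_. 0)"
  let ?V = "\<lambda>k. apply_ops (powers N) (concat (map letter_ops (take k w))) V"
  define P where "P = (\<lambda>k v. k \<le> length w \<longrightarrow> holds N w v (?V k))"
  define Q where "Q = (\<lambda>k v v'. k < length w \<longrightarrow> runs ?S T letter_com (st_of (?h k) v) (st_of (?h k) v'))"
  have ex: "\<exists>v'. P (Suc k) v' \<and> Q k u v'" if "P k u" for k u
  proof (cases "k < length w")
    case True
    then have "holds N w u (?V k)" using that by (simp add: P_def)
    from runs_letter_com[OF this _ True, of "?h k"] assms(2)
    obtain v' where v': "runs UNIV T letter_com (st_of (?h k) u) (st_of (?h k) v')"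
      "holds N w v' (apply_ops (powers N) (letter_ops (w ! k)) (?V k))"
      by (auto simp: T_def shift_apply)
    have "apply_ops (powers N) (letter_ops (w ! k)) (?V k) = ?V (Suc k)"
      using True by (simp add: take_Suc_conv_app_nth apply_ops_append)
    moreover have "runs ?S T letter_com (st_of (?h k) u) (st_of (?h k) v')"
      using v'(1)
    proof (rule runs_local)
      fix i
      show "{fst (st_of (?h k) u) i - int T..fst (st_of (?h k) u) i + int T} \<subseteq> ?S"
        using True assms(2,3) by (auto simp: shift_apply T_def)
    qed
    ultimately show ?thesis using v'(2) by (auto simp: P_def Q_def)
  qed (simp add: P_def Q_def)
  obtain u where u: "u 0 = v" "\<And>k. P k (u k)" "\<And>k. Q k (u k) (u (Suc k))"
  proof -
    have "\<exists>u. \<forall>k. (P k (u k) \<and> (k = 0 \<longrightarrow> u k = v)) \<and> Q k (u k) (u (Suc k))"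
      by (rule dependent_nat_choice) (use ex assms(1) in \<open>auto simp: P_def apply_ops_def\<close>)
    then show ?thesis using that by blast
  qed
  have "runs ?S (length w * (T + 4) + 4) (for_each [0] 0 letter_com) (st_of (\<lambda>_. 0) (u 0)) (st_of (\<lambda>_. 0) (u (length w)))"
  proof (rule runs_for_each)
    fix k assume "k \<le> length w"
    then have "u k 0 = map Letter w" using u(2)[of k] by (simp add: P_def holds_def)
    then show "Blank \<notin> set (u k 0) \<and> length (u k 0) = length w \<and> (0 :: int) = 0" by auto
  next
    fix k assume "k < length w"
    then show "runs ?S T letter_com (st_of (?h k) (u k)) (st_of (?h k) (u (Suc k)))"
      using u(3)[of k] by (simp add: Q_def)
  next
    show "{0 - int (2 * length w + 3)..0 + int (3 * length w + 3)} \<subseteq> ?S"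
      using assms(2,3) by auto
  qed simp
  moreover have "holds N w (u (length w)) (?V (length w))" using u(2)[of "length w"] by (simp add: P_def)
  ultimately show ?thesis by (auto simp: u(1) T_def)
qed

text \<open>The last two additions prepare both \<open>mask + f\<close> and \<open>mask - f\<close>: the top bit of a
  block of the former tells the sign of a coefficient, and its absolute value is then read off
  the remaining bits of the former or the latter.\<close>

definition table_com :: com where
  "table_com = prepare ;; add_regs start_ops ;; for_each [0] 0 letter_com ;;
     add_regs [(14, 10, 1, False), (15, 10, 1, True)] ;; put_table"

definition mask_val :: "nat \<Rightarrow> int" where
  "mask_val N = (\<Sum>p<N ^ 3. 2 ^ (wid N - 1) * 2 ^ (wid N * p))"

lemma holds_prepared:
  assumes "N = Suc (length w)"
  shows "holds N w (prepared w) (unit_vec(14 := mask_val N, 15 := mask_val N))"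
proof -
  have "val (mask N (N ^ 3)) = mask_val N"
    unfolding mask_def mask_val_def by (rule val_mask) (simp add: wid_def)
  then have k: "\<exists>bs. map Bit (mask N (N ^ 3)) = map Bit bs \<and> siz N \<le> length bs \<and> length bs = siz N \<and>
      2 ^ siz N dvd val bs - mask_val N"
    by (intro exI[of _ "mask N (N ^ 3)"]) (simp add: length_mask siz_def mult.commute)
  have z: "\<exists>bs. map Bit (replicate (siz N) False) = map Bit bs \<and> siz N \<le> length bs \<and> length bs = siz N \<and>
      2 ^ siz N dvd val bs - 0"
    by (intro exI[of _ "replicate (siz N) False"]) (simp add: val_replicate_False)
  have o: "\<exists>bs. Bit True # map Bit (replicate (siz N) False) = map Bit bs \<and> siz N \<le> length bs \<and>
      2 ^ siz N dvd val bs - 1"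
    by (intro exI[of _ "True # replicate (siz N) False"]) (simp add: val_replicate_False)
  have R: "{10..16} = {10, 11, 12, 13, 14, 15, 16 :: nat}" by auto
  show ?thesis
    unfolding holds_def R using k z o
    by (simp add: prepared_def Let_def unit_vec_def length_mask assms[symmetric] mult.commute del: map_replicate) auto
qed

lemma apply_ops_agree:
  assumes "\<forall>(d, s, r, n) \<in> set ops. d \<in> R \<and> s \<in> R" "\<forall>i \<in> R. V i = V' i"
  shows "(\<forall>i \<in> R. apply_ops \<mu> ops V i = apply_ops \<mu> ops V' i) \<and> (\<forall>i. i \<notin> R \<longrightarrow> apply_ops \<mu> ops V i = V i)"
  using assms
proof (induction ops arbitrary: V V')
  case (Cons op ops)
  obtain d s r n where op: "op = (d, s, r, n)" by (cases op)
  have "d \<in> R" "s \<in> R" using Cons.prems(1) op by auto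
  have "(\<forall>i \<in> R. apply_ops \<mu> ops (apply_op \<mu> op V) i = apply_ops \<mu> ops (apply_op \<mu> op V') i) \<and>
      (\<forall>i. i \<notin> R \<longrightarrow> apply_ops \<mu> ops (apply_op \<mu> op V) i = apply_op \<mu> op V i)"
    using Cons.prems \<open>d \<in> R\<close> \<open>s \<in> R\<close> by (intro Cons.IH) (auto simp: op apply_op_def)
  then show ?case using \<open>d \<in> R\<close> by (auto simp: apply_ops_def op apply_op_def)
qed (simp add: apply_ops_def)

lemma kron_word_poly:
  "apply_ops (powers N) (word_ops w) (unit_vec(14 := c, 15 := c)) i =
    (if i \<in> {10, 11, 12, 13, 16} then eval3 (kron (wid N) N) (word_poly w i)
     else (unit_vec(14 := c, 15 := c)) i)"
proof -
  let ?R = "{10, 11, 12, 13, 16} :: nat set"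
  have 1: "kron (wid N) N (0, 0, 0) = 1" by (simp add: kron_def pos3_def)
  have "(\<lambda>i. eval3 (kron (wid N) N) (word_poly w i)) = apply_ops (powers N) (word_ops w) unit_vec"
    unfolding word_poly_def powers_def
    by (simp only: eval3_apply_ops[of "kron (wid N) N", OF kron_add 1] eval3_unit_vec[of "kron (wid N) N", OF 1])
  then have 2: "eval3 (kron (wid N) N) (word_poly w i) = apply_ops (powers N) (word_ops w) unit_vec i" for i
    by (rule fun_cong)
  have "{10..13} \<subseteq> ?R" by auto
  then have "\<forall>(d, s, r, n) \<in> set (word_ops w). d \<in> ?R \<and> s \<in> ?R"
    using letter_ops_distinct by (fastforce simp: word_ops_def start_ops_def)
  from apply_ops_agree[OF this, of "unit_vec(14 := c, 15 := c)" unit_vec "powers N"]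
  show ?thesis unfolding 2 by (auto simp: unit_vec_def)
qed

lemma abs_lookup_less:
  assumes "N = Suc (length w)"
  shows "\<bar>Poly_Mapping.lookup (trace_poly w) m\<bar> < 2 ^ (wid N - 1)"
proof -
  have "(2 :: int) ^ (5 + 14 * length w) < 2 ^ (wid N - 1)"
    by (rule power_strict_increasing) (simp_all add: assms wid_def)
  then show ?thesis using abs_lookup_trace_poly[of w m] by linarith
qed

lemma siz_bounds:
  assumes "N > 0"
  shows "N ^ 3 \<le> siz N" "17 \<le> siz N" "siz N \<le> 17 * N ^ 4" "N \<le> N ^ 3" "N\<^sup>2 \<le> N ^ 3"
proof -
  show *: "N \<le> N ^ 3" "N\<^sup>2 \<le> N ^ 3"
    using assms power_increasing[of 1 3 N] power_increasing[of 2 3 N] by auto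
  show "N ^ 3 \<le> siz N" by (simp add: siz_def wid_def)
  have "17 * 1 \<le> wid N * N ^ 3" using assms by (intro mult_le_mono) (simp_all add: wid_def Suc_leI)
  then show "17 \<le> siz N" by (simp add: siz_def)
  have "wid N * N ^ 3 \<le> (17 * N) * N ^ 3" using assms by (intro mult_le_mono1) (simp add: wid_def)
  then show "siz N \<le> 17 * N ^ 4" by (simp add: siz_def power4_eq_xxxx power3_eq_cube mult_ac)
qed

lemma concat_map_cong3:
  assumes "\<And>i j k. i < N \<Longrightarrow> j < N \<Longrightarrow> k < N \<Longrightarrow> f i j k = g i j k"
  shows "concat (map (\<lambda>i. concat (map (\<lambda>j. concat (map (f i j) [0..<N])) [0..<N])) [0..<N]) =
    concat (map (\<lambda>i. concat (map (\<lambda>j. concat (map (g i j) [0..<N])) [0..<N])) [0..<N])"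
proof -
  have 1: "concat (map (f i j) [0..<N]) = concat (map (g i j) [0..<N])" if "i < N" "j < N" for i j
    by (rule arg_cong[where f = concat], rule map_cong[OF refl]) (use that assms in auto)
  have 2: "concat (map (\<lambda>j. concat (map (f i j) [0..<N])) [0..<N]) =
    concat (map (\<lambda>j. concat (map (g i j) [0..<N])) [0..<N])" if "i < N" for i
    by (rule arg_cong[where f = concat], rule map_cong[OF refl], rule 1) (use that in auto)
  show ?thesis
    by (rule arg_cong[where f = concat], rule map_cong[OF refl], rule 2) auto
qed

lemma runs_table_com:
  assumes "N = Suc (length w)" "b = 6000 * N ^ 4"
  shows "\<exists>h v. runs {-int b..int b} (12000 * N ^ 5) table_com
      (\<lambda>_. 0, (\<lambda>_. blank_tape)(0 := tape_of (map Letter w))) (st_of h v) \<and>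
    v 1 = dense_table (length w) (trace_poly w)"
proof -
  let ?S = "{-int b..int b}" and ?L = "siz N" and ?W = "wid N"
  let ?V0 = "unit_vec(14 := mask_val N, 15 := mask_val N)"
  have N: "N > 0" "N > length w" using assms(1) by auto
  note sb = siz_bounds[OF N(1)]
  have bL: "?L \<le> 17 * N ^ 4" "N ^ 3 \<le> N ^ 4" "1 \<le> N ^ 4" "N \<le> N ^ 4"
    using sb power_increasing[of 3 4 N] power_increasing[of 0 4 N] power_increasing[of 1 4 N] N by auto
  have loc: "runs ?S T c (ready v) \<sigma>'" if "runs UNIV T c (ready v) \<sigma>'" "T \<le> b" for T c v \<sigma>'
    using that(1) by (rule runs_local) (use that(2) in auto)
  have T1: "15 * (14 * ?L + 100) \<le> b"
  proof -
    have "15 * (14 * ?L + 100) = 210 * ?L + 1500" by simp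
    then show ?thesis using bL assms(2) by linarith
  qed
  have 1: "runs ?S (15 * (14 * ?L + 100)) prepare (ready ((\<lambda>_. [])(0 := map Letter w))) (ready (prepared w))"
    using runs_prepare[of w] T1 by (intro loc) (simp_all add: assms(1))
  have st: "\<forall>op \<in> set start_ops. valid_op op" by (simp add: start_ops_def valid_op_def)
  obtain v1 where v1: "runs UNIV (length start_ops * (8 * ?L + 13) + 1) (add_regs start_ops) (ready (prepared w)) (ready v1)"
    "holds N w v1 (apply_ops (powers N) start_ops ?V0)"
    using runs_ops[OF holds_prepared[OF assms(1)] st _ N(1), where h = "\<lambda>_. 0"] by auto
  have T2: "length start_ops * (8 * ?L + 13) + 1 \<le> b" using bL assms(2) by (simp add: start_ops_def)
  note 2 = loc[OF v1(1) T2]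
  have T3: "14 * (8 * ?L + 13) + 3 * N + 4 \<le> b"
  proof -
    have "14 * (8 * ?L + 13) = 112 * ?L + 182" by simp
    then show ?thesis using bL assms(2) by linarith
  qed
  obtain v2 where 3: "runs ?S (length w * (14 * (8 * ?L + 13) + 8) + 4) (for_each [0] 0 letter_com) (ready v1) (ready v2)"
    and v2: "holds N w v2 (apply_ops (powers N) (word_ops w) ?V0)"
    using runs_letters[OF v1(2) N(2) T3] by (auto simp: word_ops_def apply_ops_append)
  let ?ops = "[(14, 10, 1, False), (15, 10, 1, True)]"
  have fin: "\<forall>op \<in> set ?ops. valid_op op" by (simp add: valid_op_def)
  obtain v3 where v3: "runs UNIV (length ?ops * (8 * ?L + 13) + 1) (add_regs ?ops) (ready v2) (ready v3)"
    and h3: "holds N w v3 (apply_ops (powers N) ?ops (apply_ops (powers N) (word_ops w) ?V0))"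
    using runs_ops[OF v2 fin _ N(1), where h = "\<lambda>_. 0"] by auto
  have T4: "length ?ops * (8 * ?L + 13) + 1 \<le> b" using bL assms(2) by simp
  note 4 = loc[OF v3 T4]
  let ?f = "trace_poly w"
  let ?V = "apply_ops (powers N) ?ops (apply_ops (powers N) (word_ops w) ?V0)"
  have V: "?V 14 = mask_val N + eval3 (kron ?W N) ?f" "?V 15 = mask_val N - eval3 (kron ?W N) ?f"
  proof -
    have "powers N 1 = 1" by (simp add: powers_def mon_def)
    then show "?V 14 = mask_val N + eval3 (kron ?W N) ?f" "?V 15 = mask_val N - eval3 (kron ?W N) ?f"
      by (simp_all add: apply_ops_Nil apply_ops_Cons apply_op_def kron_word_poly trace_poly_eq_word_poly
          del: One_nat_def)
  qed
  have reg: "\<exists>bs. v3 r = map Bit bs \<and> length bs = ?W * N ^ 3 \<and> 2 ^ (?W * N ^ 3) dvd val bs - ?V r"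
    if "r \<in> {10..16}" "r < 16" for r
    using h3 that unfolding holds_def siz_def by blast
  obtain bs where bs: "v3 14 = map Bit bs" "length bs = ?W * N ^ 3"
    "2 ^ (?W * N ^ 3) dvd val bs - (mask_val N + eval3 (kron ?W N) ?f)"
    using reg[of 14] unfolding V by auto
  obtain cs where cs: "v3 15 = map Bit cs" "length cs = ?W * N ^ 3"
    "2 ^ (?W * N ^ 3) dvd val cs - (mask_val N - eval3 (kron ?W N) ?f)"
    using reg[of 15] unfolding V by auto
  have W0: "?W > 0" by (simp add: wid_def)
  have v3: "length (v3 7) = ?W" "v3 1 = []" "Blank \<notin> set (v3 7)"
    "\<And>y. y \<in> {2, 3, 4, 5} \<Longrightarrow> length (v3 y) = N \<and> Blank \<notin> set (v3 y)"
    using h3 by (auto simp: holds_def)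
  obtain h' where 5: "runs UNIV (N * (N * (N * (11 * ?W + 22) + 8) + 8) + 4) put_table (ready v3)
    (st_of h' (v3(1 := concat (map (\<lambda>i. concat (map (\<lambda>j. concat (map (\<lambda>k.
       if i + j + k < N then entry (block ?W (i * N\<^sup>2 + j * N + k) bs) (block ?W (i * N\<^sup>2 + j * N + k) cs)
       else []) [0..<N])) [0..<N])) [0..<N]))))"
    by (rule exE[OF runs_put_table[OF bs(1) cs(1) bs(2) cs(2) v3(1) W0 v3(2,3,4)]])
  have T5': "N * (N * (N * (11 * ?W + 22) + 8) + 8) + 4 \<le> 11 * ?L + 42 * N ^ 3"
  proof -
    have "N * (N * (N * (11 * ?W + 22) + 8) + 8) + 4 = 11 * ?L + 22 * N ^ 3 + 8 * N\<^sup>2 + 8 * N + 4"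
      by (simp add: siz_def power3_eq_cube power2_eq_square algebra_simps)
    then show ?thesis using sb N(1) by linarith
  qed
  then have T5: "N * (N * (N * (11 * ?W + 22) + 8) + 8) + 4 \<le> b" using bL assms(2) by linarith
  have keys: "Poly_Mapping.keys ?f \<subseteq> {(i, j, k). i + j + k < N}"
    using keys_trace_poly[of w] assms(1) by (auto simp: less_Suc_eq_le)
  have out: "concat (map (\<lambda>i. concat (map (\<lambda>j. concat (map (\<lambda>k.
       if i + j + k < N then entry (block ?W (i * N\<^sup>2 + j * N + k) bs) (block ?W (i * N\<^sup>2 + j * N + k) cs)
       else []) [0..<N])) [0..<N])) [0..<N]) = dense_table (length w) ?f"
    unfolding dense_table_loops assms(1)[symmetric]
    by (rule concat_map_cong3, rule if_cong[OF refl _ refl],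
        rule entry_block[OF bs(2) cs(2) W0 bs(3)[unfolded mask_val_def] cs(3)[unfolded mask_val_def]
            keys abs_lookup_less[OF assms(1)]])
  define P where "P = st_of h' (v3(1 := dense_table (length w) ?f))"
  have T_sum: "15 * (14 * ?L + 100) + (length start_ops * (8 * ?L + 13) + 1 +
      (length w * (14 * (8 * ?L + 13) + 8) + 4 + (length ?ops * (8 * ?L + 13) + 1 +
      (N * (N * (N * (11 * ?W + 22) + 8) + 8) + 4)))) \<le> 12000 * N ^ 5"
  proof -
    define X where "X = N * (N * (N * (11 * ?W + 22) + 8) + 8) + 4"
    define Y where "Y = length w * (14 * (8 * ?L + 13) + 8)"
    have "Y \<le> N * (14 * (8 * (17 * N ^ 4) + 13) + 8)"
      unfolding Y_def using N(2) bL(1) by (intro mult_le_mono add_mono) auto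
    also have "\<dots> = 1904 * (N * N ^ 4) + 190 * N" by (simp add: algebra_simps)
    also have "N * N ^ 4 = N ^ 5" by (simp flip: power_Suc)
    finally have Y: "Y \<le> 1904 * N ^ 5 + 190 * N" .
    have X: "X \<le> 11 * ?L + 42 * N ^ 3" unfolding X_def by (rule T5')
    have N45: "N ^ 4 \<le> N ^ 5" using N(1) by (intro power_increasing) auto
    have "length start_ops = 5" "length ?ops = 2" by (simp_all add: start_ops_def)
    then show ?thesis
      unfolding X_def[symmetric] Y_def[symmetric] using X Y N45 bL by simp
  qed
  have init: "(\<lambda>_. 0, (\<lambda>_. blank_tape)(0 := tape_of (map Letter w))) = ready ((\<lambda>_. [])(0 := map Letter w))"
    by (auto simp: st_of_def tapes_of_def fun_eq_iff blank_tape_def tape_of_def)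
  have "runs ?S (12000 * N ^ 5) table_com
      (\<lambda>_. 0, (\<lambda>_. blank_tape)(0 := tape_of (map Letter w))) P"
    unfolding init table_com_def P_def
    by (rule runs_mono[OF runs_Seq[OF 1 runs_Seq[OF 2 runs_Seq[OF 3 runs_Seq[OF 4 loc[OF 5[unfolded out] T5]]]]] T_sum])
  then show ?thesis unfolding P_def
    by (intro exI conjI, assumption) simp
qed

lemma wf_move_all: "\<forall>y \<in> set Y. y < k \<Longrightarrow> wf_com k (move_all m Y)"
  by (auto simp: move_all_def)

lemma wf_put: "y < k \<Longrightarrow> s \<in> symbols \<Longrightarrow> wf_com k (put y s)"
  by (auto simp: put_def idle_def)

lemma wf_forward: "\<forall>y \<in> set Y. y < k \<Longrightarrow> wf_com k (forward Y y)"
  by (simp add: forward_def wf_move_all)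

lemma wf_rewind: "\<forall>y \<in> set Y. y < k \<Longrightarrow> wf_com k (rewind Y y)"
  by (simp add: rewind_def wf_move_all)

lemma wf_for_each: "\<forall>y \<in> set Y. y < k \<Longrightarrow> wf_com k c \<Longrightarrow> wf_com k (for_each Y y c)"
  by (simp add: for_each_def wf_move_all wf_rewind)

lemma wf_append_map:
  "x < k \<Longrightarrow> y < k \<Longrightarrow> (\<And>s. s \<in> symbols \<Longrightarrow> f s \<in> symbols) \<Longrightarrow> wf_com k (append_map f y x)"
  by (auto simp: append_map_def idle_def wf_rewind)

lemma wf_puts: "y < k \<Longrightarrow> set ss \<subseteq> symbols \<Longrightarrow> wf_com k (puts y ss)"
  by (induction ss) (auto simp: wf_move_all wf_put)

lemma wf_build:
  "x < k \<Longrightarrow> y < k \<Longrightarrow> (\<And>s. s \<in> symbols \<Longrightarrow> f s \<in> symbols) \<Longrightarrow> set ss \<subseteq> symbols \<Longrightarrow>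
    set ss' \<subseteq> symbols \<Longrightarrow> wf_com k (build f y x ss ss')"
  by (simp add: build_def wf_puts wf_append_map wf_rewind)

lemma wf_build_rep: "x < k \<Longrightarrow> y < k \<Longrightarrow> 2 < k \<Longrightarrow> set ss \<subseteq> symbols \<Longrightarrow> wf_com k (build_rep y x ss)"
  by (simp add: build_rep_def repeat_append_def wf_puts wf_for_each wf_append_map wf_rewind)

lemma Bit_symbols [simp]: "Bit b \<in> symbols" "Blank \<in> symbols" "Plus \<in> symbols" "Minus \<in> symbols" "Sep \<in> symbols"
  by (simp_all add: symbols_def)

lemma wf_add_reg: "d < 18 \<Longrightarrow> s < 18 \<Longrightarrow> r < 18 \<Longrightarrow> wf_com 18 (add_reg d s r n)"
  by (auto simp: add_reg_def add_loop_def add_step_def idle_def Let_def wf_forward wf_rewind)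

lemma wf_add_regs: "\<forall>(d, s, r, n) \<in> set ops. d < 18 \<and> s < 18 \<and> r < 18 \<Longrightarrow> wf_com 18 (add_regs ops)"
  by (induction ops rule: add_regs.induct) (auto simp: wf_move_all wf_add_reg)

lemma wf_letter_ops: "wf_com 18 (add_regs (letter_ops l))"
  using letter_ops_distinct[of l] by (intro wf_add_regs) fastforce

lemma wf_put_mag: "x < 18 \<Longrightarrow> wf_com 18 (put_mag x)"
  by (auto simp: put_mag_def idle_def wf_move_all wf_put)

lemma wf_put_table: "wf_com 18 put_table"
  by (simp add: put_table_def put_cell_def put_entry_def wf_for_each wf_forward wf_rewind wf_move_all
      wf_put wf_put_mag)

lemma wf_table_com: "wf_com 18 table_com"
proof -
  have "wf_com 18 prepare"
    by (simp add: prepare_def wf_build wf_build_rep)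
  moreover have "wf_com 18 (add_regs start_ops)" "wf_com 18 (add_regs [(14, 10, 1, False), (15, 10, 1, True)])"
    by (intro wf_add_regs; simp add: start_ops_def)+
  moreover have "wf_com 18 letter_com"
    unfolding letter_com_def by (simp only: wf_com.simps wf_letter_ops simp_thms)
  ultimately show ?thesis
    unfolding table_com_def wf_com.simps by (intro conjI wf_for_each wf_put_table) auto
qed

lemma bigo_power:
  assumes "\<And>n. f n \<le> c * Suc n ^ k"
  shows "(\<lambda>n. real (f n)) \<in> O(\<lambda>n. real n ^ k)"
proof (rule bigoI[where c = "real c * 2 ^ k"])
  show "\<forall>\<^sub>F n in sequentially. norm (real (f n)) \<le> real c * 2 ^ k * norm (real n ^ k)"
    using eventually_ge_at_top[of 1]
  proof eventually_elim
    case (elim n)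
    have "Suc n ^ k \<le> (2 * n) ^ k" using elim by (intro power_mono) auto
    with assms[of n] have "f n \<le> c * (2 * n) ^ k" by (meson mult_le_mono2 order_trans)
    then have "real (f n) \<le> real (c * (2 * n) ^ k)" by (rule of_nat_mono)
    then show ?case by (simp add: power_mult_distrib mult.assoc)
  qed
qed

lemma length_dense_table: "length (dense_table (length w) (trace_poly w)) \<le> 18 * Suc (length w) ^ 4"
proof -
  define N where "N = Suc (length w)"
  have N: "N \<ge> 1" by (simp add: N_def)
  have e: "length (table_entry (Poly_Mapping.lookup (trace_poly w) t)) \<le> 18 * N" for t
  proof -
    have "\<bar>Poly_Mapping.lookup (trace_poly w) t\<bar> < 2 ^ (16 * N)"
      using abs_lookup_less[OF N_def, of t] by (simp add: wid_def)
    then have "nat \<bar>Poly_Mapping.lookup (trace_poly w) t\<bar> < 2 ^ (16 * N)"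
      by (simp add: nat_less_iff)
    then have "length (binary (nat \<bar>Poly_Mapping.lookup (trace_poly w) t\<bar>)) \<le> 16 * N"
      using N by (intro length_binary) auto
    then show ?thesis using N by (simp add: table_entry_def)
  qed
  have "length (concat (map g xs)) \<le> length xs * c" if "\<And>t. length (g t) \<le> c"
    for g :: "nat \<times> nat \<times> nat \<Rightarrow> symbol list" and xs c
    by (induction xs) (auto intro: add_mono that)
  from this[OF e] have 1: "length (dense_table (length w) (trace_poly w)) \<le> length (triples (length w)) * (18 * N)"
    unfolding dense_table_def .
  have "length (triples (length w)) = card (set (triples (length w)))"
    by (rule distinct_card[OF distinct_triples, symmetric])
  also have "\<dots> \<le> card ({..<N} \<times> {..<N} \<times> {..<N})"
    by (intro card_mono) (auto simp: set_triples N_def)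
  also have "\<dots> = N ^ 3" by (simp add: power3_eq_cube)
  finally have "length (triples (length w)) * (18 * N) \<le> N ^ 3 * (18 * N)" by (rule mult_le_mono1)
  also have "\<dots> = 18 * N ^ 4" by (simp add: power4_eq_xxxx power3_eq_cube)
  finally show ?thesis using 1 by (simp add: N_def)
qed

theorem theorem1p6:
  shows "(\<exists>(M :: tm) (T :: nat \<Rightarrow> nat) (S :: nat \<Rightarrow> nat).
            valid_tm M \<and>
            (\<lambda>n. real (T n)) \<in> O(\<lambda>n. real n ^ 5) \<and>
            (\<lambda>n. real (S n)) \<in> O(\<lambda>n. real n ^ 4) \<and>
            (\<forall>w. cyclically_reduced w \<longrightarrow>
               computes_within M (map Letter w) (dense_table (length w) (trace_poly w))
                 (T (length w)) (S (length w)))) \<and>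
         (\<exists>L :: nat \<Rightarrow> nat.
            (\<lambda>n. real (L n)) \<in> O(\<lambda>n. real n ^ 4) \<and>
            (\<forall>w. cyclically_reduced w \<longrightarrow>
               length (dense_table (length w) (trace_poly w)) \<le> L (length w)))"
proof (rule conjI)
  let ?T = "\<lambda>n. 12000 * Suc n ^ 5"
  let ?S = "\<lambda>n. 18 * (2 * (6000 * Suc n ^ 4) + 1)"
  have "computes_within (machine 18 table_com) (map Letter w) (dense_table (length w) (trace_poly w))
      (?T (length w)) (?S (length w))" for w
  proof -
    obtain h v where "runs {- int (6000 * Suc (length w) ^ 4)..int (6000 * Suc (length w) ^ 4)}
        (12000 * Suc (length w) ^ 5) table_com
        (\<lambda>_. 0, (\<lambda>_. blank_tape)(0 := tape_of (map Letter w))) (st_of h v)"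
      and "v 1 = dense_table (length w) (trace_poly w)"
      using runs_table_com[OF refl refl] by blast
    then show ?thesis
      by (intro machine_computes[OF wf_table_com]) auto
  qed
  moreover have "valid_tm (machine 18 table_com)"
    by (rule valid_machine[OF wf_table_com]) simp
  moreover have "(\<lambda>n. real (?T n)) \<in> O(\<lambda>n. real n ^ 5)"
    by (rule bigo_power[where c = 12000]) simp
  moreover have "(\<lambda>n. real (?S n)) \<in> O(\<lambda>n. real n ^ 4)"
  proof (rule bigo_power)
    fix n :: nat
    have "1 \<le> Suc n ^ 4" by simp
    moreover have "?S n = 216000 * Suc n ^ 4 + 18" by simp
    ultimately show "?S n \<le> 220000 * Suc n ^ 4" by linarith
  qed
  ultimately show "\<exists>(M :: tm) (T :: nat \<Rightarrow> nat) (S :: nat \<Rightarrow> nat).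
            valid_tm M \<and>
            (\<lambda>n. real (T n)) \<in> O(\<lambda>n. real n ^ 5) \<and>
            (\<lambda>n. real (S n)) \<in> O(\<lambda>n. real n ^ 4) \<and>
            (\<forall>w. cyclically_reduced w \<longrightarrow>
               computes_within M (map Letter w) (dense_table (length w) (trace_poly w))
                 (T (length w)) (S (length w)))"
    by (intro exI[of _ "machine 18 table_com"] exI[of _ ?T] exI[of _ ?S]) blast
  show "\<exists>L :: nat \<Rightarrow> nat.
            (\<lambda>n. real (L n)) \<in> O(\<lambda>n. real n ^ 4) \<and>
            (\<forall>w. cyclically_reduced w \<longrightarrow>
               length (dense_table (length w) (trace_poly w)) \<le> L (length w))"
    using length_dense_table bigo_power[of "\<lambda>n. 18 * Suc n ^ 4" 18 4]
    by (intro exI[of _ "\<lambda>n. 18 * Suc n ^ 4"]) simp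
qed

end
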